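(* Let $B\,|\,C$ be a Frobenius ring extension, with underlying unital ring homomorphism $C\to B$, and let $A=\operatorname{End} B_C$ be the endomorphism ring of the right $C$-module $B$, regarded as a ring extension $A\,|\,B$ via the left regular map $\lambda: B\to A$, $\lambda(x)(b)=xb$. If the tower of rings $A\,|\,B\,|\,C$ is right depth three (i.e. the extension $B\,|\,C$ is rD3), then the composite ring extension $A\,|\,C$ (via $C\to B\to A$) is depth two, i.e. both right depth two and left depth two.
   Context: Rings are associative with identity and ring homomorphisms preserve identities. A ring extension $A\,|\,B$ is a ring homomorphism $B\to A$; a tower of rings $A\,|\,B\,|\,C$ is a pair of ring homomorphisms $C\to B\to A$. All bimodule structures are the natural ones induced by these maps. $X\oplus *\cong Y$ means $X$ is isomorphic to a direct summand of $Y$. A ring extension $B\,|\,C$ is Frobenius if there are a $C$-$C$-bimodule homomorphism $E:B\to C$ and finitely many elements $x_i,y_i\in B$ with $\sum_i E(bx_i)y_i=b=\sum_i x_iE(y_ib)$ for all $b\in B$ (values of $E$ acting on $B$ through $C\to B$). A tower $A\,|\,B\,|\,C$ is right depth three (rD3) if for some positive integer $N$, $A\otimes_B A\oplus *\cong A^N$ as $A$-$C$-bimodules. A ring extension $A\,|\,C$ is right depth two if for some positive integer $N$, $A\otimes_C A\oplus *\cong A^N$ as $A$-$C$-bimodules; left depth two if for some positive integer $N$, $A\otimes_C A\oplus *\cong A^N$ as $C$-$A$-bimodules; and depth two (D2) if it is both. *)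

theory Defs
  imports "HOL-Algebra.Module" "HOL-Algebra.RingHom" "HOL-Algebra.Free_Abelian_Groups"
begin

section \<open>Bimodules\<close>

text \<open>
  Rings are not assumed commutative, so a bimodule carries a left action (inherited from
  \<^type>\<open>module\<close>) and a separate right action. As for modules in HOL-Algebra, only the additive
  part of the underlying ring record is meaningful; its multiplicative fields are ignored.
\<close>

record ('a, 'b, 's) bimodule = "('a, 'b) module" +
  rsmult :: "['b, 's] \<Rightarrow> 'b" (infixl \<open>\<odot>\<^sub>r\<index>\<close> 70)

locale bimodule = R?: ring R + S?: ring S + M?: abelian_group M
  for R :: "('r, 'p) ring_scheme" (structure) and S :: "('s, 'q) ring_scheme" (structure)
    and M :: "('r, 'b, 's, 'm) bimodule_scheme" (structure) +
  assumes smult_closed: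
      "\<lbrakk>a \<in> carrier R; x \<in> carrier M\<rbrakk> \<Longrightarrow> a \<odot>\<^bsub>M\<^esub> x \<in> carrier M"
    and smult_l_distr:
      "\<lbrakk>a \<in> carrier R; b \<in> carrier R; x \<in> carrier M\<rbrakk>
        \<Longrightarrow> (a \<oplus>\<^bsub>R\<^esub> b) \<odot>\<^bsub>M\<^esub> x = a \<odot>\<^bsub>M\<^esub> x \<oplus>\<^bsub>M\<^esub> b \<odot>\<^bsub>M\<^esub> x"
    and smult_r_distr:
      "\<lbrakk>a \<in> carrier R; x \<in> carrier M; y \<in> carrier M\<rbrakk>
        \<Longrightarrow> a \<odot>\<^bsub>M\<^esub> (x \<oplus>\<^bsub>M\<^esub> y) = a \<odot>\<^bsub>M\<^esub> x \<oplus>\<^bsub>M\<^esub> a \<odot>\<^bsub>M\<^esub> y"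
    and smult_assoc:
      "\<lbrakk>a \<in> carrier R; b \<in> carrier R; x \<in> carrier M\<rbrakk>
        \<Longrightarrow> (a \<otimes>\<^bsub>R\<^esub> b) \<odot>\<^bsub>M\<^esub> x = a \<odot>\<^bsub>M\<^esub> (b \<odot>\<^bsub>M\<^esub> x)"
    and smult_one: "x \<in> carrier M \<Longrightarrow> \<one>\<^bsub>R\<^esub> \<odot>\<^bsub>M\<^esub> x = x"
    and rsmult_closed:
      "\<lbrakk>x \<in> carrier M; s \<in> carrier S\<rbrakk> \<Longrightarrow> x \<odot>\<^sub>r\<^bsub>M\<^esub> s \<in> carrier M"
    and rsmult_l_distr:
      "\<lbrakk>x \<in> carrier M; y \<in> carrier M; s \<in> carrier S\<rbrakk>
        \<Longrightarrow> (x \<oplus>\<^bsub>M\<^esub> y) \<odot>\<^sub>r\<^bsub>M\<^esub> s = x \<odot>\<^sub>r\<^bsub>M\<^esub> s \<oplus>\<^bsub>M\<^esub> y \<odot>\<^sub>r\<^bsub>M\<^esub> s"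
    and rsmult_r_distr:
      "\<lbrakk>x \<in> carrier M; s \<in> carrier S; t \<in> carrier S\<rbrakk>
        \<Longrightarrow> x \<odot>\<^sub>r\<^bsub>M\<^esub> (s \<oplus>\<^bsub>S\<^esub> t) = x \<odot>\<^sub>r\<^bsub>M\<^esub> s \<oplus>\<^bsub>M\<^esub> x \<odot>\<^sub>r\<^bsub>M\<^esub> t"
    and rsmult_assoc:
      "\<lbrakk>x \<in> carrier M; s \<in> carrier S; t \<in> carrier S\<rbrakk>
        \<Longrightarrow> x \<odot>\<^sub>r\<^bsub>M\<^esub> (s \<otimes>\<^bsub>S\<^esub> t) = (x \<odot>\<^sub>r\<^bsub>M\<^esub> s) \<odot>\<^sub>r\<^bsub>M\<^esub> t"
    and rsmult_one: "x \<in> carrier M \<Longrightarrow> x \<odot>\<^sub>r\<^bsub>M\<^esub> \<one>\<^bsub>S\<^esub> = x"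
    and smult_rsmult:
      "\<lbrakk>a \<in> carrier R; x \<in> carrier M; s \<in> carrier S\<rbrakk>
        \<Longrightarrow> (a \<odot>\<^bsub>M\<^esub> x) \<odot>\<^sub>r\<^bsub>M\<^esub> s = a \<odot>\<^bsub>M\<^esub> (x \<odot>\<^sub>r\<^bsub>M\<^esub> s)"

definition bimodule_hom ::
    "('r, 'p) ring_scheme \<Rightarrow> ('s, 'q) ring_scheme \<Rightarrow> ('r, 'a, 's, 'm) bimodule_scheme
      \<Rightarrow> ('r, 'b, 's, 'n) bimodule_scheme \<Rightarrow> ('a \<Rightarrow> 'b) set"
  where "bimodule_hom R S M N =
    {h \<in> carrier M \<rightarrow> carrier N.
      (\<forall>x\<in>carrier M. \<forall>y\<in>carrier M. h (x \<oplus>\<^bsub>M\<^esub> y) = h x \<oplus>\<^bsub>N\<^esub> h y) \<and>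
      (\<forall>r\<in>carrier R. \<forall>x\<in>carrier M. h (r \<odot>\<^bsub>M\<^esub> x) = r \<odot>\<^bsub>N\<^esub> h x) \<and>
      (\<forall>x\<in>carrier M. \<forall>s\<in>carrier S. h (x \<odot>\<^sub>r\<^bsub>M\<^esub> s) = h x \<odot>\<^sub>r\<^bsub>N\<^esub> s)}"

definition sub_bimodule ::
    "('r, 'p) ring_scheme \<Rightarrow> ('s, 'q) ring_scheme \<Rightarrow> 'b set
      \<Rightarrow> ('r, 'b, 's, 'm) bimodule_scheme \<Rightarrow> bool"
  where "sub_bimodule R S P M \<longleftrightarrow>
    additive_subgroup P M \<and>
    (\<forall>r\<in>carrier R. \<forall>x\<in>P. r \<odot>\<^bsub>M\<^esub> x \<in> P) \<and>
    (\<forall>x\<in>P. \<forall>s\<in>carrier S. x \<odot>\<^sub>r\<^bsub>M\<^esub> s \<in> P)"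

definition direct_summand ::
    "('r, 'p) ring_scheme \<Rightarrow> ('s, 'q) ring_scheme \<Rightarrow> 'b set
      \<Rightarrow> ('r, 'b, 's, 'm) bimodule_scheme \<Rightarrow> bool"
  where "direct_summand R S P M \<longleftrightarrow>
    sub_bimodule R S P M \<and>
    (\<exists>Q. sub_bimodule R S Q M \<and> P \<inter> Q = {\<zero>\<^bsub>M\<^esub>} \<and> P <+>\<^bsub>M\<^esub> Q = carrier M)"

text \<open>\<open>X \<oplus> * \<cong> Y\<close>: \<open>X\<close> is isomorphic to an (internal) direct summand of \<open>Y\<close>.\<close>

definition iso_direct_summand ::
    "('r, 'p) ring_scheme \<Rightarrow> ('s, 'q) ring_scheme \<Rightarrow> ('r, 'a, 's, 'm) bimodule_scheme
      \<Rightarrow> ('r, 'b, 's, 'n) bimodule_scheme \<Rightarrow> bool"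
  where "iso_direct_summand R S X Y \<longleftrightarrow>
    (\<exists>P h. direct_summand R S P Y \<and>
      h \<in> bimodule_hom R S X (Y\<lparr>carrier := P\<rparr>) \<and> bij_betw h (carrier X) P)"

definition bimodule_power ::
    "('r, 'b, 's, 'm) bimodule_scheme \<Rightarrow> nat \<Rightarrow> ('r, nat \<Rightarrow> 'b, 's) bimodule"
  where "bimodule_power M n =
    \<lparr>carrier = {..<n} \<rightarrow>\<^sub>E carrier M, monoid.mult = undefined, one = undefined,
     ring.zero = (\<lambda>i\<in>{..<n}. \<zero>\<^bsub>M\<^esub>),
     add = (\<lambda>x y. \<lambda>i\<in>{..<n}. x i \<oplus>\<^bsub>M\<^esub> y i),
     smult = (\<lambda>r x. \<lambda>i\<in>{..<n}. r \<odot>\<^bsub>M\<^esub> x i),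
     rsmult = (\<lambda>x s. \<lambda>i\<in>{..<n}. x i \<odot>\<^sub>r\<^bsub>M\<^esub> s)\<rparr>"

text \<open>The ring \<open>A\<close> as a bimodule, acted on from the left through \<open>f : R \<rightarrow> A\<close> and from the right
  through \<open>g : S \<rightarrow> A\<close>.\<close>

definition ring_bimodule ::
    "('a, 'm) ring_scheme \<Rightarrow> ('r \<Rightarrow> 'a) \<Rightarrow> ('s \<Rightarrow> 'a) \<Rightarrow> ('r, 'a, 's) bimodule"
  where "ring_bimodule A f g =
    \<lparr>carrier = carrier A, monoid.mult = monoid.mult A, one = one A, ring.zero = \<zero>\<^bsub>A\<^esub>, add = add A,
     smult = (\<lambda>r x. f r \<otimes>\<^bsub>A\<^esub> x),
     rsmult = (\<lambda>x s. x \<otimes>\<^bsub>A\<^esub> g s)\<rparr>"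


section \<open>Tensor products\<close>

text \<open>
  \<open>M \<otimes>\<^sub>B N\<close> is the free abelian group on \<open>M \<times> N\<close> modulo the subgroup generated by the
  biadditivity and \<open>B\<close>-balancing relations. The left action of \<open>M\<close> and the right action of \<open>N\<close>
  are extended additively to the free group. As the elements of the quotient are cosets, the
  result of an action on a coset \<open>X\<close> is the coset containing the image of \<open>X\<close>, obtained by
  adding the relation subgroup to that image.
\<close>

definition tensor_free ::
    "('r, 'a, 'b, 'm) bimodule_scheme \<Rightarrow> ('b, 'c, 's, 'n) bimodule_scheme
      \<Rightarrow> ('a \<times> 'c \<Rightarrow>\<^sub>0 int) monoid"
  where "tensor_free M N = free_Abelian_group (carrier M \<times> carrier N)"

definition tensor_relations ::
    "('b, 'q) ring_scheme \<Rightarrow> ('r, 'a, 'b, 'm) bimodule_scheme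
      \<Rightarrow> ('b, 'c, 's, 'n) bimodule_scheme \<Rightarrow> ('a \<times> 'c \<Rightarrow>\<^sub>0 int) set"
  where "tensor_relations B M N =
    {frag_of (x \<oplus>\<^bsub>M\<^esub> x', y) - (frag_of (x, y) + frag_of (x', y)) | x x' y.
      x \<in> carrier M \<and> x' \<in> carrier M \<and> y \<in> carrier N} \<union>
    {frag_of (x, y \<oplus>\<^bsub>N\<^esub> y') - (frag_of (x, y) + frag_of (x, y')) | x y y'.
      x \<in> carrier M \<and> y \<in> carrier N \<and> y' \<in> carrier N} \<union>
    {frag_of (x \<odot>\<^sub>r\<^bsub>M\<^esub> b, y) - frag_of (x, b \<odot>\<^bsub>N\<^esub> y) | x b y.
      x \<in> carrier M \<and> b \<in> carrier B \<and> y \<in> carrier N}"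

definition tensor_kernel ::
    "('b, 'q) ring_scheme \<Rightarrow> ('r, 'a, 'b, 'm) bimodule_scheme
      \<Rightarrow> ('b, 'c, 's, 'n) bimodule_scheme \<Rightarrow> ('a \<times> 'c \<Rightarrow>\<^sub>0 int) set"
  where "tensor_kernel B M N = generate (tensor_free M N) (tensor_relations B M N)"

definition tensor_bimodule ::
    "('b, 'q) ring_scheme \<Rightarrow> ('r, 'a, 'b, 'm) bimodule_scheme
      \<Rightarrow> ('b, 'c, 's, 'n) bimodule_scheme \<Rightarrow> ('r, ('a \<times> 'c \<Rightarrow>\<^sub>0 int) set, 's) bimodule"
  where "tensor_bimodule B M N =
    (let F = tensor_free M N; K = tensor_kernel B M N; T = F Mod K in
    \<lparr>carrier = carrier T, monoid.mult = undefined, one = undefined,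
     ring.zero = \<one>\<^bsub>T\<^esub>,
     add = monoid.mult T,
     smult = (\<lambda>r X. K <#>\<^bsub>F\<^esub> frag_extend (\<lambda>(x, y). frag_of (r \<odot>\<^bsub>M\<^esub> x, y)) ` X),
     rsmult = (\<lambda>X s. K <#>\<^bsub>F\<^esub> frag_extend (\<lambda>(x, y). frag_of (x, y \<odot>\<^sub>r\<^bsub>N\<^esub> s)) ` X)\<rparr>)"


section \<open>Ring extensions\<close>

text \<open>A ring extension \<open>A | B\<close> is a homomorphism \<open>f : B \<rightarrow> A\<close>, expressed by
  \<^locale>\<open>ring_hom_ring\<close>.\<close>

definition frobenius_extension ::
    "('b, 'm) ring_scheme \<Rightarrow> ('c, 'n) ring_scheme \<Rightarrow> ('c \<Rightarrow> 'b) \<Rightarrow> bool"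
  where "frobenius_extension B C f \<longleftrightarrow>
    ring_hom_ring C B f \<and>
    (\<exists>E n x y. E \<in> bimodule_hom C C (ring_bimodule B f f) (ring_bimodule C id id) \<and>
      x \<in> {..<n::nat} \<rightarrow> carrier B \<and> y \<in> {..<n} \<rightarrow> carrier B \<and>
      (\<forall>b\<in>carrier B.
        (\<Oplus>\<^bsub>B\<^esub>i\<in>{..<n}. f (E (b \<otimes>\<^bsub>B\<^esub> x i)) \<otimes>\<^bsub>B\<^esub> y i) = b \<and>
        (\<Oplus>\<^bsub>B\<^esub>i\<in>{..<n}. x i \<otimes>\<^bsub>B\<^esub> f (E (y i \<otimes>\<^bsub>B\<^esub> b))) = b))"

text \<open>The tower \<open>A | B | C\<close> is given by \<open>f : C \<rightarrow> B\<close> and \<open>g : B \<rightarrow> A\<close>.\<close>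

definition right_depth_three ::
    "('a, 'l) ring_scheme \<Rightarrow> ('b, 'm) ring_scheme \<Rightarrow> ('c, 'n) ring_scheme
      \<Rightarrow> ('b \<Rightarrow> 'a) \<Rightarrow> ('c \<Rightarrow> 'b) \<Rightarrow> bool"
  where "right_depth_three A B C g f \<longleftrightarrow>
    ring_hom_ring C B f \<and> ring_hom_ring B A g \<and>
    (\<exists>N>0. iso_direct_summand A C
      (tensor_bimodule B (ring_bimodule A id g) (ring_bimodule A g (g \<circ> f)))
      (bimodule_power (ring_bimodule A id (g \<circ> f)) N))"

definition right_depth_two ::
    "('a, 'l) ring_scheme \<Rightarrow> ('c, 'n) ring_scheme \<Rightarrow> ('c \<Rightarrow> 'a) \<Rightarrow> bool"
  where "right_depth_two A C f \<longleftrightarrow>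
    ring_hom_ring C A f \<and>
    (\<exists>N>0. iso_direct_summand A C
      (tensor_bimodule C (ring_bimodule A id f) (ring_bimodule A f f))
      (bimodule_power (ring_bimodule A id f) N))"

definition left_depth_two ::
    "('a, 'l) ring_scheme \<Rightarrow> ('c, 'n) ring_scheme \<Rightarrow> ('c \<Rightarrow> 'a) \<Rightarrow> bool"
  where "left_depth_two A C f \<longleftrightarrow>
    ring_hom_ring C A f \<and>
    (\<exists>N>0. iso_direct_summand C A
      (tensor_bimodule C (ring_bimodule A f f) (ring_bimodule A f id))
      (bimodule_power (ring_bimodule A f id) N))"

definition depth_two ::
    "('a, 'l) ring_scheme \<Rightarrow> ('c, 'n) ring_scheme \<Rightarrow> ('c \<Rightarrow> 'a) \<Rightarrow> bool"
  where "depth_two A C f \<longleftrightarrow> right_depth_two A C f \<and> left_depth_two A C f"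


section \<open>Endomorphism rings\<close>

text \<open>Endomorphisms of the underlying right \<open>S\<close>-module of \<open>M\<close>. They are extensional functions
  (undefined outside the carrier), so that equal endomorphisms are equal as functions.\<close>

definition right_End ::
    "('s, 'q) ring_scheme \<Rightarrow> ('r, 'b, 's, 'm) bimodule_scheme \<Rightarrow> ('b \<Rightarrow> 'b) ring"
  where "right_End S M =
    \<lparr>carrier = {h \<in> carrier M \<rightarrow>\<^sub>E carrier M.
       (\<forall>x\<in>carrier M. \<forall>y\<in>carrier M. h (x \<oplus>\<^bsub>M\<^esub> y) = h x \<oplus>\<^bsub>M\<^esub> h y) \<and>
       (\<forall>x\<in>carrier M. \<forall>s\<in>carrier S. h (x \<odot>\<^sub>r\<^bsub>M\<^esub> s) = h x \<odot>\<^sub>r\<^bsub>M\<^esub> s)},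
     monoid.mult = compose (carrier M),
     one = (\<lambda>x\<in>carrier M. x),
     ring.zero = (\<lambda>x\<in>carrier M. \<zero>\<^bsub>M\<^esub>),
     add = (\<lambda>h k. \<lambda>x\<in>carrier M. h x \<oplus>\<^bsub>M\<^esub> k x)\<rparr>"

text \<open>\<open>End B\<^sub>C\<close> for a ring extension \<open>f : C \<rightarrow> B\<close>; the left action on \<open>B\<close> plays no role here.\<close>

definition extension_End ::
    "('b, 'm) ring_scheme \<Rightarrow> ('c, 'n) ring_scheme \<Rightarrow> ('c \<Rightarrow> 'b) \<Rightarrow> ('b \<Rightarrow> 'b) ring"
  where "extension_End B C f = right_End C (ring_bimodule B id f)"

definition left_regular :: "('b, 'm) ring_scheme \<Rightarrow> 'b \<Rightarrow> 'b \<Rightarrow> 'b"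
  where "left_regular B x = (\<lambda>b\<in>carrier B. x \<otimes>\<^bsub>B\<^esub> b)"


section \<open>Well-definedness of the constructions\<close>

lemma bimodule_ring_bimodule:
  assumes "ring_hom_ring R A f" "ring_hom_ring S A g"
  shows "bimodule R S (ring_bimodule A f g)"
proof -
  interpret f: ring_hom_ring R A f by fact
  interpret g: ring_hom_ring S A g by fact
  interpret abelian_group "ring_bimodule A f g"
    by (rule abelian_groupI) (auto simp: ring_bimodule_def f.S.a_ac intro: f.S.l_neg)
  show ?thesis
    by unfold_locales
      (auto simp: ring_bimodule_def f.S.l_distr f.S.r_distr f.S.m_assoc)
qed

lemma restrict_eq_self:
  "x \<in> I \<rightarrow>\<^sub>E S \<Longrightarrow> (\<And>i. i \<in> I \<Longrightarrow> h i = x i) \<Longrightarrow> restrict h I = x"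
  by (auto simp: fun_eq_iff restrict_def PiE_iff extensional_def)

lemma bimodule_bimodule_power:
  assumes "bimodule R S M"
  shows "bimodule R S (bimodule_power M n)"
proof -
  interpret bimodule R S M by fact
  define P where "P = bimodule_power M n"
  have car: "x \<in> carrier P \<longleftrightarrow> x \<in> {..<n} \<rightarrow>\<^sub>E carrier M" for x
    by (simp add: P_def bimodule_power_def)
  have ops: "x \<oplus>\<^bsub>P\<^esub> y = (\<lambda>i\<in>{..<n}. x i \<oplus>\<^bsub>M\<^esub> y i)" "\<zero>\<^bsub>P\<^esub> = (\<lambda>i\<in>{..<n}. \<zero>\<^bsub>M\<^esub>)"
      "r \<odot>\<^bsub>P\<^esub> x = (\<lambda>i\<in>{..<n}. r \<odot>\<^bsub>M\<^esub> x i)" "x \<odot>\<^sub>r\<^bsub>P\<^esub> s = (\<lambda>i\<in>{..<n}. x i \<odot>\<^sub>r\<^bsub>M\<^esub> s)" for x y r s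
    by (simp_all add: P_def bimodule_power_def)
  have mem: "x i \<in> carrier M" if "x \<in> carrier P" "i < n" for x i
    using that by (auto simp: car)
  have self: "restrict g {..<n} = x" if "x \<in> carrier P" "\<And>i. i < n \<Longrightarrow> g i = x i" for g x
    using that restrict_eq_self[of x "{..<n}" "carrier M" g] by (auto simp: car)
  have cl: "restrict g {..<n} \<in> carrier P" if "\<And>i. i < n \<Longrightarrow> g i \<in> carrier M" for g
    using that by (auto simp: car)
  have P: "abelian_group P"
  proof (rule abelian_groupI)
    show "\<exists>y\<in>carrier P. y \<oplus>\<^bsub>P\<^esub> x = \<zero>\<^bsub>P\<^esub>" if "x \<in> carrier P" for x
      unfolding ops
      by (rule bexI[of _ "\<lambda>i\<in>{..<n}. \<ominus>\<^bsub>M\<^esub> x i"], rule restrict_ext, simp add: that mem M.l_neg)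
        (rule cl, simp add: that mem)
    show "\<zero>\<^bsub>P\<^esub> \<oplus>\<^bsub>P\<^esub> x = x" if "x \<in> carrier P" for x
      unfolding ops by (rule self) (simp_all add: that mem)
    show "\<zero>\<^bsub>P\<^esub> \<in> carrier P" unfolding ops by (rule cl) simp
    show "x \<oplus>\<^bsub>P\<^esub> y \<in> carrier P" if "x \<in> carrier P" "y \<in> carrier P" for x y
      unfolding ops by (rule cl) (simp add: that mem)
    show "x \<oplus>\<^bsub>P\<^esub> y \<oplus>\<^bsub>P\<^esub> z = x \<oplus>\<^bsub>P\<^esub> (y \<oplus>\<^bsub>P\<^esub> z)"
      if "x \<in> carrier P" "y \<in> carrier P" "z \<in> carrier P" for x y z
      unfolding ops by (rule restrict_ext) (simp add: that mem M.a_assoc)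
    show "x \<oplus>\<^bsub>P\<^esub> y = y \<oplus>\<^bsub>P\<^esub> x" if "x \<in> carrier P" "y \<in> carrier P" for x y
      unfolding ops by (rule restrict_ext) (simp add: that mem M.a_comm)
  qed
  interpret P: abelian_group P by (rule P)
  have "bimodule R S P"
  proof unfold_locales
    show "\<one>\<^bsub>R\<^esub> \<odot>\<^bsub>P\<^esub> x = x" if "x \<in> carrier P" for x
      unfolding ops by (rule self) (simp_all add: that mem smult_one)
    show "x \<odot>\<^sub>r\<^bsub>P\<^esub> \<one>\<^bsub>S\<^esub> = x" if "x \<in> carrier P" for x
      unfolding ops by (rule self) (simp_all add: that mem rsmult_one)
  qed (unfold ops, (rule cl restrict_ext, simp add: mem smult_closed smult_l_distr smult_r_distr
      smult_assoc rsmult_closed rsmult_l_distr rsmult_r_distr rsmult_assoc smult_rsmult)+)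
  then show ?thesis by (simp add: P_def)
qed

lemma ring_extension_End:
  assumes "ring_hom_ring C B f"
  shows "ring (extension_End B C f)"
proof -
  interpret f: ring_hom_ring C B f by fact
  define A where "A = extension_End B C f"
  have car: "h \<in> carrier A \<longleftrightarrow> h \<in> carrier B \<rightarrow>\<^sub>E carrier B \<and>
      (\<forall>x\<in>carrier B. \<forall>y\<in>carrier B. h (x \<oplus>\<^bsub>B\<^esub> y) = h x \<oplus>\<^bsub>B\<^esub> h y) \<and>
      (\<forall>x\<in>carrier B. \<forall>s\<in>carrier C. h (x \<otimes>\<^bsub>B\<^esub> f s) = h x \<otimes>\<^bsub>B\<^esub> f s)" for h
    by (simp add: A_def extension_End_def right_End_def ring_bimodule_def)
  have ops: "x \<oplus>\<^bsub>A\<^esub> y = (\<lambda>b\<in>carrier B. x b \<oplus>\<^bsub>B\<^esub> y b)" "x \<otimes>\<^bsub>A\<^esub> y = (\<lambda>b\<in>carrier B. x (y b))"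
      "\<zero>\<^bsub>A\<^esub> = (\<lambda>b\<in>carrier B. \<zero>\<^bsub>B\<^esub>)" "\<one>\<^bsub>A\<^esub> = (\<lambda>b\<in>carrier B. b)" for x y
    by (simp_all add: A_def extension_End_def right_End_def ring_bimodule_def compose_def)
  have mem: "h b \<in> carrier B" if "h \<in> carrier A" "b \<in> carrier B" for h b
    using that by (auto simp: car)
  have hom: "h (x \<oplus>\<^bsub>B\<^esub> y) = h x \<oplus>\<^bsub>B\<^esub> h y" if "h \<in> carrier A" "x \<in> carrier B" "y \<in> carrier B" for h x y
    using that by (auto simp: car)
  have lin: "h (x \<otimes>\<^bsub>B\<^esub> f s) = h x \<otimes>\<^bsub>B\<^esub> f s" if "h \<in> carrier A" "x \<in> carrier B" "s \<in> carrier C" for h x s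
    using that by (auto simp: car)
  have self: "restrict g (carrier B) = h"
    if "h \<in> carrier A" "\<And>b. b \<in> carrier B \<Longrightarrow> g b = h b" for g h
    using that restrict_eq_self[of h "carrier B" "carrier B" g] by (auto simp: car)
  have A: "abelian_group A"
  proof (rule abelian_groupI)
    show "\<exists>y\<in>carrier A. y \<oplus>\<^bsub>A\<^esub> x = \<zero>\<^bsub>A\<^esub>" if "x \<in> carrier A" for x
      by (rule bexI[of _ "\<lambda>b\<in>carrier B. \<ominus>\<^bsub>B\<^esub> x b"])
        (simp_all add: ops car[of "restrict _ _"] that mem hom lin f.S.l_neg f.S.minus_add f.S.l_minus cong: restrict_cong)
    show "x \<oplus>\<^bsub>A\<^esub> y \<in> carrier A" if "x \<in> carrier A" "y \<in> carrier A" for x y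
      by (simp add: ops car[of "restrict _ _"] that mem hom lin f.S.l_distr f.S.a_ac)
    show "\<zero>\<^bsub>A\<^esub> \<in> carrier A" by (simp add: ops car)
    show "\<zero>\<^bsub>A\<^esub> \<oplus>\<^bsub>A\<^esub> x = x" if "x \<in> carrier A" for x
      unfolding ops by (rule self) (simp_all add: that mem)
    show "x \<oplus>\<^bsub>A\<^esub> y \<oplus>\<^bsub>A\<^esub> z = x \<oplus>\<^bsub>A\<^esub> (y \<oplus>\<^bsub>A\<^esub> z)"
      if "x \<in> carrier A" "y \<in> carrier A" "z \<in> carrier A" for x y z
      unfolding ops by (rule restrict_ext) (simp add: that mem f.S.a_assoc)
    show "x \<oplus>\<^bsub>A\<^esub> y = y \<oplus>\<^bsub>A\<^esub> x" if "x \<in> carrier A" "y \<in> carrier A" for x y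
      unfolding ops by (rule restrict_ext) (simp add: that mem f.S.a_comm)
  qed
  have M: "monoid A"
  proof (rule monoidI)
    show "x \<otimes>\<^bsub>A\<^esub> y \<in> carrier A" if "x \<in> carrier A" "y \<in> carrier A" for x y
      by (simp add: ops car[of "restrict _ _"] that mem hom lin)
    show "\<one>\<^bsub>A\<^esub> \<in> carrier A" by (simp add: ops car)
    show "\<one>\<^bsub>A\<^esub> \<otimes>\<^bsub>A\<^esub> x = x" if "x \<in> carrier A" for x
      unfolding ops by (rule self) (simp_all add: that mem)
    show "x \<otimes>\<^bsub>A\<^esub> \<one>\<^bsub>A\<^esub> = x" if "x \<in> carrier A" for x
      unfolding ops by (rule self) (simp_all add: that mem)
    show "x \<otimes>\<^bsub>A\<^esub> y \<otimes>\<^bsub>A\<^esub> z = x \<otimes>\<^bsub>A\<^esub> (y \<otimes>\<^bsub>A\<^esub> z)"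
      if "x \<in> carrier A" "y \<in> carrier A" "z \<in> carrier A" for x y z
      unfolding ops by (rule restrict_ext) (simp add: that mem)
  qed
  have "ring A"
  proof (rule ringI[OF A M])
    show "(x \<oplus>\<^bsub>A\<^esub> y) \<otimes>\<^bsub>A\<^esub> z = x \<otimes>\<^bsub>A\<^esub> z \<oplus>\<^bsub>A\<^esub> y \<otimes>\<^bsub>A\<^esub> z"
      if "x \<in> carrier A" "y \<in> carrier A" "z \<in> carrier A" for x y z
      unfolding ops by (rule restrict_ext) (simp add: that mem)
    show "z \<otimes>\<^bsub>A\<^esub> (x \<oplus>\<^bsub>A\<^esub> y) = z \<otimes>\<^bsub>A\<^esub> x \<oplus>\<^bsub>A\<^esub> z \<otimes>\<^bsub>A\<^esub> y"
      if "x \<in> carrier A" "y \<in> carrier A" "z \<in> carrier A" for x y z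
      unfolding ops by (rule restrict_ext) (simp add: that mem hom)
  qed
  then show ?thesis by (simp add: A_def)
qed

lemma ring_hom_left_regular:
  assumes "ring_hom_ring C B f"
  shows "ring_hom_ring B (extension_End B C f) (left_regular B)"
proof -
  interpret f: ring_hom_ring C B f by fact
  have A: "ring (extension_End B C f)" using assms by (rule ring_extension_End)
  note d = extension_End_def right_End_def ring_bimodule_def left_regular_def
  show ?thesis
  proof (rule ring_hom_ringI[OF f.S.ring_axioms A])
    show "left_regular B x \<in> carrier (extension_End B C f)" if "x \<in> carrier B" for x
      using that unfolding d by (auto simp: f.S.r_distr f.S.m_assoc)
    show "left_regular B (x \<otimes>\<^bsub>B\<^esub> y) = left_regular B x \<otimes>\<^bsub>extension_End B C f\<^esub> left_regular B y"
      if "x \<in> carrier B" "y \<in> carrier B" for x y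
      using that unfolding d by (auto simp: compose_def f.S.m_assoc intro!: restrict_ext)
    show "left_regular B (x \<oplus>\<^bsub>B\<^esub> y) = left_regular B x \<oplus>\<^bsub>extension_End B C f\<^esub> left_regular B y"
      if "x \<in> carrier B" "y \<in> carrier B" for x y
      using that unfolding d by (auto simp: f.S.l_distr intro!: restrict_ext)
    show "left_regular B \<one>\<^bsub>B\<^esub> = \<one>\<^bsub>extension_End B C f\<^esub>"
      unfolding d by (auto intro!: restrict_ext)
  qed
qed

lemma bimodule_tensor:
  fixes M :: "('r, 'c, 'b, 'm) bimodule_scheme" and N :: "('b, 'd, 's, 'n) bimodule_scheme"
  assumes "bimodule R B M" "bimodule B S N"
  shows "bimodule R S (tensor_bimodule B M N)"
proof -
  interpret M: bimodule R B M by fact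
  interpret N: bimodule B S N by fact
  define P where "P = carrier M \<times> carrier N"
  define F where "F = tensor_free M N"
  define K where "K = tensor_kernel B M N"
  define T where "T = tensor_bimodule B M N"
  have F_eq: "F = free_Abelian_group P" by (simp add: F_def tensor_free_def P_def)
  interpret F: comm_group F
    unfolding F_eq by (rule abelian_free_Abelian_group)
  have carF: "x \<in> carrier F \<longleftrightarrow> Poly_Mapping.keys x \<subseteq> P" for x
    by (simp add: F_eq)
  have multF: "x \<otimes>\<^bsub>F\<^esub> y = x + y" for x y by (simp add: F_eq)
  have oneF: "\<one>\<^bsub>F\<^esub> = 0" by (simp add: F_eq)
  have invF: "x \<in> carrier F \<Longrightarrow> inv\<^bsub>F\<^esub> x = - x" for x by (simp add: F_eq)
  have fragF: "p \<in> P \<Longrightarrow> frag_of p \<in> carrier F" for p by (simp add: carF)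
  have F_add: "x \<in> carrier F \<Longrightarrow> y \<in> carrier F \<Longrightarrow> x + y \<in> carrier F" for x y
    using F.m_closed[of x y] by (simp add: multF)
  have F_diff: "x \<in> carrier F \<Longrightarrow> y \<in> carrier F \<Longrightarrow> x - y \<in> carrier F" for x y
    using F.m_closed[of x "inv\<^bsub>F\<^esub> y"] F.inv_closed[of y] by (simp add: multF invF)
  have rel: "tensor_relations B M N \<subseteq> carrier F"
    unfolding tensor_relations_def
    by (auto intro!: F_diff F_add fragF simp: P_def M.rsmult_closed N.smult_closed)
  have K: "subgroup K F"
    unfolding K_def tensor_kernel_def F_def[symmetric]
    by (rule F.generate_is_subgroup[OF rel])
  then have KF: "K \<subseteq> carrier F" by (rule subgroup.subset)
  have Kadd: "x \<in> K \<Longrightarrow> y \<in> K \<Longrightarrow> x + y \<in> K" for x y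
    using subgroup.m_closed[OF K] by (simp add: multF)
  have Kminus: "x \<in> K \<Longrightarrow> - x \<in> K" for x
    using subgroup.m_inv_closed[OF K] KF by (metis invF subsetD)
  have Kdiff: "x \<in> K \<Longrightarrow> y \<in> K \<Longrightarrow> x - y \<in> K" for x y
    using Kadd[OF _ Kminus] by simp
  have K0: "0 \<in> K" using subgroup.one_closed[OF K] by (simp add: oneF)
  have Krel: "x \<in> tensor_relations B M N \<Longrightarrow> x \<in> K" for x
    unfolding K_def tensor_kernel_def by (rule generate.incl)
  interpret K: normal K F by (rule F.subgroup_imp_normal[OF K])
  interpret Q: comm_group "F Mod K" by (rule F.abelian_FactGroup[OF K])
  have coset: "X \<in> K #>\<^bsub>F\<^esub> x \<longleftrightarrow> X - x \<in> K" for x X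
    by (auto simp: r_coset_def multF intro!: bexI[of _ "X - x"])
  have coset_eqI: "x - y \<in> K \<Longrightarrow> K #>\<^bsub>F\<^esub> x = K #>\<^bsub>F\<^esub> y" for x y
  proof -
    assume a: "x - y \<in> K"
    have "X - x \<in> K \<longleftrightarrow> X - y \<in> K" for X
      using Kadd[OF _ a, of "X - x"] Kdiff[OF _ a, of "X - y"] by auto
    then show ?thesis using coset by blast
  qed
  have carT: "carrier T = (\<lambda>x. K #>\<^bsub>F\<^esub> x) ` carrier F"
    by (auto simp: T_def tensor_bimodule_def Let_def F_def[symmetric] K_def[symmetric]
       carrier_FactGroup)
  have addT: "(K #>\<^bsub>F\<^esub> x) \<oplus>\<^bsub>T\<^esub> (K #>\<^bsub>F\<^esub> y) = K #>\<^bsub>F\<^esub> (x + y)"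
    if "x \<in> carrier F" "y \<in> carrier F" for x y
    using K.rcos_sum[OF that]
    by (simp add: T_def tensor_bimodule_def Let_def F_def[symmetric] K_def[symmetric]
       FactGroup_def multF)
  have T_ab: "abelian_group T"
  proof (rule abelian_groupI)
    have c: "carrier T = carrier (F Mod K)" and a: "add T = monoid.mult (F Mod K)"
      and z: "ring.zero T = \<one>\<^bsub>F Mod K\<^esub>"
      by (simp_all add: T_def tensor_bimodule_def Let_def F_def[symmetric] K_def[symmetric])
    show "\<exists>y\<in>carrier T. y \<oplus>\<^bsub>T\<^esub> x = \<zero>\<^bsub>T\<^esub>" if "x \<in> carrier T" for x
      unfolding c a z using that c by (metis Q.inv_closed Q.l_inv)
    show "\<And>x y z. \<lbrakk>x \<in> carrier T; y \<in> carrier T; z \<in> carrier T\<rbrakk>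
        \<Longrightarrow> (x \<oplus>\<^bsub>T\<^esub> y) \<oplus>\<^bsub>T\<^esub> z = x \<oplus>\<^bsub>T\<^esub> (y \<oplus>\<^bsub>T\<^esub> z)"
      unfolding c a by (rule Q.m_assoc)
    show "\<And>x y. \<lbrakk>x \<in> carrier T; y \<in> carrier T\<rbrakk> \<Longrightarrow> x \<oplus>\<^bsub>T\<^esub> y = y \<oplus>\<^bsub>T\<^esub> x"
      unfolding c a by (rule Q.m_comm)
    show "\<And>x y. \<lbrakk>x \<in> carrier T; y \<in> carrier T\<rbrakk> \<Longrightarrow> x \<oplus>\<^bsub>T\<^esub> y \<in> carrier T"
      unfolding c a by (rule Q.m_closed)
    show "\<And>x. x \<in> carrier T \<Longrightarrow> \<zero>\<^bsub>T\<^esub> \<oplus>\<^bsub>T\<^esub> x = x"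
      unfolding c a z by (rule Q.l_one)
    show "\<zero>\<^bsub>T\<^esub> \<in> carrier T" unfolding c z by (rule Q.one_closed)
  qed
  define L where "L r = frag_extend (\<lambda>(x, y). frag_of (r \<odot>\<^bsub>M\<^esub> x, y :: 'd))" for r
  define G where "G s = frag_extend (\<lambda>(x :: 'c, y). frag_of (x, y \<odot>\<^sub>r\<^bsub>N\<^esub> s))" for s
  have L_add: "L r (x + y) = L r x + L r y" "L r (x - y) = L r x - L r y"
    and L_of: "L r (frag_of (a, b)) = frag_of (r \<odot>\<^bsub>M\<^esub> a, b)" for r x y a b
    by (simp_all add: L_def frag_extend_add frag_extend_diff)
  have G_add: "G r (x + y) = G r x + G r y" "G r (x - y) = G r x - G r y"
    and G_of: "G r (frag_of (a, b)) = frag_of (a, b \<odot>\<^sub>r\<^bsub>N\<^esub> r)" for r x y a b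
    by (simp_all add: G_def frag_extend_add frag_extend_diff)
  have indF: "p x" if "x \<in> carrier F" "p 0" "\<And>a b. a \<in> carrier M \<Longrightarrow> b \<in> carrier N \<Longrightarrow> p (frag_of (a, b))"
    "\<And>a b. p a \<Longrightarrow> p b \<Longrightarrow> p (a - b)" for p :: "_ \<Rightarrow> bool" and x
    using that(1) unfolding carF
    by (induction x rule: frag_induction) (use that(2-) in \<open>auto simp: P_def\<close>)
  have LF: "L r x \<in> carrier F" if "r \<in> carrier R" "x \<in> carrier F" for r x
    using that(2)
    by (rule indF) (auto simp: L_add L_of that fragF P_def M.smult_closed intro: F_diff, simp add: L_def carF)
  have GF: "G r x \<in> carrier F" if "r \<in> carrier S" "x \<in> carrier F" for r x
    using that(2)
    by (rule indF) (auto simp: G_add G_of that fragF P_def N.rsmult_closed intro: F_diff, simp add: G_def carF)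
  have indK: "p x" if "x \<in> K" "p 0" "\<And>a. a \<in> tensor_relations B M N \<Longrightarrow> p a"
    "\<And>a b. p a \<Longrightarrow> p b \<Longrightarrow> p (a + b)" "\<And>a. p a \<Longrightarrow> p (- a)" for p :: "_ \<Rightarrow> bool" and x
    using that(1) unfolding K_def tensor_kernel_def F_def[symmetric]
  proof (induction rule: generate.induct)
    case one then show ?case using that by (simp add: oneF)
  next
    case (incl h) then show ?case using that by simp
  next
    case (inv h)
    then have "h \<in> carrier F" using rel by auto
    then show ?case using that(5)[OF that(3)[OF inv]] by (simp add: invF)
  next
    case (eng h1 h2) then show ?case using that by (simp add: multF)
  qed
  have L0: "L r 0 = 0" "L r (- x) = - L r x" for r x by (simp_all add: L_def frag_extend_minus)
  have G0: "G r 0 = 0" "G r (- x) = - G r x" for r x by (simp_all add: G_def frag_extend_minus)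
  have rel1: "frag_of (x \<oplus>\<^bsub>M\<^esub> x', y) - (frag_of (x, y) + frag_of (x', y)) \<in> K"
    if "x \<in> carrier M" "x' \<in> carrier M" "y \<in> carrier N" for x x' y
    by (rule Krel) (use that in \<open>auto simp: tensor_relations_def\<close>)
  have rel2: "frag_of (x, y \<oplus>\<^bsub>N\<^esub> y') - (frag_of (x, y) + frag_of (x, y')) \<in> K"
    if "x \<in> carrier M" "y \<in> carrier N" "y' \<in> carrier N" for x y y'
    by (rule Krel) (use that in \<open>auto simp: tensor_relations_def\<close>)
  have rel3: "frag_of (x \<odot>\<^sub>r\<^bsub>M\<^esub> b, y) - frag_of (x, b \<odot>\<^bsub>N\<^esub> y) \<in> K"
    if "x \<in> carrier M" "b \<in> carrier B" "y \<in> carrier N" for x b y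
    by (rule Krel) (use that in \<open>auto simp: tensor_relations_def\<close>)
  have LK: "L r x \<in> K" if r: "r \<in> carrier R" and "x \<in> K" for r x
    using that(2)
  proof (rule indK)
    show "L r a \<in> K" if "a \<in> tensor_relations B M N" for a
      using that r unfolding tensor_relations_def
      by (auto simp: L_add L_of M.smult_r_distr M.smult_rsmult[symmetric] M.smult_closed intro!: rel1 rel2 rel3)
  qed (auto simp: L_add L0 K0 Kadd Kminus)
  have GK: "G r x \<in> K" if r: "r \<in> carrier S" and "x \<in> K" for r x
    using that(2)
  proof (rule indK)
    show "G r a \<in> K" if "a \<in> tensor_relations B M N" for a
      using that r unfolding tensor_relations_def
      by (auto simp: G_add G_of N.rsmult_l_distr N.smult_rsmult N.rsmult_closed intro!: rel1 rel2 rel3)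
  qed (auto simp: G_add G0 K0 Kadd Kminus)
  have LT: "r \<odot>\<^bsub>T\<^esub> (K #>\<^bsub>F\<^esub> x) = K #>\<^bsub>F\<^esub> L r x" if "r \<in> carrier R" for r x
  proof -
    have "r \<odot>\<^bsub>T\<^esub> (K #>\<^bsub>F\<^esub> x) = K <#>\<^bsub>F\<^esub> L r ` (K #>\<^bsub>F\<^esub> x)"
      by (simp add: T_def tensor_bimodule_def Let_def F_def[symmetric] K_def[symmetric] L_def)
    also have "\<dots> = {k + L r (k' + x) | k k'. k \<in> K \<and> k' \<in> K}"
      by (auto simp: set_mult_def r_coset_def multF)
    also have "\<dots> = K #>\<^bsub>F\<^esub> L r x"
    proof (intro equalityI subsetI)
      fix z assume "z \<in> {k + L r (k' + x) | k k'. k \<in> K \<and> k' \<in> K}"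
      then obtain k k' where "k \<in> K" "k' \<in> K" "z = k + L r (k' + x)" by blast
      then show "z \<in> K #>\<^bsub>F\<^esub> L r x" using that by (simp add: coset L_add Kadd LK)
    next
      fix z assume "z \<in> K #>\<^bsub>F\<^esub> L r x"
      then show "z \<in> {k + L r (k' + x) | k k'. k \<in> K \<and> k' \<in> K}"
        by (intro CollectI exI[of _ "z - L r x"] exI[of _ 0]) (simp add: coset K0)
    qed
    finally show ?thesis .
  qed
  have GT: "(K #>\<^bsub>F\<^esub> x) \<odot>\<^sub>r\<^bsub>T\<^esub> r = K #>\<^bsub>F\<^esub> G r x" if "r \<in> carrier S" for r x
  proof -
    have "(K #>\<^bsub>F\<^esub> x) \<odot>\<^sub>r\<^bsub>T\<^esub> r = K <#>\<^bsub>F\<^esub> G r ` (K #>\<^bsub>F\<^esub> x)"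
      by (simp add: T_def tensor_bimodule_def Let_def F_def[symmetric] K_def[symmetric] G_def)
    also have "\<dots> = {k + G r (k' + x) | k k'. k \<in> K \<and> k' \<in> K}"
      by (auto simp: set_mult_def r_coset_def multF)
    also have "\<dots> = K #>\<^bsub>F\<^esub> G r x"
    proof (intro equalityI subsetI)
      fix z assume "z \<in> {k + G r (k' + x) | k k'. k \<in> K \<and> k' \<in> K}"
      then obtain k k' where "k \<in> K" "k' \<in> K" "z = k + G r (k' + x)" by blast
      then show "z \<in> K #>\<^bsub>F\<^esub> G r x" using that by (simp add: coset G_add Kadd GK)
    next
      fix z assume "z \<in> K #>\<^bsub>F\<^esub> G r x"
      then show "z \<in> {k + G r (k' + x) | k k'. k \<in> K \<and> k' \<in> K}"
        by (intro CollectI exI[of _ "z - G r x"] exI[of _ 0]) (simp add: coset K0)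
    qed
    finally show ?thesis .
  qed
  interpret T: abelian_group T by (rule T_ab)
  have "bimodule R S T"
  proof unfold_locales
    show "a \<odot>\<^bsub>T\<^esub> x \<in> carrier T" if "a \<in> carrier R" "x \<in> carrier T" for a x
      using that by (auto simp: carT LT LF)
    show "x \<odot>\<^sub>r\<^bsub>T\<^esub> a \<in> carrier T" if "x \<in> carrier T" "a \<in> carrier S" for a x
      using that by (auto simp: carT GT GF)
    show "a \<odot>\<^bsub>T\<^esub> (x \<oplus>\<^bsub>T\<^esub> y) = a \<odot>\<^bsub>T\<^esub> x \<oplus>\<^bsub>T\<^esub> a \<odot>\<^bsub>T\<^esub> y"
      if "a \<in> carrier R" "x \<in> carrier T" "y \<in> carrier T" for a x y
      using that by (auto simp: carT LT LF addT L_add)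
    show "(x \<oplus>\<^bsub>T\<^esub> y) \<odot>\<^sub>r\<^bsub>T\<^esub> a = x \<odot>\<^sub>r\<^bsub>T\<^esub> a \<oplus>\<^bsub>T\<^esub> y \<odot>\<^sub>r\<^bsub>T\<^esub> a"
      if "x \<in> carrier T" "y \<in> carrier T" "a \<in> carrier S" for a x y
      using that by (auto simp: carT GT GF addT G_add)
    show "(a \<oplus>\<^bsub>R\<^esub> b) \<odot>\<^bsub>T\<^esub> x = a \<odot>\<^bsub>T\<^esub> x \<oplus>\<^bsub>T\<^esub> b \<odot>\<^bsub>T\<^esub> x"
      if ab: "a \<in> carrier R" "b \<in> carrier R" "x \<in> carrier T" for a b x
    proof -
      have "L (a \<oplus>\<^bsub>R\<^esub> b) x - (L a x + L b x) \<in> K" if "x \<in> carrier F" for x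
        using that
      proof (rule indF)
        fix u v assume "L (a \<oplus>\<^bsub>R\<^esub> b) u - (L a u + L b u) \<in> K" "L (a \<oplus>\<^bsub>R\<^esub> b) v - (L a v + L b v) \<in> K"
        from Kdiff[OF this] show "L (a \<oplus>\<^bsub>R\<^esub> b) (u - v) - (L a (u - v) + L b (u - v)) \<in> K"
          by (simp add: L_add algebra_simps)
      qed (auto simp: L0 K0 L_of M.smult_l_distr ab M.smult_closed intro: rel1)
      moreover obtain u where "x = K #>\<^bsub>F\<^esub> u" "u \<in> carrier F" using ab by (auto simp: carT)
      ultimately show ?thesis using ab by (simp add: LT LF addT coset_eqI)
    qed
    show "x \<odot>\<^sub>r\<^bsub>T\<^esub> (a \<oplus>\<^bsub>S\<^esub> b) = x \<odot>\<^sub>r\<^bsub>T\<^esub> a \<oplus>\<^bsub>T\<^esub> x \<odot>\<^sub>r\<^bsub>T\<^esub> b"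
      if ab: "x \<in> carrier T" "a \<in> carrier S" "b \<in> carrier S" for a b x
    proof -
      have "G (a \<oplus>\<^bsub>S\<^esub> b) x - (G a x + G b x) \<in> K" if "x \<in> carrier F" for x
        using that
      proof (rule indF)
        fix u v assume "G (a \<oplus>\<^bsub>S\<^esub> b) u - (G a u + G b u) \<in> K" "G (a \<oplus>\<^bsub>S\<^esub> b) v - (G a v + G b v) \<in> K"
        from Kdiff[OF this] show "G (a \<oplus>\<^bsub>S\<^esub> b) (u - v) - (G a (u - v) + G b (u - v)) \<in> K"
          by (simp add: G_add algebra_simps)
      qed (auto simp: G0 K0 G_of N.rsmult_r_distr ab N.rsmult_closed intro: rel2)
      moreover obtain u where "x = K #>\<^bsub>F\<^esub> u" "u \<in> carrier F" using ab by (auto simp: carT)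
      ultimately show ?thesis using ab by (simp add: GT GF addT coset_eqI)
    qed
    show "(a \<otimes>\<^bsub>R\<^esub> b) \<odot>\<^bsub>T\<^esub> x = a \<odot>\<^bsub>T\<^esub> (b \<odot>\<^bsub>T\<^esub> x)"
      if ab: "a \<in> carrier R" "b \<in> carrier R" "x \<in> carrier T" for a b x
    proof -
      have "L (a \<otimes>\<^bsub>R\<^esub> b) x = L a (L b x)" if "x \<in> carrier F" for x
        using that by (rule indF) (auto simp: L0 L_add L_of M.smult_assoc ab)
      then show ?thesis using ab by (auto simp: carT LT LF)
    qed
    show "x \<odot>\<^sub>r\<^bsub>T\<^esub> (a \<otimes>\<^bsub>S\<^esub> b) = (x \<odot>\<^sub>r\<^bsub>T\<^esub> a) \<odot>\<^sub>r\<^bsub>T\<^esub> b"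
      if ab: "x \<in> carrier T" "a \<in> carrier S" "b \<in> carrier S" for a b x
    proof -
      have "G (a \<otimes>\<^bsub>S\<^esub> b) x = G b (G a x)" if "x \<in> carrier F" for x
        using that by (rule indF) (auto simp: G0 G_add G_of N.rsmult_assoc ab)
      then show ?thesis using ab by (auto simp: carT GT GF)
    qed
    show "\<one>\<^bsub>R\<^esub> \<odot>\<^bsub>T\<^esub> x = x" if "x \<in> carrier T" for x
    proof -
      have "L \<one>\<^bsub>R\<^esub> x = x" if "x \<in> carrier F" for x
        using that by (rule indF) (auto simp: L0 L_add L_of M.smult_one)
      then show ?thesis using that by (auto simp: carT LT)
    qed
    show "x \<odot>\<^sub>r\<^bsub>T\<^esub> \<one>\<^bsub>S\<^esub> = x" if "x \<in> carrier T" for x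
    proof -
      have "G \<one>\<^bsub>S\<^esub> x = x" if "x \<in> carrier F" for x
        using that by (rule indF) (auto simp: G0 G_add G_of N.rsmult_one)
      then show ?thesis using that by (auto simp: carT GT)
    qed
    show "(a \<odot>\<^bsub>T\<^esub> x) \<odot>\<^sub>r\<^bsub>T\<^esub> s = a \<odot>\<^bsub>T\<^esub> (x \<odot>\<^sub>r\<^bsub>T\<^esub> s)"
      if ab: "a \<in> carrier R" "x \<in> carrier T" "s \<in> carrier S" for a x s
    proof -
      have "G s (L a x) = L a (G s x)" if "x \<in> carrier F" for x
        using that by (rule indF) (auto simp: L0 G0 L_add G_add L_of G_of)
      then show ?thesis using ab by (auto simp: carT LT GT)
    qed
  qed
  then show ?thesis by (simp add: T_def)
qed

end

theory Submission
  imports Defs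
begin

text \<open>
  Let \<open>E, x\<^sub>i, y\<^sub>i\<close> be a Frobenius system of \<open>B | C\<close>. The ring \<open>A = End B\<^sub>C\<close> is spanned by the
  endomorphisms \<open>b E b'\<close> that send \<open>u\<close> to \<open>b E(b' u)\<close>, and \<open>A | C\<close> is Frobenius with
  \<open>\<epsilon>(b E b') = E(b b')\<close> and dual bases \<open>x\<^sub>m E x\<^sub>l\<close>, \<open>y\<^sub>l E y\<^sub>m\<close>. Splitting the tensors
  \<open>1 \<otimes>\<^sub>B E b\<close> along the depth three condition and applying \<open>a \<otimes>\<^sub>B a' \<mapsto> a \<lambda>(a' b')\<close> gives
  \<open>C\<close>-bilinear maps \<open>\<gamma>\<^sub>i, \<delta>\<^sub>i : B \<rightarrow> A\<close> with \<open>\<lambda>(E(b b')) = \<Sum>\<^sub>i \<gamma>\<^sub>i(b) \<delta>\<^sub>i(b')\<close>. Applying this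
  twice decomposes \<open>\<epsilon>(a a')\<close> in the same way as \<open>\<Sum>\<^sub>j \<Gamma>\<^sub>j(a) \<Delta>\<^sub>j(a')\<close> with \<open>C\<close>-bilinear
  endomaps of \<open>A\<close>. This condition is left-right symmetric, and with the dual bases \<open>X\<^sub>p, Y\<^sub>p\<close> of
  \<open>A | C\<close> it yields \<open>1 \<otimes>\<^sub>C a = \<Sum>\<^sub>p \<epsilon>(a X\<^sub>p) \<otimes> Y\<^sub>p = \<Sum>\<^sub>j \<Gamma>\<^sub>j(a) \<Sum>\<^sub>p \<Delta>\<^sub>j(X\<^sub>p) \<otimes> Y\<^sub>p\<close> and its mirror
  image, that is, right and left depth two.
\<close>

section \<open>Finite sums in abelian groups\<close>

text \<open>The depth three condition is one-sided: it splits tensors only as A-C-bimodules and by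
  itself gives no hold on C-A-bimodules. Passing to \<open>E(b b')\<close> removes this asymmetry,
  because both factors of its decomposition are merely C-bilinear. The map
  \<open>a \<otimes> a' \<mapsto> a \<lambda>(a' b')\<close> evaluates the second leg at
  \<open>b'\<close> and identifies \<open>A \<otimes> B\<close> over \<open>B\<close> with
  \<open>A\<close>. It is left A-linear, which lets the coefficient
  \<open>\<gamma>\<^sub>i(b)\<close> come out in front; as the splitting happens in a power of
  \<open>A\<close>, that coefficient lies in \<open>A\<close> and not in \<open>B\<close>. The
  passage from \<open>B\<close> to \<open>A\<close> rests on \<open>A\<close> being
  \<open>B \<otimes> B\<close> over \<open>C\<close>, with \<open>b E b'\<close> in place of
  \<open>b \<otimes> b'\<close>. Since \<open>\<epsilon>(b E b' c E c') = E(b E(b' c) c')\<close>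
  contains two nested values of \<open>E\<close>, splitting the outer and then the inner one gives
  the sum of all \<open>\<gamma>\<^sub>i(b) \<gamma>\<^sub>j(b') \<delta>\<^sub>j(c)
  \<delta>\<^sub>i(c')\<close>. Hence the squared index set, and the inner index in the middle.
  C-linearity that a formula with dual bases hides comes from the Casimir identity.\<close>

lemma add_hom_finsum:
  assumes "abelian_group G" "abelian_group H" "h \<in> hom (add_monoid G) (add_monoid H)"
    and "g \<in> I \<rightarrow> carrier G"
  shows "h (finsum G g I) = (\<Oplus>\<^bsub>H\<^esub>i\<in>I. h (g i))"
proof -
  interpret G: abelian_group G by fact
  interpret H: abelian_group H by fact
  interpret h: group_hom "add_monoid G" "add_monoid H" h
    using assms(3) by (simp add: group_hom_def group_hom_axioms_def)
  have zero: "h \<zero>\<^bsub>G\<^esub> = \<zero>\<^bsub>H\<^esub>" using h.hom_one by simp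
  show ?thesis
  proof (cases "finite I")
    case True
    then show ?thesis using assms(4)
    proof (induction I rule: finite_induct)
      case empty
      then show ?case by (simp add: zero)
    next
      case (insert i I)
      then have g: "g i \<in> carrier G" "g \<in> I \<rightarrow> carrier G" by auto
      then have hg: "h (g i) \<in> carrier H" "(\<lambda>i. h (g i)) \<in> I \<rightarrow> carrier H"
        using h.hom_closed by auto
      show ?case
        using insert.hyps g hg insert.IH h.hom_mult[of "g i" "finsum G g I"]
        by simp
    qed
  next
    \<comment> \<open>By convention \<open>finsum\<close> over an infinite set is zero, so only the
      preservation of zero remains.\<close>
    case False
    then show ?thesis by (simp add: zero)
  qed
qed

lemma add_homI:
  assumes "\<And>x. x \<in> carrier G \<Longrightarrow> h x \<in> carrier H"
    and "\<And>x y. \<lbrakk>x \<in> carrier G; y \<in> carrier G\<rbrakk> \<Longrightarrow> h (x \<oplus>\<^bsub>G\<^esub> y) = h x \<oplus>\<^bsub>H\<^esub> h y"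
  shows "h \<in> hom (add_monoid G) (add_monoid H)"
  using assms by (auto simp: hom_def)

lemma add_hom_diff:
  assumes "abelian_group G" "abelian_group H" "h \<in> hom (add_monoid G) (add_monoid H)"
    and "x \<in> carrier G" "y \<in> carrier G"
  shows "h (x \<ominus>\<^bsub>G\<^esub> y) = h x \<ominus>\<^bsub>H\<^esub> h y"
proof -
  interpret G: abelian_group G by fact
  interpret H: abelian_group H by fact
  interpret h: group_hom "add_monoid G" "add_monoid H" h
    using assms(3) by (simp add: group_hom_def group_hom_axioms_def)
  show ?thesis
    using h.hom_mult[of x "\<ominus>\<^bsub>G\<^esub> y"] h.hom_inv[of y] assms(4,5)
    by (simp add: a_minus_def a_inv_def)
qed

section \<open>Double sums over finite index sets\<close>

context abelian_monoid
begin

lemma finsum_Times: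
  assumes "finite I" "finite J" "\<And>i j. \<lbrakk>i \<in> I; j \<in> J\<rbrakk> \<Longrightarrow> g i j \<in> carrier G"
  shows "(\<Oplus>p\<in>I \<times> J. g (fst p) (snd p)) = (\<Oplus>i\<in>I. \<Oplus>j\<in>J. g i j)"
  using assms(1,3)
proof (induction I rule: finite_induct)
  case empty
  show ?case by simp
next
  case (insert i I)
  have closed: "(\<Oplus>j\<in>J. g k j) \<in> carrier G" if "k \<in> insert i I" for k
    using insert.prems that by (intro finsum_closed) auto
  \<comment> \<open>The slice over \<open>i\<close> is the image of \<open>J\<close> under
    \<open>Pair i\<close>, so its sum reindexes to a sum over \<open>J\<close>.\<close>
  have "(\<Oplus>p\<in>insert i I \<times> J. g (fst p) (snd p)) = (\<Oplus>p\<in>Pair i ` J \<union> I \<times> J. g (fst p) (snd p))"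
    by (rule arg_cong[where f = "finsum _ _"]) auto
  also have "\<dots> = (\<Oplus>p\<in>Pair i ` J. g (fst p) (snd p)) \<oplus> (\<Oplus>p\<in>I \<times> J. g (fst p) (snd p))"
    using insert assms(2) by (intro finsum_Un_disjoint) auto
  also have "(\<Oplus>p\<in>Pair i ` J. g (fst p) (snd p)) = (\<Oplus>j\<in>J. g (fst (i, j)) (snd (i, j)))"
    using insert.prems by (intro finsum_reindex) (auto simp: inj_on_def)
  also have "(\<Oplus>p\<in>I \<times> J. g (fst p) (snd p)) = (\<Oplus>i\<in>I. \<Oplus>j\<in>J. g i j)"
    by (rule insert.IH) (rule insert.prems, auto)
  finally show ?case
    using insert.hyps closed by simp
qed

lemma finsum_swap:
  assumes "finite I" "finite J" "\<And>i j. \<lbrakk>i \<in> I; j \<in> J\<rbrakk> \<Longrightarrow> g i j \<in> carrier G"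
  shows "(\<Oplus>i\<in>I. \<Oplus>j\<in>J. g i j) = (\<Oplus>j\<in>J. \<Oplus>i\<in>I. g i j)"
  using assms(1,3)
proof (induction I rule: finite_induct)
  case empty
  show ?case by simp
next
  case (insert i I)
  have closed: "(\<Oplus>j\<in>J. g k j) \<in> carrier G" if "k \<in> insert i I" for k
    using insert.prems that by (intro finsum_closed) auto
  have closed': "(\<Oplus>k\<in>I. g k j) \<in> carrier G" if "j \<in> J" for j
    using insert.prems that by (intro finsum_closed) auto
  have "(\<Oplus>k\<in>insert i I. \<Oplus>j\<in>J. g k j) = (\<Oplus>j\<in>J. g i j) \<oplus> (\<Oplus>k\<in>I. \<Oplus>j\<in>J. g k j)"
    using insert.hyps closed by (intro finsum_insert) auto
  also have "(\<Oplus>k\<in>I. \<Oplus>j\<in>J. g k j) = (\<Oplus>j\<in>J. \<Oplus>k\<in>I. g k j)"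
    by (rule insert.IH) (rule insert.prems, auto)
  also have "(\<Oplus>j\<in>J. g i j) \<oplus> \<dots> = (\<Oplus>j\<in>J. g i j \<oplus> (\<Oplus>k\<in>I. g k j))"
    using insert.prems closed' by (intro finsum_addf[symmetric]) auto
  also have "\<dots> = (\<Oplus>j\<in>J. \<Oplus>k\<in>insert i I. g k j)"
  proof (rule finsum_cong')
    fix j assume "j \<in> J"
    then show "g i j \<oplus> (\<Oplus>k\<in>I. g k j) = (\<Oplus>k\<in>insert i I. g k j)"
      using insert.hyps insert.prems by (intro finsum_insert[symmetric]) auto
  qed (use insert.prems in \<open>auto intro!: finsum_closed\<close>)
  finally show ?case .
qed

end


section \<open>Direct summands as split bimodule homomorphisms\<close>

lemma bimodule_homI:
  assumes "\<And>x. x \<in> carrier M \<Longrightarrow> h x \<in> carrier N"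
    and "\<And>x y. \<lbrakk>x \<in> carrier M; y \<in> carrier M\<rbrakk> \<Longrightarrow> h (x \<oplus>\<^bsub>M\<^esub> y) = h x \<oplus>\<^bsub>N\<^esub> h y"
    and "\<And>r x. \<lbrakk>r \<in> carrier R; x \<in> carrier M\<rbrakk> \<Longrightarrow> h (r \<odot>\<^bsub>M\<^esub> x) = r \<odot>\<^bsub>N\<^esub> h x"
    and "\<And>x s. \<lbrakk>x \<in> carrier M; s \<in> carrier S\<rbrakk> \<Longrightarrow> h (x \<odot>\<^sub>r\<^bsub>M\<^esub> s) = h x \<odot>\<^sub>r\<^bsub>N\<^esub> s"
  shows "h \<in> bimodule_hom R S M N"
  using assms by (simp add: bimodule_hom_def)

lemma bimodule_homD:
  assumes "h \<in> bimodule_hom R S M N"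
  shows "x \<in> carrier M \<Longrightarrow> h x \<in> carrier N"
    and "\<lbrakk>x \<in> carrier M; y \<in> carrier M\<rbrakk> \<Longrightarrow> h (x \<oplus>\<^bsub>M\<^esub> y) = h x \<oplus>\<^bsub>N\<^esub> h y"
    and "\<lbrakk>r \<in> carrier R; x \<in> carrier M\<rbrakk> \<Longrightarrow> h (r \<odot>\<^bsub>M\<^esub> x) = r \<odot>\<^bsub>N\<^esub> h x"
    and "\<lbrakk>x \<in> carrier M; s \<in> carrier S\<rbrakk> \<Longrightarrow> h (x \<odot>\<^sub>r\<^bsub>M\<^esub> s) = h x \<odot>\<^sub>r\<^bsub>N\<^esub> s"
  using assms by (auto simp: bimodule_hom_def)

lemma bimodule_hom_add_hom:
  "h \<in> bimodule_hom R S M N \<Longrightarrow> h \<in> hom (add_monoid M) (add_monoid N)"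
  by (auto simp: bimodule_hom_def hom_def)

lemma (in bimodule) smult_add_hom:
  "r \<in> carrier R \<Longrightarrow> (\<lambda>x. r \<odot>\<^bsub>M\<^esub> x) \<in> hom (add_monoid M) (add_monoid M)"
  by (rule add_homI) (simp_all add: smult_closed smult_r_distr)

lemma (in bimodule) rsmult_add_hom:
  "s \<in> carrier S \<Longrightarrow> (\<lambda>x. x \<odot>\<^sub>r\<^bsub>M\<^esub> s) \<in> hom (add_monoid M) (add_monoid M)"
  by (rule add_homI) (simp_all add: rsmult_closed rsmult_l_distr)

text \<open>A retraction \<open>r\<close> of \<open>s\<close> splits \<open>Y\<close> into the image
  of \<open>s\<close> and the kernel of \<open>r\<close>, by
  \<open>y = s (r y) + (y - s (r y))\<close>. Such pairs of homomorphisms are easier to build than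
  internal complements.\<close>

lemma iso_direct_summandI:
  assumes X: "bimodule R S X" and Y: "bimodule R S Y"
    and s: "s \<in> bimodule_hom R S X Y" and r: "r \<in> bimodule_hom R S Y X"
    and rs: "\<And>x. x \<in> carrier X \<Longrightarrow> r (s x) = x"
  shows "iso_direct_summand R S X Y"
proof -
  interpret X: bimodule R S X by fact
  interpret Y: bimodule R S Y by fact
  note sD = bimodule_homD[OF s] and rD = bimodule_homD[OF r]
  interpret s: abelian_group_hom X Y s
    by unfold_locales (use bimodule_hom_add_hom[OF s] in auto)
  interpret r: abelian_group_hom Y X r
    by unfold_locales (use bimodule_hom_add_hom[OF r] in auto)
  define P where "P = s ` carrier X"
  define Q where "Q = {y \<in> carrier Y. r y = \<zero>\<^bsub>X\<^esub>}"
  have "additive_subgroup P Y"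
    using group_hom.img_is_subgroup[OF s.a_group_hom]
    by (simp add: P_def additive_subgroup_def)
  then have P: "sub_bimodule R S P Y"
    using X.smult_closed X.rsmult_closed unfolding sub_bimodule_def P_def
    by (auto simp: sD(3,4)[symmetric])
  have "additive_subgroup Q Y"
    using r.additive_subgroup_a_kernel unfolding Q_def a_kernel_def' .
  moreover have "r' \<odot>\<^bsub>X\<^esub> \<zero>\<^bsub>X\<^esub> = \<zero>\<^bsub>X\<^esub>" if "r' \<in> carrier R" for r'
    using X.smult_r_distr[OF that X.zero_closed X.zero_closed] X.smult_closed[OF that X.zero_closed]
    by simp
  moreover have "\<zero>\<^bsub>X\<^esub> \<odot>\<^sub>r\<^bsub>X\<^esub> t = \<zero>\<^bsub>X\<^esub>" if "t \<in> carrier S" for t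
    using X.rsmult_l_distr[OF X.zero_closed X.zero_closed that] X.rsmult_closed[OF X.zero_closed that]
    by simp
  ultimately have Q: "sub_bimodule R S Q Y"
    by (auto simp: sub_bimodule_def Q_def rD Y.smult_closed Y.rsmult_closed)
  have PQ: "P \<inter> Q = {\<zero>\<^bsub>Y\<^esub>}"
    by (auto simp: P_def Q_def rs sD image_iff intro!: bexI[of _ "\<zero>\<^bsub>X\<^esub>"])
  have "y \<in> P <+>\<^bsub>Y\<^esub> Q" if y: "y \<in> carrier Y" for y
  proof -
    have "s (r y) \<in> P" "y \<ominus>\<^bsub>Y\<^esub> s (r y) \<in> Q"
      using y add_hom_diff[OF Y.abelian_group_axioms X.abelian_group_axioms bimodule_hom_add_hom[OF r]]
      by (auto simp: P_def Q_def rs sD rD a_minus_def X.r_neg)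
    moreover have "y = s (r y) \<oplus>\<^bsub>Y\<^esub> (y \<ominus>\<^bsub>Y\<^esub> s (r y))"
      using y sD(1) rD(1) by (simp add: a_minus_def Y.a_lcomm Y.r_neg)
    ultimately show ?thesis
      unfolding set_add_def' by blast
  qed
  moreover have "P <+>\<^bsub>Y\<^esub> Q \<subseteq> carrier Y"
    by (auto simp: set_add_def' P_def Q_def sD)
  ultimately have "direct_summand R S P Y"
    using P Q PQ by (auto simp: direct_summand_def)
  moreover have "s \<in> bimodule_hom R S X (Y\<lparr>carrier := P\<rparr>)"
    using s by (auto simp: bimodule_hom_def P_def)
  moreover have "bij_betw s (carrier X) P"
    unfolding P_def by (rule bij_betw_imageI[OF inj_on_inverseI[of _ r]]) (auto simp: rs)
  ultimately show ?thesis
    unfolding iso_direct_summand_def by blast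
qed

text \<open>The retraction is the projection onto \<open>P\<close> along its complement
  \<open>Q\<close>, followed by the inverse of \<open>s\<close>.\<close>

lemma iso_direct_summandE:
  assumes X: "bimodule R S X" and Y: "bimodule R S Y" and "iso_direct_summand R S X Y"
  obtains s r where "s \<in> bimodule_hom R S X Y" "r \<in> bimodule_hom R S Y X"
    and "\<And>x. x \<in> carrier X \<Longrightarrow> r (s x) = x"
proof -
  interpret X: bimodule R S X by fact
  interpret Y: bimodule R S Y by fact
  obtain P Q s where P: "sub_bimodule R S P Y" and Q: "sub_bimodule R S Q Y"
    and PQ: "P \<inter> Q = {\<zero>\<^bsub>Y\<^esub>}" "P <+>\<^bsub>Y\<^esub> Q = carrier Y"
    and s: "s \<in> bimodule_hom R S X (Y\<lparr>carrier := P\<rparr>)" and bij: "bij_betw s (carrier X) P"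
    using assms(3) unfolding iso_direct_summand_def direct_summand_def by blast
  interpret P: additive_subgroup P Y using P by (simp add: sub_bimodule_def)
  interpret Q: additive_subgroup Q Y using Q by (simp add: sub_bimodule_def)
  have sY: "s \<in> bimodule_hom R S X Y"
    using s P.a_subset by (auto simp: bimodule_hom_def)
  note sD = bimodule_homD[OF sY]
  have sP: "s x \<in> P" if "x \<in> carrier X" for x using bij that by (auto simp: bij_betw_def)
  \<comment> \<open>Both \<open>p - p'\<close> and \<open>q' - q\<close> are the same element, which
    lies in \<open>P\<close> and in \<open>Q\<close> and is therefore zero.\<close>
  have uniq: "p = p'" if "p \<in> P" "p' \<in> P" "q \<in> Q" "q' \<in> Q" "p \<oplus>\<^bsub>Y\<^esub> q = p' \<oplus>\<^bsub>Y\<^esub> q'" for p p' q q'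
  proof -
    have mem: "p \<in> carrier Y" "p' \<in> carrier Y" "q \<in> carrier Y" "q' \<in> carrier Y"
      using that P.a_subset Q.a_subset by auto
    have "p \<ominus>\<^bsub>Y\<^esub> p' = q' \<ominus>\<^bsub>Y\<^esub> q"
    proof -
      have "p = (p' \<oplus>\<^bsub>Y\<^esub> q') \<ominus>\<^bsub>Y\<^esub> q"
        using that(5) mem by (metis Y.add.inv_solve_right Y.a_closed a_minus_def)
      also have "\<dots> = (q' \<ominus>\<^bsub>Y\<^esub> q) \<oplus>\<^bsub>Y\<^esub> p'"
        using mem by (simp add: a_minus_def Y.a_assoc Y.a_comm[of _ p'])
      finally show ?thesis
        using mem by (simp add: a_minus_def Y.a_assoc Y.r_neg)
    qed
    moreover have "p \<ominus>\<^bsub>Y\<^esub> p' \<in> P" "q' \<ominus>\<^bsub>Y\<^esub> q \<in> Q"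
      unfolding a_minus_def using that by auto
    ultimately have "p \<ominus>\<^bsub>Y\<^esub> p' \<in> P \<inter> Q" by simp
    then have "p \<ominus>\<^bsub>Y\<^esub> p' = \<zero>\<^bsub>Y\<^esub>" unfolding PQ(1) by simp
    moreover have "p = (p \<ominus>\<^bsub>Y\<^esub> p') \<oplus>\<^bsub>Y\<^esub> p'"
      using mem by (simp add: a_minus_def Y.a_assoc Y.l_neg)
    ultimately show ?thesis using mem by simp
  qed
  have "\<exists>x\<in>carrier X. \<exists>q\<in>Q. y = s x \<oplus>\<^bsub>Y\<^esub> q" if "y \<in> carrier Y" for y
    using that bij unfolding PQ(2)[symmetric] set_add_def' bij_betw_def by blast
  then obtain r q where r: "\<And>y. y \<in> carrier Y \<Longrightarrow> r y \<in> carrier X"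
    and q: "\<And>y. y \<in> carrier Y \<Longrightarrow> q y \<in> Q"
    and dec: "\<And>y. y \<in> carrier Y \<Longrightarrow> y = s (r y) \<oplus>\<^bsub>Y\<^esub> q y"
    by metis
  have qY: "q y \<in> carrier Y" if "y \<in> carrier Y" for y using q[OF that] Q.a_subset by auto
  \<comment> \<open>So far \<open>r\<close> and \<open>q\<close> are bare choice functions.
    Uniqueness of the decomposition makes \<open>r\<close> a homomorphism: each law below is read
    off from one explicit decomposition of the argument.\<close>
  have r_eqI: "r y = x" if "y \<in> carrier Y" "x \<in> carrier X" "t \<in> Q" "y = s x \<oplus>\<^bsub>Y\<^esub> t" for x y t
  proof -
    have "s (r y) = s x"
      using uniq[of "s (r y)" "s x" "q y" t] that dec[of y] r q sP by metis
    then show ?thesis using bij r that by (auto simp: bij_betw_def inj_on_def)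
  qed
  show thesis
  proof
    show "s \<in> bimodule_hom R S X Y" by (rule sY)
    show "r (s x) = x" if "x \<in> carrier X" for x
      using that sD by (intro r_eqI[of _ _ "\<zero>\<^bsub>Y\<^esub>"]) (auto simp: Q.zero_closed)
    show "r \<in> bimodule_hom R S Y X"
    proof (rule bimodule_homI)
      fix y z assume yz: "y \<in> carrier Y" "z \<in> carrier Y"
      have "y \<oplus>\<^bsub>Y\<^esub> z = (s (r y) \<oplus>\<^bsub>Y\<^esub> q y) \<oplus>\<^bsub>Y\<^esub> (s (r z) \<oplus>\<^bsub>Y\<^esub> q z)"
        using dec yz by simp
      also have "\<dots> = s (r y \<oplus>\<^bsub>X\<^esub> r z) \<oplus>\<^bsub>Y\<^esub> (q y \<oplus>\<^bsub>Y\<^esub> q z)"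
        using yz r qY sD by (simp add: Y.a_ac)
      finally have eq: "y \<oplus>\<^bsub>Y\<^esub> z = s (r y \<oplus>\<^bsub>X\<^esub> r z) \<oplus>\<^bsub>Y\<^esub> (q y \<oplus>\<^bsub>Y\<^esub> q z)" .
      show "r (y \<oplus>\<^bsub>Y\<^esub> z) = r y \<oplus>\<^bsub>X\<^esub> r z"
        by (rule r_eqI[OF _ _ _ eq]) (use yz r q in auto)
    next
      fix a y assume ay: "a \<in> carrier R" "y \<in> carrier Y"
      have "a \<odot>\<^bsub>Y\<^esub> y = a \<odot>\<^bsub>Y\<^esub> (s (r y) \<oplus>\<^bsub>Y\<^esub> q y)"
        using dec ay by simp
      also have "\<dots> = s (a \<odot>\<^bsub>X\<^esub> r y) \<oplus>\<^bsub>Y\<^esub> a \<odot>\<^bsub>Y\<^esub> q y"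
        using ay r qY sD by (simp add: Y.smult_r_distr)
      finally have eq: "a \<odot>\<^bsub>Y\<^esub> y = s (a \<odot>\<^bsub>X\<^esub> r y) \<oplus>\<^bsub>Y\<^esub> a \<odot>\<^bsub>Y\<^esub> q y" .
      show "r (a \<odot>\<^bsub>Y\<^esub> y) = a \<odot>\<^bsub>X\<^esub> r y"
        by (rule r_eqI[OF _ _ _ eq]) (use ay r q Q in \<open>auto simp: sub_bimodule_def Y.smult_closed X.smult_closed\<close>)
    next
      fix a y assume ay: "y \<in> carrier Y" "a \<in> carrier S"
      have "y \<odot>\<^sub>r\<^bsub>Y\<^esub> a = (s (r y) \<oplus>\<^bsub>Y\<^esub> q y) \<odot>\<^sub>r\<^bsub>Y\<^esub> a"
        using dec ay by simp
      also have "\<dots> = s (r y \<odot>\<^sub>r\<^bsub>X\<^esub> a) \<oplus>\<^bsub>Y\<^esub> q y \<odot>\<^sub>r\<^bsub>Y\<^esub> a"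
        using ay r qY sD by (simp add: Y.rsmult_l_distr)
      finally have eq: "y \<odot>\<^sub>r\<^bsub>Y\<^esub> a = s (r y \<odot>\<^sub>r\<^bsub>X\<^esub> a) \<oplus>\<^bsub>Y\<^esub> q y \<odot>\<^sub>r\<^bsub>Y\<^esub> a" .
      show "r (y \<odot>\<^sub>r\<^bsub>Y\<^esub> a) = r y \<odot>\<^sub>r\<^bsub>X\<^esub> a"
        by (rule r_eqI[OF _ _ _ eq]) (use ay r q Q in \<open>auto simp: sub_bimodule_def Y.rsmult_closed X.rsmult_closed\<close>)
    qed (rule r)
  qed
qed

section \<open>Summands of finite powers in coordinates\<close>

lemma finsum_bimodule_power:
  assumes M: "bimodule R S M" and g: "\<And>j. j \<in> J \<Longrightarrow> g j \<in> carrier (bimodule_power M n)" and "finite J"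
  shows "finsum (bimodule_power M n) g J = (\<lambda>i\<in>{..<n}. \<Oplus>\<^bsub>M\<^esub>j\<in>J. g j i)"
proof -
  interpret M: bimodule R S M by fact
  interpret P: bimodule R S "bimodule_power M n" by (rule bimodule_bimodule_power[OF M])
  show ?thesis
    using assms(3,2)
  proof (induction J rule: finite_induct)
    case empty
    show ?case unfolding P.finsum_empty by (simp add: bimodule_power_def)
  next
    case (insert j J)
    have mem: "g k i \<in> carrier M" if "k \<in> insert j J" "i < n" for k i
      using insert.prems[OF that(1)] that(2) by (auto simp: bimodule_power_def)
    have "finsum (bimodule_power M n) g (insert j J) = g j \<oplus>\<^bsub>bimodule_power M n\<^esub> finsum (bimodule_power M n) g J"
      using insert by (intro P.finsum_insert) auto
    also have "\<dots> = (\<lambda>i\<in>{..<n}. \<Oplus>\<^bsub>M\<^esub>k\<in>insert j J. g k i)"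
      using insert mem by (simp add: bimodule_power_def Pi_def cong: restrict_cong)
    finally show ?case .
  qed
qed

text \<open>A homomorphism into a power is a tuple of maps \<open>g i\<close>, and the maps
  \<open>h i\<close> add up to a homomorphism out of it. A resolution of the identity by maps
  through \<open>M\<close> thus splits \<open>X\<close> off a power of \<open>M\<close>.\<close>

lemma iso_direct_summand_powerI:
  fixes g :: "nat \<Rightarrow> 'a \<Rightarrow> 'b" and h :: "nat \<Rightarrow> 'b \<Rightarrow> 'a"
  assumes X: "bimodule R S X" and M: "bimodule R S M"
    and g: "\<And>i. i < n \<Longrightarrow> g i \<in> bimodule_hom R S X M"
    and h: "\<And>i. i < n \<Longrightarrow> h i \<in> bimodule_hom R S M X"
    and id: "\<And>x. x \<in> carrier X \<Longrightarrow> (\<Oplus>\<^bsub>X\<^esub>i\<in>{..<n}. h i (g i x)) = x"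
  shows "iso_direct_summand R S X (bimodule_power M n)"
proof (rule iso_direct_summandI[OF X bimodule_bimodule_power[OF M]])
  interpret X: bimodule R S X by fact
  interpret M: bimodule R S M by fact
  have gc: "g i x \<in> carrier M" if "i < n" "x \<in> carrier X" for i x
    using bimodule_homD(1)[OF g] that by auto
  have hc: "h i x \<in> carrier X" if "i < n" "x \<in> carrier M" for i x
    using bimodule_homD(1)[OF h] that by auto
  have gD: "g i (x \<oplus>\<^bsub>X\<^esub> y) = g i x \<oplus>\<^bsub>M\<^esub> g i y"
    if "i < n" "x \<in> carrier X" "y \<in> carrier X" for i x y
    using bimodule_homD(2)[OF g] that by auto
  have gD': "r \<in> carrier R \<Longrightarrow> g i (r \<odot>\<^bsub>X\<^esub> x) = r \<odot>\<^bsub>M\<^esub> g i x"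
      "s \<in> carrier S \<Longrightarrow> g i (x \<odot>\<^sub>r\<^bsub>X\<^esub> s) = g i x \<odot>\<^sub>r\<^bsub>M\<^esub> s"
    if "i < n" "x \<in> carrier X" for i x r s
    using bimodule_homD(3,4)[OF g] that by auto
  have hD: "h i (x \<oplus>\<^bsub>M\<^esub> y) = h i x \<oplus>\<^bsub>X\<^esub> h i y"
    if "i < n" "x \<in> carrier M" "y \<in> carrier M" for i x y
    using bimodule_homD(2)[OF h] that by auto
  have hD': "r \<in> carrier R \<Longrightarrow> h i (r \<odot>\<^bsub>M\<^esub> x) = r \<odot>\<^bsub>X\<^esub> h i x"
      "s \<in> carrier S \<Longrightarrow> h i (x \<odot>\<^sub>r\<^bsub>M\<^esub> s) = h i x \<odot>\<^sub>r\<^bsub>X\<^esub> s"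
    if "i < n" "x \<in> carrier M" for i x r s
    using bimodule_homD(3,4)[OF h] that by auto
  let ?r = "\<lambda>y. \<Oplus>\<^bsub>X\<^esub>i\<in>{..<n}. h i (y i)"
  show "(\<lambda>x. \<lambda>i\<in>{..<n}. g i x) \<in> bimodule_hom R S X (bimodule_power M n)"
    by (rule bimodule_homI) (auto simp: bimodule_power_def gc gD gD' intro!: restrict_ext)
  show "?r \<in> bimodule_hom R S (bimodule_power M n) X"
  proof (rule bimodule_homI)
    fix x assume "x \<in> carrier (bimodule_power M n)"
    then have x: "x i \<in> carrier M" if "i < n" for i using that by (auto simp: bimodule_power_def)
    show "?r x \<in> carrier X" using x hc by (auto intro!: X.finsum_closed)
    {
      fix y assume "y \<in> carrier (bimodule_power M n)"
      then have y: "y i \<in> carrier M" if "i < n" for i using that by (auto simp: bimodule_power_def)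
      have "?r (x \<oplus>\<^bsub>bimodule_power M n\<^esub> y) = (\<Oplus>\<^bsub>X\<^esub>i\<in>{..<n}. h i (x i) \<oplus>\<^bsub>X\<^esub> h i (y i))"
        using x y hc hD by (intro X.finsum_cong') (auto simp: bimodule_power_def)
      also have "\<dots> = ?r x \<oplus>\<^bsub>X\<^esub> ?r y"
        using x y hc by (intro X.finsum_addf) auto
      finally show "?r (x \<oplus>\<^bsub>bimodule_power M n\<^esub> y) = ?r x \<oplus>\<^bsub>X\<^esub> ?r y" .
    next
      fix r assume "r \<in> carrier R"
      then show "?r (r \<odot>\<^bsub>bimodule_power M n\<^esub> x) = r \<odot>\<^bsub>X\<^esub> ?r x"
        using x hc hD'
        by (subst add_hom_finsum[OF _ _ X.smult_add_hom])
          (auto simp: bimodule_power_def X.M.abelian_group_axioms X.smult_closed intro!: X.finsum_cong')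
    next
      fix s assume "s \<in> carrier S"
      then show "?r (x \<odot>\<^sub>r\<^bsub>bimodule_power M n\<^esub> s) = ?r x \<odot>\<^sub>r\<^bsub>X\<^esub> s"
        using x hc hD'
        by (subst add_hom_finsum[OF _ _ X.rsmult_add_hom])
          (auto simp: bimodule_power_def X.M.abelian_group_axioms X.rsmult_closed intro!: X.finsum_cong')
    }
  qed
  fix x assume x: "x \<in> carrier X"
  have "(\<Oplus>\<^bsub>X\<^esub>i\<in>{..<n}. h i ((\<lambda>i\<in>{..<n}. g i x) i)) = (\<Oplus>\<^bsub>X\<^esub>i\<in>{..<n}. h i (g i x))"
    using x gc hc by (intro X.finsum_cong') auto
  then show "?r (\<lambda>i\<in>{..<n}. g i x) = x" using id[OF x] by simp
qed

text \<open>The decompositions to which this is applied are indexed by pairs, hence the enumeration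
  of an arbitrary finite set. Nonemptiness yields the positive exponent that depth two
  demands.\<close>

lemma iso_direct_summand_powerI_finite:
  assumes X: "bimodule R S X" and M: "bimodule R S M"
    and I: "finite I" "I \<noteq> {}"
    and g: "\<And>i. i \<in> I \<Longrightarrow> g i \<in> bimodule_hom R S X M"
    and h: "\<And>i. i \<in> I \<Longrightarrow> h i \<in> bimodule_hom R S M X"
    and id: "\<And>x. x \<in> carrier X \<Longrightarrow> (\<Oplus>\<^bsub>X\<^esub>i\<in>I. h i (g i x)) = x"
  shows "\<exists>n>0. iso_direct_summand R S X (bimodule_power M n)"
proof -
  interpret X: bimodule R S X by fact
  obtain e where "bij_betw e {0..<card I} I"
    using ex_bij_betw_nat_finite[OF I(1)] by blast
  then have inj: "inj_on e {..<card I}" and img: "e ` {..<card I} = I"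
    by (auto simp: bij_betw_def atLeast0LessThan)
  have e: "e i \<in> I" if "i < card I" for i using img that by auto
  have "iso_direct_summand R S X (bimodule_power M (card I))"
  proof (rule iso_direct_summand_powerI[OF X M, of _ "\<lambda>i. g (e i)" "\<lambda>i. h (e i)"])
    fix x assume x: "x \<in> carrier X"
    have "(\<Oplus>\<^bsub>X\<^esub>i\<in>{..<card I}. h (e i) (g (e i) x)) = (\<Oplus>\<^bsub>X\<^esub>i\<in>e ` {..<card I}. h i (g i x))"
      using x by (intro X.finsum_reindex[symmetric] inj)
        (auto intro!: bimodule_homD(1)[OF h] bimodule_homD(1)[OF g] e)
    then show "(\<Oplus>\<^bsub>X\<^esub>i\<in>{..<card I}. h (e i) (g (e i) x)) = x"
      using id[OF x] by (simp add: img)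
  qed (auto intro: g h e)
  then show ?thesis using I by (intro exI[of _ "card I"]) (simp add: card_gt_0_iff)
qed

text \<open>Here \<open>g i\<close> is the i-th coordinate of the embedding, and \<open>h i\<close>
  is the retraction on the i-th copy of \<open>M\<close>.\<close>

lemma iso_direct_summand_powerE:
  fixes X :: "('r, 'a, 's, 'm) bimodule_scheme" and M :: "('r, 'b, 's, 'n) bimodule_scheme"
  assumes X: "bimodule R S X" and M: "bimodule R S M"
    and "iso_direct_summand R S X (bimodule_power M n)"
  obtains g h where "\<And>i. i < n \<Longrightarrow> g i \<in> bimodule_hom R S X M"
    "\<And>i. i < n \<Longrightarrow> h i \<in> bimodule_hom R S M X"
    "\<And>x. x \<in> carrier X \<Longrightarrow> (\<Oplus>\<^bsub>X\<^esub>i\<in>{..<n}. h i (g i x)) = x"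
proof -
  interpret X: bimodule R S X by fact
  interpret M: bimodule R S M by fact
  let ?P = "bimodule_power M n"
  interpret P: bimodule R S ?P by (rule bimodule_bimodule_power[OF M])
  obtain s r where s: "s \<in> bimodule_hom R S X ?P" and r: "r \<in> bimodule_hom R S ?P X"
    and rs: "\<And>x. x \<in> carrier X \<Longrightarrow> r (s x) = x"
    by (rule iso_direct_summandE[OF X P.bimodule_axioms assms(3)]) iprover
  note sD = bimodule_homD[OF s] and rD = bimodule_homD[OF r]
  have r0: "a \<odot>\<^bsub>M\<^esub> \<zero>\<^bsub>M\<^esub> = \<zero>\<^bsub>M\<^esub>" if "a \<in> carrier R" for a
    using M.smult_r_distr[OF that M.zero_closed M.zero_closed] M.smult_closed[OF that M.zero_closed]
    by simp
  have l0: "\<zero>\<^bsub>M\<^esub> \<odot>\<^sub>r\<^bsub>M\<^esub> t = \<zero>\<^bsub>M\<^esub>" if "t \<in> carrier S" for t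
    using M.rsmult_l_distr[OF M.zero_closed M.zero_closed that] M.rsmult_closed[OF M.zero_closed that]
    by simp
  \<comment> \<open>The i-th coordinate inclusion. It respects both actions because they fix zero,
    which is what \<open>r0\<close> and \<open>l0\<close> are for.\<close>
  define inc where "inc i m = (\<lambda>j\<in>{..<n}. if j = i then m else \<zero>\<^bsub>M\<^esub>)" for i m
  have inc: "inc i \<in> bimodule_hom R S M ?P" for i
    by (rule bimodule_homI)
      (auto simp: inc_def bimodule_power_def r0 l0 M.smult_closed M.rsmult_closed intro!: restrict_ext)
  show thesis
  proof
    fix i assume i: "i < n"
    have "(\<lambda>x. x i) \<in> bimodule_hom R S ?P M"
      using i by (auto simp: bimodule_hom_def bimodule_power_def)
    then show "(\<lambda>x. s x i) \<in> bimodule_hom R S X M"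
      using sD by (auto simp: bimodule_hom_def)
    show "(\<lambda>m. r (inc i m)) \<in> bimodule_hom R S M X"
      using rD bimodule_homD[OF inc[of i]] by (auto simp: bimodule_hom_def)
  next
    fix x assume x: "x \<in> carrier X"
    have sx: "s x i \<in> carrier M" if "i < n" for i
      using sD(1)[OF x] that by (auto simp: bimodule_power_def)
    have inc_s: "inc i (s x i) \<in> carrier ?P" if "i < n" for i
      using bimodule_homD(1)[OF inc sx[OF that]] .
    have "(\<Oplus>\<^bsub>M\<^esub>i\<in>{..<n}. inc i (s x i) j) = s x j" if "j < n" for j
    proof -
      have "(\<Oplus>\<^bsub>M\<^esub>i\<in>{..<n}. inc i (s x i) j) = (\<Oplus>\<^bsub>M\<^esub>i\<in>{..<n}. if j = i then s x i else \<zero>\<^bsub>M\<^esub>)"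
        using that sx by (intro M.finsum_cong') (auto simp: inc_def)
      also have "\<dots> = s x j"
        using that sx by (intro M.finsum_singleton) auto
      finally show ?thesis .
    qed
    \<comment> \<open>An element of the power is the sum of its coordinates put back in place by
      \<open>inc\<close>. Both sides are extensional, so agreement at the indices below
      \<open>n\<close> suffices.\<close>
    then have "finsum ?P (\<lambda>i. inc i (s x i)) {..<n} = s x"
      using sD(1)[OF x] inc_s
      by (subst finsum_bimodule_power[OF M])
        (auto simp: bimodule_power_def intro!: restrict_eq_self[of _ _ "carrier M"])
    then show "(\<Oplus>\<^bsub>X\<^esub>i\<in>{..<n}. r (inc i (s x i))) = x"
      using rs[OF x] inc_s
      by (subst add_hom_finsum[OF _ _ bimodule_hom_add_hom[OF r], symmetric])
        (auto simp: P.abelian_group_axioms X.abelian_group_axioms)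
  qed
qed


section \<open>Universal property of the tensor product\<close>

text \<open>These are the maps that factor through the tensor product over \<open>B\<close>. No
  outer linearity is demanded, so that any abelian group can serve as target; the Casimir identity
  below is applied to several of them.\<close>

definition balanced_map ::
    "('b, 'q) ring_scheme \<Rightarrow> ('r, 'a, 'b, 'm) bimodule_scheme \<Rightarrow> ('b, 'c, 's, 'n) bimodule_scheme
      \<Rightarrow> ('h, 'k) ring_scheme \<Rightarrow> ('a \<Rightarrow> 'c \<Rightarrow> 'h) \<Rightarrow> bool"
  where "balanced_map B M N H \<phi> \<longleftrightarrow>
    (\<forall>x\<in>carrier M. \<phi> x \<in> hom (add_monoid N) (add_monoid H)) \<and>
    (\<forall>y\<in>carrier N. (\<lambda>x. \<phi> x y) \<in> hom (add_monoid M) (add_monoid H)) \<and>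
    (\<forall>x\<in>carrier M. \<forall>b\<in>carrier B. \<forall>y\<in>carrier N. \<phi> (x \<odot>\<^sub>r\<^bsub>M\<^esub> b) y = \<phi> x (b \<odot>\<^bsub>N\<^esub> y))"

lemma balanced_mapI:
  assumes "\<And>x y. \<lbrakk>x \<in> carrier M; y \<in> carrier N\<rbrakk> \<Longrightarrow> \<phi> x y \<in> carrier H"
    and "\<And>x x' y. \<lbrakk>x \<in> carrier M; x' \<in> carrier M; y \<in> carrier N\<rbrakk>
      \<Longrightarrow> \<phi> (x \<oplus>\<^bsub>M\<^esub> x') y = \<phi> x y \<oplus>\<^bsub>H\<^esub> \<phi> x' y"
    and "\<And>x y y'. \<lbrakk>x \<in> carrier M; y \<in> carrier N; y' \<in> carrier N\<rbrakk>
      \<Longrightarrow> \<phi> x (y \<oplus>\<^bsub>N\<^esub> y') = \<phi> x y \<oplus>\<^bsub>H\<^esub> \<phi> x y'"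
    and "\<And>x b y. \<lbrakk>x \<in> carrier M; b \<in> carrier B; y \<in> carrier N\<rbrakk>
      \<Longrightarrow> \<phi> (x \<odot>\<^sub>r\<^bsub>M\<^esub> b) y = \<phi> x (b \<odot>\<^bsub>N\<^esub> y)"
  shows "balanced_map B M N H \<phi>"
  using assms by (auto simp: balanced_map_def hom_def)

lemma balanced_mapD:
  assumes "balanced_map B M N H \<phi>"
  shows "\<lbrakk>x \<in> carrier M; y \<in> carrier N\<rbrakk> \<Longrightarrow> \<phi> x y \<in> carrier H"
    and "\<lbrakk>x \<in> carrier M; x' \<in> carrier M; y \<in> carrier N\<rbrakk>
      \<Longrightarrow> \<phi> (x \<oplus>\<^bsub>M\<^esub> x') y = \<phi> x y \<oplus>\<^bsub>H\<^esub> \<phi> x' y"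
    and "\<lbrakk>x \<in> carrier M; y \<in> carrier N; y' \<in> carrier N\<rbrakk>
      \<Longrightarrow> \<phi> x (y \<oplus>\<^bsub>N\<^esub> y') = \<phi> x y \<oplus>\<^bsub>H\<^esub> \<phi> x y'"
    and "\<lbrakk>x \<in> carrier M; b \<in> carrier B; y \<in> carrier N\<rbrakk>
      \<Longrightarrow> \<phi> (x \<odot>\<^sub>r\<^bsub>M\<^esub> b) y = \<phi> x (b \<odot>\<^bsub>N\<^esub> y)"
    and "x \<in> carrier M \<Longrightarrow> \<phi> x \<in> hom (add_monoid N) (add_monoid H)"
    and "y \<in> carrier N \<Longrightarrow> (\<lambda>x. \<phi> x y) \<in> hom (add_monoid M) (add_monoid H)"
  using assms by (auto simp: balanced_map_def hom_def)

definition pure_tensor ::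
    "('b, 'q) ring_scheme \<Rightarrow> ('r, 'a, 'b, 'm) bimodule_scheme \<Rightarrow> ('b, 'c, 's, 'n) bimodule_scheme
      \<Rightarrow> 'a \<Rightarrow> 'c \<Rightarrow> ('a \<times> 'c \<Rightarrow>\<^sub>0 int) set"
  where "pure_tensor B M N x y = tensor_kernel B M N #>\<^bsub>tensor_free M N\<^esub> frag_of (x, y)"

section \<open>Pure tensors and the two actions on them\<close>

locale tensor_product = M: bimodule R B M + N: bimodule B S N
  for R :: "('r, 'p) ring_scheme" and B :: "('b, 'q) ring_scheme" and S :: "('s, 't) ring_scheme"
    and M :: "('r, 'a, 'b, 'm) bimodule_scheme" and N :: "('b, 'c, 's, 'n) bimodule_scheme"
begin

abbreviation T where "T \<equiv> tensor_bimodule B M N"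
abbreviation F where "F \<equiv> tensor_free M N"
abbreviation K where "K \<equiv> tensor_kernel B M N"
abbreviation pure where "pure \<equiv> pure_tensor B M N"

sublocale T: bimodule R S T
  by (rule bimodule_tensor[OF M.bimodule_axioms N.bimodule_axioms])

lemma comm_group_F: "comm_group F"
  by (simp add: tensor_free_def abelian_free_Abelian_group)

lemma relations_subset: "tensor_relations B M N \<subseteq> carrier F"
proof -
  have *: "a \<in> carrier F \<Longrightarrow> b \<in> carrier F \<Longrightarrow> a + b \<in> carrier F"
     "a \<in> carrier F \<Longrightarrow> b \<in> carrier F \<Longrightarrow> a - b \<in> carrier F" for a b
    using keys_add[of a b] keys_diff[of a b] by (auto simp: tensor_free_def)
  have "p \<in> carrier M \<times> carrier N \<Longrightarrow> frag_of p \<in> carrier F" for p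
    by (simp add: tensor_free_def)
  then show ?thesis
    unfolding tensor_relations_def
    by (auto intro!: * simp: M.rsmult_closed N.smult_closed)
qed

lemma normal_K: "K \<lhd> F"
proof -
  interpret F: comm_group F by (rule comm_group_F)
  show ?thesis
    unfolding tensor_kernel_def by (rule F.subgroup_imp_normal[OF F.generate_is_subgroup[OF relations_subset]])
qed

lemma T_eq:
  "carrier T = carrier (F Mod K)"
  "hom G (add_monoid T) = hom G (F Mod K)" "hom (add_monoid T) H = hom (F Mod K) H"
  by (simp_all add: tensor_bimodule_def Let_def hom_def)

lemma frag_of_closed: "\<lbrakk>x \<in> carrier M; y \<in> carrier N\<rbrakk> \<Longrightarrow> frag_of (x, y) \<in> carrier F"
  by (simp add: tensor_free_def)

lemma mult_F: "a \<otimes>\<^bsub>F\<^esub> b = a + b" by (simp add: tensor_free_def)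

lemma pure_closed: "\<lbrakk>x \<in> carrier M; y \<in> carrier N\<rbrakk> \<Longrightarrow> pure x y \<in> carrier T"
  unfolding pure_tensor_def T_eq by (auto simp: carrier_FactGroup frag_of_closed)

lemma coset_eqI:
  assumes "a - b \<in> K" "a \<in> carrier F" "b \<in> carrier F"
  shows "K #>\<^bsub>F\<^esub> a = K #>\<^bsub>F\<^esub> b"
proof -
  interpret F: comm_group F by (rule comm_group_F)
  interpret K: normal K F by (rule normal_K)
  have "a \<in> K #>\<^bsub>F\<^esub> b"
    using assms(1) by (force simp: r_coset_def mult_F)
  then show ?thesis using F.repr_independence[OF _ assms(3) K.is_subgroup] by simp
qed

lemma relation_coset_eq:
  "\<lbrakk>a - b \<in> tensor_relations B M N; a \<in> carrier F; b \<in> carrier F\<rbrakk> \<Longrightarrow> K #>\<^bsub>F\<^esub> a = K #>\<^bsub>F\<^esub> b"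
  by (rule coset_eqI) (auto simp: tensor_kernel_def intro: generate.incl)

lemma add_coset:
  "\<lbrakk>a \<in> carrier F; b \<in> carrier F\<rbrakk> \<Longrightarrow> (K #>\<^bsub>F\<^esub> a) \<oplus>\<^bsub>T\<^esub> (K #>\<^bsub>F\<^esub> b) = K #>\<^bsub>F\<^esub> (a + b)"
  using normal.rcos_sum[OF normal_K, of a b]
  by (simp add: tensor_bimodule_def Let_def FactGroup_def mult_F)

lemma add_F_closed: "\<lbrakk>a \<in> carrier F; b \<in> carrier F\<rbrakk> \<Longrightarrow> a + b \<in> carrier F"
  using keys_add[of a b] by (auto simp: tensor_free_def)

text \<open>Each of the three laws is one family of generators of \<open>K\<close>, read in the
  quotient.\<close>

lemma balanced_pure: "balanced_map B M N T pure"
proof (rule balanced_mapI)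
  fix x x' y assume "x \<in> carrier M" "x' \<in> carrier M" "y \<in> carrier N"
  then show "pure (x \<oplus>\<^bsub>M\<^esub> x') y = pure x y \<oplus>\<^bsub>T\<^esub> pure x' y"
    unfolding pure_tensor_def
    by (subst add_coset, simp_all add: frag_of_closed, intro relation_coset_eq)
      (auto simp: tensor_relations_def frag_of_closed intro: add_F_closed)
next
  fix x y y' assume "x \<in> carrier M" "y \<in> carrier N" "y' \<in> carrier N"
  then show "pure x (y \<oplus>\<^bsub>N\<^esub> y') = pure x y \<oplus>\<^bsub>T\<^esub> pure x y'"
    unfolding pure_tensor_def
    by (subst add_coset, simp_all add: frag_of_closed, intro relation_coset_eq)
      (auto simp: tensor_relations_def frag_of_closed intro: add_F_closed)
next
  fix x b y assume "x \<in> carrier M" "b \<in> carrier B" "y \<in> carrier N"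
  then show "pure (x \<odot>\<^sub>r\<^bsub>M\<^esub> b) y = pure x (b \<odot>\<^bsub>N\<^esub> y)"
    unfolding pure_tensor_def
    by (intro relation_coset_eq)
      (auto simp: tensor_relations_def M.rsmult_closed N.smult_closed intro!: frag_of_closed)
qed (rule pure_closed)

text \<open>The actions on cosets are defined by images, so it suffices to find one representative.\<close>

lemma coset_eq_pure:
  assumes "X \<in> carrier T" "frag_of (x, y) \<in> X" "x \<in> carrier M" "y \<in> carrier N"
  shows "X = pure x y"
proof -
  interpret F: comm_group F by (rule comm_group_F)
  interpret K: normal K F by (rule normal_K)
  obtain a where "a \<in> carrier F" "X = K #>\<^bsub>F\<^esub> a"
    using assms(1) by (auto simp: T_eq carrier_FactGroup)
  then show ?thesis
    unfolding pure_tensor_def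
    using F.repr_independence[OF _ _ K.is_subgroup] assms(2) by metis
qed

lemma frag_of_in_pure: "\<lbrakk>x \<in> carrier M; y \<in> carrier N\<rbrakk> \<Longrightarrow> frag_of (x, y) \<in> pure x y"
  using group.rcos_self[OF comm_group.axioms(2)[OF comm_group_F]] normal_imp_subgroup[OF normal_K]
  by (simp add: pure_tensor_def frag_of_closed)

text \<open>Both actions on \<open>T\<close> add \<open>K\<close> to an image of a coset. As
  \<open>K\<close> contains 0, the image itself survives, and with it the representative that
  identifies the resulting coset.\<close>

lemma subset_set_mult_K: "X \<subseteq> K <#>\<^bsub>F\<^esub> X"
proof -
  have "0 \<in> K"
    using subgroup.one_closed[OF normal_imp_subgroup[OF normal_K]] by (simp add: tensor_free_def)
  then show ?thesis by (force simp: set_mult_def mult_F)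
qed

lemma smult_pure:
  assumes "r \<in> carrier R" "x \<in> carrier M" "y \<in> carrier N"
  shows "r \<odot>\<^bsub>T\<^esub> pure x y = pure (r \<odot>\<^bsub>M\<^esub> x) y"
proof (rule coset_eq_pure)
  let ?L = "frag_extend (\<lambda>(x, y :: 'c). frag_of (r \<odot>\<^bsub>M\<^esub> x, y))"
  have "frag_of (r \<odot>\<^bsub>M\<^esub> x, y) \<in> ?L ` pure x y"
    using assms by (intro image_eqI[OF _ frag_of_in_pure]) simp_all
  then show "frag_of (r \<odot>\<^bsub>M\<^esub> x, y) \<in> r \<odot>\<^bsub>T\<^esub> pure x y"
    using subsetD[OF subset_set_mult_K] by (simp add: tensor_bimodule_def Let_def)
qed (use assms in \<open>auto intro: T.smult_closed pure_closed M.smult_closed\<close>)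

lemma rsmult_pure:
  assumes "s \<in> carrier S" "x \<in> carrier M" "y \<in> carrier N"
  shows "pure x y \<odot>\<^sub>r\<^bsub>T\<^esub> s = pure x (y \<odot>\<^sub>r\<^bsub>N\<^esub> s)"
proof (rule coset_eq_pure)
  let ?L = "frag_extend (\<lambda>(x :: 'a, y). frag_of (x, y \<odot>\<^sub>r\<^bsub>N\<^esub> s))"
  have "frag_of (x, y \<odot>\<^sub>r\<^bsub>N\<^esub> s) \<in> ?L ` pure x y"
    using assms by (intro image_eqI[OF _ frag_of_in_pure]) simp_all
  then show "frag_of (x, y \<odot>\<^sub>r\<^bsub>N\<^esub> s) \<in> pure x y \<odot>\<^sub>r\<^bsub>T\<^esub> s"
    using subsetD[OF subset_set_mult_K] by (simp add: tensor_bimodule_def Let_def)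
qed (use assms in \<open>auto intro: T.rsmult_closed pure_closed N.rsmult_closed\<close>)

section \<open>Maps out of the tensor product\<close>

lemma add_hom_coset: "(\<lambda>a. K #>\<^bsub>F\<^esub> a) \<in> hom F (add_monoid T)"
  by (subst T_eq(2)) (rule normal.r_coset_hom_Mod[OF normal_K])

text \<open>Pure tensors generate \<open>T\<close> as a group. Since \<open>g\<close> and
  \<open>h\<close> are only required to be additive, linearity of a map can itself be proved by
  comparing two additive maps on pure tensors.\<close>

lemma tensor_hom_eqI:
  assumes H: "abelian_group H"
    and g: "g \<in> hom (add_monoid T) (add_monoid H)" and h: "h \<in> hom (add_monoid T) (add_monoid H)"
    and eq: "\<And>x y. \<lbrakk>x \<in> carrier M; y \<in> carrier N\<rbrakk> \<Longrightarrow> g (pure x y) = h (pure x y)"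
    and t: "t \<in> carrier T"
  shows "g t = h t"
proof -
  interpret H: abelian_group H by fact
  interpret F: comm_group F by (rule comm_group_F)
  interpret g: group_hom F "add_monoid H" "\<lambda>a. g (K #>\<^bsub>F\<^esub> a)"
    using hom_compose[OF add_hom_coset g]
    by (simp add: group_hom_def group_hom_axioms_def o_def F.is_group)
  interpret h: group_hom F "add_monoid H" "\<lambda>a. h (K #>\<^bsub>F\<^esub> a)"
    using hom_compose[OF add_hom_coset h]
    by (simp add: group_hom_def group_hom_axioms_def o_def F.is_group)
  obtain a where a: "a \<in> carrier F" "t = K #>\<^bsub>F\<^esub> a"
    using t by (auto simp: T_eq carrier_FactGroup)
  have "Poly_Mapping.keys a \<subseteq> carrier M \<times> carrier N" using a(1) by (simp add: tensor_free_def)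
  \<comment> \<open>Membership in \<open>F\<close> is carried through the induction because the case
    of a difference applies the homomorphism laws to both parts.\<close>
  then have "a \<in> carrier F \<and> g (K #>\<^bsub>F\<^esub> a) = h (K #>\<^bsub>F\<^esub> a)"
  proof (induction a rule: frag_induction)
    case zero
    have "0 = \<one>\<^bsub>F\<^esub>" by (simp add: tensor_free_def)
    then show ?case using F.one_closed g.hom_one h.hom_one by metis
  next
    case (one p)
    then show ?case
      using eq[of "fst p" "snd p"] frag_of_closed[of "fst p" "snd p"] by (auto simp: pure_tensor_def)
  next
    case (diff a b)
    have "a - b = a \<otimes>\<^bsub>F\<^esub> inv\<^bsub>F\<^esub> b"
      using diff by (simp add: tensor_free_def)
    then show ?case
      using diff g.hom_mult[of a "inv\<^bsub>F\<^esub> b"] h.hom_mult[of a "inv\<^bsub>F\<^esub> b"] g.hom_inv[of b] h.hom_inv[of b]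
      by simp
  qed
  then show ?thesis using a by simp
qed

text \<open>The map extends to the free abelian group on \<open>M \<times> N\<close>, kills the
  generators of \<open>K\<close>, and so factors through the quotient.\<close>

lemma tensor_lift:
  assumes H: "abelian_group H" and \<phi>: "balanced_map B M N H \<phi>"
  obtains h where "h \<in> hom (add_monoid T) (add_monoid H)"
    "\<And>x y. \<lbrakk>x \<in> carrier M; y \<in> carrier N\<rbrakk> \<Longrightarrow> h (pure x y) = \<phi> x y"
proof -
  interpret H: abelian_group H by fact
  interpret F: comm_group F by (rule comm_group_F)
  interpret K: normal K F by (rule normal_K)
  note \<phi>D = balanced_mapD[OF \<phi>]
  have "(\<lambda>p. \<phi> (fst p) (snd p)) ` (carrier M \<times> carrier N) \<subseteq> carrier (add_monoid H)"
    using \<phi>D(1) by auto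
  then obtain g where g: "g \<in> hom F (add_monoid H)"
    and g_of: "\<And>x y. \<lbrakk>x \<in> carrier M; y \<in> carrier N\<rbrakk> \<Longrightarrow> g (frag_of (x, y)) = \<phi> x y"
    using comm_group.free_Abelian_group_universal[OF H.a_comm_group]
    unfolding tensor_free_def by (metis (no_types, lifting) SigmaI fst_conv snd_conv)
  interpret g: group_hom F "add_monoid H" g
    using g by (simp add: group_hom_def group_hom_axioms_def F.is_group)
  have g_eq: "g a = g b \<Longrightarrow> g (a - b) = \<zero>\<^bsub>H\<^esub>" if "a \<in> carrier F" "b \<in> carrier F" for a b
  proof -
    have "a - b = a \<otimes>\<^bsub>F\<^esub> inv\<^bsub>F\<^esub> b"
      using that by (simp add: tensor_free_def)
    then show "g a = g b \<Longrightarrow> g (a - b) = \<zero>\<^bsub>H\<^esub>"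
      using that g.hom_mult[of a "inv\<^bsub>F\<^esub> b"] g.hom_inv[of b] g.hom_closed[of b]
      by (simp add: a_inv_def[symmetric] H.r_neg)
  qed
  have g_add: "g (a + b) = g a \<oplus>\<^bsub>H\<^esub> g b" if "a \<in> carrier F" "b \<in> carrier F" for a b
    using g.hom_mult[OF that] by (simp add: mult_F)
  \<comment> \<open>Every relation is a difference of two elements which \<open>g\<close> maps to
    the same value because \<open>\<phi>\<close> is balanced; \<open>g_eq\<close> reduces the claim
    to that equality.\<close>
  have "g a = \<zero>\<^bsub>H\<^esub>" if "a \<in> tensor_relations B M N" for a
    using that unfolding tensor_relations_def
    by (auto simp: g_of g_add frag_of_closed \<phi>D(2-4) M.rsmult_closed N.smult_closed
        intro!: g_eq frag_of_closed add_F_closed)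
  then have "tensor_relations B M N \<subseteq> kernel F (add_monoid H) g"
    using relations_subset by (auto simp: kernel_def)
  then have ker: "K \<subseteq> kernel F (add_monoid H) g"
    unfolding tensor_kernel_def by (rule F.generate_subgroup_incl[OF _ g.subgroup_kernel])
  have g_coset: "g a = g b" if "a \<in> carrier F" "b \<in> carrier F" "K #>\<^bsub>F\<^esub> a = K #>\<^bsub>F\<^esub> b" for a b
  proof -
    have "a \<in> K #>\<^bsub>F\<^esub> b" using that F.rcos_self[OF that(1) K.is_subgroup] by simp
    then obtain k where "k \<in> K" "a = k \<otimes>\<^bsub>F\<^esub> b" by (auto simp: r_coset_def)
    moreover from this have "g k = \<zero>\<^bsub>H\<^esub>" "k \<in> carrier F"
      using ker by (auto simp: kernel_def)
    ultimately show ?thesis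
      using that g.hom_mult[of k b] g.hom_closed[of b] H.l_zero[of "g b"] by simp
  qed
  obtain h where h: "h \<in> hom (add_monoid T) (add_monoid H)"
    and h_coset: "\<And>a. a \<in> carrier F \<Longrightarrow> h (K #>\<^bsub>F\<^esub> a) = g a"
    unfolding T_eq(3) using FactGroup_universal[OF g normal_K g_coset] by metis
  show thesis
    using h by (rule that) (simp add: pure_tensor_def frag_of_closed h_coset g_of)
qed

lemma tensor_lift_bimodule:
  assumes H: "bimodule R S H" and \<phi>: "balanced_map B M N H \<phi>"
    and left: "\<And>r x y. \<lbrakk>r \<in> carrier R; x \<in> carrier M; y \<in> carrier N\<rbrakk>
      \<Longrightarrow> \<phi> (r \<odot>\<^bsub>M\<^esub> x) y = r \<odot>\<^bsub>H\<^esub> \<phi> x y"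
    and right: "\<And>s x y. \<lbrakk>s \<in> carrier S; x \<in> carrier M; y \<in> carrier N\<rbrakk>
      \<Longrightarrow> \<phi> x (y \<odot>\<^sub>r\<^bsub>N\<^esub> s) = \<phi> x y \<odot>\<^sub>r\<^bsub>H\<^esub> s"
  obtains h where "h \<in> bimodule_hom R S T H"
    "\<And>x y. \<lbrakk>x \<in> carrier M; y \<in> carrier N\<rbrakk> \<Longrightarrow> h (pure x y) = \<phi> x y"
proof -
  interpret H: bimodule R S H by fact
  obtain h where h: "h \<in> hom (add_monoid T) (add_monoid H)"
    and h_pure: "\<And>x y. \<lbrakk>x \<in> carrier M; y \<in> carrier N\<rbrakk> \<Longrightarrow> h (pure x y) = \<phi> x y"
    using tensor_lift[OF H.abelian_group_axioms \<phi>] by metis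
  have "h (r \<odot>\<^bsub>T\<^esub> t) = r \<odot>\<^bsub>H\<^esub> h t" if "r \<in> carrier R" "t \<in> carrier T" for r t
  proof (rule tensor_hom_eqI[OF H.abelian_group_axioms _ _ _ that(2)])
    show "(\<lambda>t. h (r \<odot>\<^bsub>T\<^esub> t)) \<in> hom (add_monoid T) (add_monoid H)"
      using hom_compose[OF T.smult_add_hom[OF that(1)] h] by (simp add: o_def)
    show "(\<lambda>t. r \<odot>\<^bsub>H\<^esub> h t) \<in> hom (add_monoid T) (add_monoid H)"
      using hom_compose[OF h H.smult_add_hom[OF that(1)]] by (simp add: o_def)
  qed (simp add: that(1) smult_pure M.smult_closed h_pure left)
  moreover have "h (t \<odot>\<^sub>r\<^bsub>T\<^esub> s) = h t \<odot>\<^sub>r\<^bsub>H\<^esub> s" if "s \<in> carrier S" "t \<in> carrier T" for s t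
  proof (rule tensor_hom_eqI[OF H.abelian_group_axioms _ _ _ that(2)])
    show "(\<lambda>t. h (t \<odot>\<^sub>r\<^bsub>T\<^esub> s)) \<in> hom (add_monoid T) (add_monoid H)"
      using hom_compose[OF T.rsmult_add_hom[OF that(1)] h] by (simp add: o_def)
    show "(\<lambda>t. h t \<odot>\<^sub>r\<^bsub>H\<^esub> s) \<in> hom (add_monoid T) (add_monoid H)"
      using hom_compose[OF h H.rsmult_add_hom[OF that(1)]] by (simp add: o_def)
  qed (simp add: that(1) rsmult_pure N.rsmult_closed h_pure right)
  ultimately have "h \<in> bimodule_hom R S T H"
    using h by (auto simp: bimodule_hom_def hom_def)
  then show thesis using that h_pure by blast
qed

end

section \<open>Depth two from a multiplicative decomposition of a Frobenius homomorphism\<close>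

lemma ring_bimodule_simps [simp]:
  "carrier (ring_bimodule A f g) = carrier A"
  "add (ring_bimodule A f g) = add A"
  "ring.zero (ring_bimodule A f g) = \<zero>\<^bsub>A\<^esub>"
  "r \<odot>\<^bsub>ring_bimodule A f g\<^esub> a = f r \<otimes>\<^bsub>A\<^esub> a"
  "a \<odot>\<^sub>r\<^bsub>ring_bimodule A f g\<^esub> s = a \<otimes>\<^bsub>A\<^esub> g s"
  by (simp_all add: ring_bimodule_def)

lemma ring_hom_ring_id: "ring A \<Longrightarrow> ring_hom_ring A A id"
  by (rule ring_hom_ringI) auto

lemma balanced_map_finsum:
  assumes "balanced_map C (ring_bimodule A f k) (ring_bimodule A l g) H \<phi>"
    and "ring A" "abelian_group H" "h \<in> I \<rightarrow> carrier A" "a \<in> carrier A"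
  shows "\<phi> (finsum A h I) a = (\<Oplus>\<^bsub>H\<^esub>i\<in>I. \<phi> (h i) a)"
    and "\<phi> a (finsum A h I) = (\<Oplus>\<^bsub>H\<^esub>i\<in>I. \<phi> a (h i))"
proof -
  have "(\<lambda>b. \<phi> b a) \<in> hom (add_monoid A) (add_monoid H)" "\<phi> a \<in> hom (add_monoid A) (add_monoid H)"
    using assms(1,5) by (auto simp: balanced_map_def hom_def)
  then show "\<phi> (finsum A h I) a = (\<Oplus>\<^bsub>H\<^esub>i\<in>I. \<phi> (h i) a)"
      "\<phi> a (finsum A h I) = (\<Oplus>\<^bsub>H\<^esub>i\<in>I. \<phi> a (h i))"
    using add_hom_finsum[OF ring.is_abelian_group[OF assms(2)] assms(3) _ assms(4)] by blast+
qed

lemma (in abelian_monoid) finsum_add_homI: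
  assumes "\<And>i. i \<in> I \<Longrightarrow> g i \<in> hom (add_monoid M) (add_monoid G)"
  shows "(\<lambda>a. \<Oplus>i\<in>I. g i a) \<in> hom (add_monoid M) (add_monoid G)"
proof (rule add_homI)
  have closed: "g i a \<in> carrier G" if "i \<in> I" "a \<in> carrier M" for i a
    using assms[OF that(1)] that(2) by (auto simp: hom_def)
  show "(\<Oplus>i\<in>I. g i a) \<in> carrier G" if "a \<in> carrier M" for a
    using closed that by (intro finsum_closed) auto
  show "(\<Oplus>i\<in>I. g i (a \<oplus>\<^bsub>M\<^esub> b)) = (\<Oplus>i\<in>I. g i a) \<oplus> (\<Oplus>i\<in>I. g i b)"
    if "a \<in> carrier M" "b \<in> carrier M" for a b
  proof -
    have "(\<Oplus>i\<in>I. g i (a \<oplus>\<^bsub>M\<^esub> b)) = (\<Oplus>i\<in>I. g i a \<oplus> g i b)"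
      using assms closed that by (intro finsum_cong') (auto simp: hom_def)
    also have "\<dots> = (\<Oplus>i\<in>I. g i a) \<oplus> (\<Oplus>i\<in>I. g i b)"
      using closed that by (intro finsum_addf) auto
    finally show ?thesis .
  qed
qed

text \<open>The dual bases are indexed by a finite set of any type, not by an initial segment of the
  naturals, so that those of the endomorphism ring, indexed by pairs, form an instance as
  well.\<close>

locale frobenius_system = ring_hom_ring C A k
  for C :: "('c, 'n) ring_scheme" and A :: "('a, 'm) ring_scheme" and k +
  fixes E :: "'a \<Rightarrow> 'c" and I :: "'i set" and x y :: "'i \<Rightarrow> 'a"
  assumes E_hom: "E \<in> bimodule_hom C C (ring_bimodule A k k) (ring_bimodule C id id)"
    and finite_I: "finite I"
    and x_closed: "i \<in> I \<Longrightarrow> x i \<in> carrier A" and y_closed: "i \<in> I \<Longrightarrow> y i \<in> carrier A"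
    and dual_basis_left: "a \<in> carrier A \<Longrightarrow> (\<Oplus>\<^bsub>A\<^esub>i\<in>I. k (E (a \<otimes>\<^bsub>A\<^esub> x i)) \<otimes>\<^bsub>A\<^esub> y i) = a"
    and dual_basis_right: "a \<in> carrier A \<Longrightarrow> (\<Oplus>\<^bsub>A\<^esub>i\<in>I. x i \<otimes>\<^bsub>A\<^esub> k (E (y i \<otimes>\<^bsub>A\<^esub> a))) = a"
begin

lemma E_closed: "a \<in> carrier A \<Longrightarrow> E a \<in> carrier C"
  and E_add: "\<lbrakk>a \<in> carrier A; b \<in> carrier A\<rbrakk> \<Longrightarrow> E (a \<oplus>\<^bsub>A\<^esub> b) = E a \<oplus>\<^bsub>C\<^esub> E b"
  and E_left: "\<lbrakk>c \<in> carrier C; a \<in> carrier A\<rbrakk> \<Longrightarrow> E (k c \<otimes>\<^bsub>A\<^esub> a) = c \<otimes>\<^bsub>C\<^esub> E a"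
  and E_right: "\<lbrakk>a \<in> carrier A; c \<in> carrier C\<rbrakk> \<Longrightarrow> E (a \<otimes>\<^bsub>A\<^esub> k c) = E a \<otimes>\<^bsub>C\<^esub> c"
  using E_hom by (auto simp: bimodule_hom_def)

text \<open>The element \<open>\<Sum> x i \<otimes> y i\<close> commutes with every
  \<open>a\<close>: expand \<open>a x i\<close> by \<open>dual_basis_right\<close>, move the
  coefficient \<open>E (y j a x i)\<close>, which lies in \<open>C\<close>, across the tensor sign,
  and contract by \<open>dual_basis_left\<close>. A balanced map in place of the tensor makes the
  identity directly usable for sums in \<open>B\<close>, in \<open>A\<close> and in a tensor
  product.\<close>

lemma casimir:
  assumes H: "abelian_group H"
    and \<phi>: "balanced_map C (ring_bimodule A f k) (ring_bimodule A k g) H \<phi>" and a: "a \<in> carrier A"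
  shows "(\<Oplus>\<^bsub>H\<^esub>i\<in>I. \<phi> (a \<otimes>\<^bsub>A\<^esub> x i) (y i)) = (\<Oplus>\<^bsub>H\<^esub>i\<in>I. \<phi> (x i) (y i \<otimes>\<^bsub>A\<^esub> a))"
proof -
  interpret H: abelian_group H by fact
  have \<phi>_closed: "\<phi> u v \<in> carrier H" if "u \<in> carrier A" "v \<in> carrier A" for u v
    using balanced_mapD(1)[OF \<phi>] that by simp
  note sum_left = balanced_map_finsum(1)[OF \<phi> S.ring_axioms H]
    and sum_right = balanced_map_finsum(2)[OF \<phi> S.ring_axioms H]
  have cl: "k (E u) \<in> carrier A" if "u \<in> carrier A" for u
    using E_closed that by simp
  have "(\<Oplus>\<^bsub>H\<^esub>i\<in>I. \<phi> (a \<otimes>\<^bsub>A\<^esub> x i) (y i))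
      = (\<Oplus>\<^bsub>H\<^esub>i\<in>I. \<Oplus>\<^bsub>H\<^esub>j\<in>I. \<phi> (x j) (k (E (y j \<otimes>\<^bsub>A\<^esub> a \<otimes>\<^bsub>A\<^esub> x i)) \<otimes>\<^bsub>A\<^esub> y i))"
  proof (rule H.finsum_cong')
    fix i assume i: "i \<in> I"
    have "\<phi> (a \<otimes>\<^bsub>A\<^esub> x i) (y i) = \<phi> (\<Oplus>\<^bsub>A\<^esub>j\<in>I. x j \<otimes>\<^bsub>A\<^esub> k (E (y j \<otimes>\<^bsub>A\<^esub> (a \<otimes>\<^bsub>A\<^esub> x i)))) (y i)"
      using i a x_closed by (simp add: dual_basis_right)
    also have "\<dots> = (\<Oplus>\<^bsub>H\<^esub>j\<in>I. \<phi> (x j \<otimes>\<^bsub>A\<^esub> k (E (y j \<otimes>\<^bsub>A\<^esub> (a \<otimes>\<^bsub>A\<^esub> x i)))) (y i))"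
      using i a by (intro sum_left) (auto intro!: S.m_closed cl x_closed y_closed)
    also have "\<dots> = (\<Oplus>\<^bsub>H\<^esub>j\<in>I. \<phi> (x j) (k (E (y j \<otimes>\<^bsub>A\<^esub> a \<otimes>\<^bsub>A\<^esub> x i)) \<otimes>\<^bsub>A\<^esub> y i))"
    proof (rule H.finsum_cong')
      fix j assume "j \<in> I"
      then show "\<phi> (x j \<otimes>\<^bsub>A\<^esub> k (E (y j \<otimes>\<^bsub>A\<^esub> (a \<otimes>\<^bsub>A\<^esub> x i)))) (y i)
          = \<phi> (x j) (k (E (y j \<otimes>\<^bsub>A\<^esub> a \<otimes>\<^bsub>A\<^esub> x i)) \<otimes>\<^bsub>A\<^esub> y i)"
        using i a x_closed y_closed balanced_mapD(4)[OF \<phi>, of "x j" "E (y j \<otimes>\<^bsub>A\<^esub> (a \<otimes>\<^bsub>A\<^esub> x i))" "y i"]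
        by (simp add: E_closed S.m_assoc)
    qed (use i a in \<open>auto intro!: \<phi>_closed S.m_closed cl x_closed y_closed\<close>)
    finally show "\<phi> (a \<otimes>\<^bsub>A\<^esub> x i) (y i)
      = (\<Oplus>\<^bsub>H\<^esub>j\<in>I. \<phi> (x j) (k (E (y j \<otimes>\<^bsub>A\<^esub> a \<otimes>\<^bsub>A\<^esub> x i)) \<otimes>\<^bsub>A\<^esub> y i))" .
  qed (use a in \<open>auto intro!: H.finsum_closed \<phi>_closed S.m_closed cl x_closed y_closed\<close>)
  also have "\<dots> = (\<Oplus>\<^bsub>H\<^esub>j\<in>I. \<Oplus>\<^bsub>H\<^esub>i\<in>I. \<phi> (x j) (k (E (y j \<otimes>\<^bsub>A\<^esub> a \<otimes>\<^bsub>A\<^esub> x i)) \<otimes>\<^bsub>A\<^esub> y i))"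
    using a by (intro H.finsum_swap finite_I \<phi>_closed S.m_closed cl x_closed y_closed)
  also have "\<dots> = (\<Oplus>\<^bsub>H\<^esub>j\<in>I. \<phi> (x j) (y j \<otimes>\<^bsub>A\<^esub> a))"
  proof (rule H.finsum_cong')
    fix j assume j: "j \<in> I"
    have "(\<Oplus>\<^bsub>H\<^esub>i\<in>I. \<phi> (x j) (k (E (y j \<otimes>\<^bsub>A\<^esub> a \<otimes>\<^bsub>A\<^esub> x i)) \<otimes>\<^bsub>A\<^esub> y i))
        = \<phi> (x j) (\<Oplus>\<^bsub>A\<^esub>i\<in>I. k (E (y j \<otimes>\<^bsub>A\<^esub> a \<otimes>\<^bsub>A\<^esub> x i)) \<otimes>\<^bsub>A\<^esub> y i)"
      using j a by (intro sum_right[symmetric]) (auto intro!: S.m_closed cl x_closed y_closed)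
    then show "(\<Oplus>\<^bsub>H\<^esub>i\<in>I. \<phi> (x j) (k (E (y j \<otimes>\<^bsub>A\<^esub> a \<otimes>\<^bsub>A\<^esub> x i)) \<otimes>\<^bsub>A\<^esub> y i))
        = \<phi> (x j) (y j \<otimes>\<^bsub>A\<^esub> a)"
      using j a by (simp add: dual_basis_left y_closed)
  qed (use a in \<open>auto intro!: \<phi>_closed S.m_closed x_closed y_closed\<close>)
  finally show ?thesis .
qed

end

text \<open>The name refers to depth two quasibases. The C-bilinear endomaps
  \<open>\<Gamma> j\<close>, with the tensors \<open>\<Sum> \<Delta> j (x i) \<otimes> y i\<close>
  that commute with \<open>C\<close>, form a right one; the endomaps \<open>\<Delta> j\<close>, with
  \<open>\<Sum> x i \<otimes> \<Gamma> j (y i)\<close>, form a left one.\<close>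

locale frobenius_quasibase = frobenius_system +
  fixes J :: "'j set" and \<Gamma> \<Delta> :: "'j \<Rightarrow> 'b \<Rightarrow> 'b"
  assumes finite_J: "finite J" and J_nonempty: "J \<noteq> {}"
    and \<Gamma>_hom: "j \<in> J \<Longrightarrow> \<Gamma> j \<in> bimodule_hom C C (ring_bimodule A k k) (ring_bimodule A k k)"
    and \<Delta>_hom: "j \<in> J \<Longrightarrow> \<Delta> j \<in> bimodule_hom C C (ring_bimodule A k k) (ring_bimodule A k k)"
    and E_mult: "\<lbrakk>a \<in> carrier A; b \<in> carrier A\<rbrakk>
      \<Longrightarrow> k (E (a \<otimes>\<^bsub>A\<^esub> b)) = (\<Oplus>\<^bsub>A\<^esub>j\<in>J. \<Gamma> j a \<otimes>\<^bsub>A\<^esub> \<Delta> j b)"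
begin

lemma bimodules:
  "bimodule A C (ring_bimodule A id k)" "bimodule C A (ring_bimodule A k id)"
  "bimodule C C (ring_bimodule A k k)"
  by (intro bimodule_ring_bimodule ring_hom_ring_id ring_hom_ring_axioms S.ring_axioms)+

lemma \<Gamma>_closed: "\<lbrakk>j \<in> J; a \<in> carrier A\<rbrakk> \<Longrightarrow> \<Gamma> j a \<in> carrier A"
  and \<Gamma>_add: "\<lbrakk>j \<in> J; a \<in> carrier A; b \<in> carrier A\<rbrakk> \<Longrightarrow> \<Gamma> j (a \<oplus>\<^bsub>A\<^esub> b) = \<Gamma> j a \<oplus>\<^bsub>A\<^esub> \<Gamma> j b"
  and \<Gamma>_left: "\<lbrakk>j \<in> J; c \<in> carrier C; a \<in> carrier A\<rbrakk> \<Longrightarrow> \<Gamma> j (k c \<otimes>\<^bsub>A\<^esub> a) = k c \<otimes>\<^bsub>A\<^esub> \<Gamma> j a"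
  and \<Gamma>_right: "\<lbrakk>j \<in> J; a \<in> carrier A; c \<in> carrier C\<rbrakk> \<Longrightarrow> \<Gamma> j (a \<otimes>\<^bsub>A\<^esub> k c) = \<Gamma> j a \<otimes>\<^bsub>A\<^esub> k c"
  using bimodule_homD[OF \<Gamma>_hom] by simp_all

lemma \<Delta>_closed: "\<lbrakk>j \<in> J; a \<in> carrier A\<rbrakk> \<Longrightarrow> \<Delta> j a \<in> carrier A"
  and \<Delta>_add: "\<lbrakk>j \<in> J; a \<in> carrier A; b \<in> carrier A\<rbrakk> \<Longrightarrow> \<Delta> j (a \<oplus>\<^bsub>A\<^esub> b) = \<Delta> j a \<oplus>\<^bsub>A\<^esub> \<Delta> j b"
  and \<Delta>_left: "\<lbrakk>j \<in> J; c \<in> carrier C; a \<in> carrier A\<rbrakk> \<Longrightarrow> \<Delta> j (k c \<otimes>\<^bsub>A\<^esub> a) = k c \<otimes>\<^bsub>A\<^esub> \<Delta> j a"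
  and \<Delta>_right: "\<lbrakk>j \<in> J; a \<in> carrier A; c \<in> carrier C\<rbrakk> \<Longrightarrow> \<Delta> j (a \<otimes>\<^bsub>A\<^esub> k c) = \<Delta> j a \<otimes>\<^bsub>A\<^esub> k c"
  using bimodule_homD[OF \<Delta>_hom] by simp_all

lemma right_depth_two: "right_depth_two A C k"
proof -
  let ?M = "ring_bimodule A id k"
  let ?N = "ring_bimodule A k k"
  interpret tensor_product A C C ?M ?N
    by (intro tensor_product.intro bimodules)
  note pD = balanced_mapD[OF balanced_pure, simplified]
  have T_ring: "abelian_group T" by (rule T.abelian_group_axioms)
  have pure_cl: "pure a b \<in> carrier T" if "a \<in> carrier A" "b \<in> carrier A" for a b
    using pD(1) that by blast
  have "\<exists>h. h \<in> bimodule_hom A C T ?M \<and>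
      (\<forall>a\<in>carrier A. \<forall>b\<in>carrier A. h (pure a b) = a \<otimes>\<^bsub>A\<^esub> \<Gamma> j b)" if j: "j \<in> J" for j
  proof -
    have "balanced_map C ?M ?N ?M (\<lambda>a b. a \<otimes>\<^bsub>A\<^esub> \<Gamma> j b)"
      by (rule balanced_mapI)
        (simp_all add: j \<Gamma>_closed \<Gamma>_add \<Gamma>_left S.l_distr S.r_distr S.m_assoc)
    then obtain h where "h \<in> bimodule_hom A C T ?M"
      "\<And>a b. \<lbrakk>a \<in> carrier ?M; b \<in> carrier ?N\<rbrakk> \<Longrightarrow> h (pure a b) = a \<otimes>\<^bsub>A\<^esub> \<Gamma> j b"
      by (rule tensor_lift_bimodule[OF bimodules(1)])
        (simp_all add: j \<Gamma>_closed \<Gamma>_right S.m_assoc)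
    then show ?thesis by auto
  qed
  then obtain h where h: "\<And>j. j \<in> J \<Longrightarrow> h j \<in> bimodule_hom A C T ?M"
    and h_pure: "\<And>j a b. \<lbrakk>j \<in> J; a \<in> carrier A; b \<in> carrier A\<rbrakk> \<Longrightarrow> h j (pure a b) = a \<otimes>\<^bsub>A\<^esub> \<Gamma> j b"
    by metis
  \<comment> \<open>The map \<open>g j\<close> sends 1 to the tensor
    \<open>\<Sum> \<Delta> j (x i) \<otimes> y i\<close> and is extended by left multiplication; the
    sum of all \<open>g j (h j t)\<close> will be the identity.\<close>
  define g where "g j a = (\<Oplus>\<^bsub>T\<^esub>i\<in>I. pure (a \<otimes>\<^bsub>A\<^esub> \<Delta> j (x i)) (y i))" for j a
  have g: "g j \<in> bimodule_hom A C ?M T" if j: "j \<in> J" for j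
  proof -
    have summand: "pure (a \<otimes>\<^bsub>A\<^esub> \<Delta> j b) b' \<in> carrier T"
      if "a \<in> carrier A" "b \<in> carrier A" "b' \<in> carrier A" for a b b'
      using that j by (intro pure_cl) (auto intro: \<Delta>_closed)
    have "g j \<in> hom (add_monoid ?M) (add_monoid T)"
      unfolding g_def
      by (intro T.finsum_add_homI add_homI) (auto simp: j \<Delta>_closed x_closed y_closed S.l_distr pD)
    moreover have "g j (r \<otimes>\<^bsub>A\<^esub> a) = r \<odot>\<^bsub>T\<^esub> g j a" if r: "r \<in> carrier A" "a \<in> carrier A" for r a
    proof -
      have "r \<odot>\<^bsub>T\<^esub> g j a = (\<Oplus>\<^bsub>T\<^esub>i\<in>I. r \<odot>\<^bsub>T\<^esub> pure (a \<otimes>\<^bsub>A\<^esub> \<Delta> j (x i)) (y i))"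
        unfolding g_def using r
        by (intro add_hom_finsum[OF T_ring T_ring T.smult_add_hom]) (auto intro: summand x_closed y_closed)
      also have "\<dots> = g j (r \<otimes>\<^bsub>A\<^esub> a)"
        unfolding g_def using r j
        by (intro T.finsum_cong')
          (auto simp: smult_pure \<Delta>_closed x_closed y_closed S.m_assoc intro!: pure_cl)
      finally show ?thesis ..
    qed
    moreover have "g j (a \<otimes>\<^bsub>A\<^esub> k c) = g j a \<odot>\<^sub>r\<^bsub>T\<^esub> c" if c: "a \<in> carrier A" "c \<in> carrier C" for a c
    proof -
      \<comment> \<open>Right C-linearity of \<open>g j\<close> says that its tensor commutes with
        \<open>C\<close>. The Casimir identity carries \<open>c\<close> from \<open>y i\<close> to
        \<open>x i\<close>, and left C-linearity of \<open>\<Delta> j\<close> lets it out; right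
        C-linearity of \<open>\<Delta> j\<close> makes the map balanced.\<close>
      have "balanced_map C ?M ?N T (\<lambda>b b'. pure (a \<otimes>\<^bsub>A\<^esub> \<Delta> j b) b')"
        by (rule balanced_mapI)
          (simp_all add: c j summand pD \<Delta>_closed \<Delta>_add \<Delta>_right S.r_distr S.m_assoc[symmetric])
      from casimir[OF T_ring this, of "k c"] c
      have "(\<Oplus>\<^bsub>T\<^esub>i\<in>I. pure (a \<otimes>\<^bsub>A\<^esub> \<Delta> j (k c \<otimes>\<^bsub>A\<^esub> x i)) (y i))
          = (\<Oplus>\<^bsub>T\<^esub>i\<in>I. pure (a \<otimes>\<^bsub>A\<^esub> \<Delta> j (x i)) (y i \<otimes>\<^bsub>A\<^esub> k c))" by simp
      moreover have "g j (a \<otimes>\<^bsub>A\<^esub> k c) = (\<Oplus>\<^bsub>T\<^esub>i\<in>I. pure (a \<otimes>\<^bsub>A\<^esub> \<Delta> j (k c \<otimes>\<^bsub>A\<^esub> x i)) (y i))"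
        unfolding g_def using c j
        by (intro T.finsum_cong')
          (auto simp: \<Delta>_left \<Delta>_closed x_closed y_closed S.m_assoc intro!: pure_cl)
      moreover have "(\<Oplus>\<^bsub>T\<^esub>i\<in>I. pure (a \<otimes>\<^bsub>A\<^esub> \<Delta> j (x i)) (y i \<otimes>\<^bsub>A\<^esub> k c))
          = (\<Oplus>\<^bsub>T\<^esub>i\<in>I. pure (a \<otimes>\<^bsub>A\<^esub> \<Delta> j (x i)) (y i) \<odot>\<^sub>r\<^bsub>T\<^esub> c)"
        using c j
        by (intro T.finsum_cong')
          (auto simp: rsmult_pure \<Delta>_closed x_closed y_closed intro!: pure_cl)
      moreover have "g j a \<odot>\<^sub>r\<^bsub>T\<^esub> c = (\<Oplus>\<^bsub>T\<^esub>i\<in>I. pure (a \<otimes>\<^bsub>A\<^esub> \<Delta> j (x i)) (y i) \<odot>\<^sub>r\<^bsub>T\<^esub> c)"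
        unfolding g_def using c
        by (intro add_hom_finsum[OF T_ring T_ring T.rsmult_add_hom]) (auto intro: summand x_closed y_closed)
      ultimately show ?thesis by simp
    qed
    ultimately show ?thesis
      by (auto simp: bimodule_hom_def hom_def)
  qed
  have "(\<Oplus>\<^bsub>T\<^esub>j\<in>J. g j (h j t)) = id t" if "t \<in> carrier T" for t
  proof (rule tensor_hom_eqI[OF T_ring _ _ _ that])
    show "(\<lambda>t. \<Oplus>\<^bsub>T\<^esub>j\<in>J. g j (h j t)) \<in> hom (add_monoid T) (add_monoid T)"
      using hom_compose[OF bimodule_hom_add_hom[OF h] bimodule_hom_add_hom[OF g]]
      by (intro T.finsum_add_homI) (simp add: o_def)
    fix a b assume "a \<in> carrier ?M" "b \<in> carrier ?N"
    then have ab: "a \<in> carrier A" "b \<in> carrier A" by simp_all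
    note cl = ab x_closed y_closed \<Gamma>_closed \<Delta>_closed E_closed
    have "(\<Oplus>\<^bsub>T\<^esub>j\<in>J. g j (h j (pure a b)))
        = (\<Oplus>\<^bsub>T\<^esub>j\<in>J. \<Oplus>\<^bsub>T\<^esub>i\<in>I. pure (a \<otimes>\<^bsub>A\<^esub> \<Gamma> j b \<otimes>\<^bsub>A\<^esub> \<Delta> j (x i)) (y i))"
      by (intro T.finsum_cong') (auto simp: g_def h_pure cl intro!: T.finsum_closed pure_cl)
    also have "\<dots> = (\<Oplus>\<^bsub>T\<^esub>i\<in>I. \<Oplus>\<^bsub>T\<^esub>j\<in>J. pure (a \<otimes>\<^bsub>A\<^esub> \<Gamma> j b \<otimes>\<^bsub>A\<^esub> \<Delta> j (x i)) (y i))"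
      by (intro T.finsum_swap finite_I finite_J pure_cl) (auto simp: cl)
    \<comment> \<open>For fixed \<open>i\<close>, \<open>E_mult\<close> collapses the sum over
      \<open>j\<close> to a value of \<open>E\<close>, which comes from \<open>C\<close> and crosses
      to the second leg, where \<open>dual_basis_left\<close> is waiting for it.\<close>
    also have "\<dots> = (\<Oplus>\<^bsub>T\<^esub>i\<in>I. pure a (k (E (b \<otimes>\<^bsub>A\<^esub> x i)) \<otimes>\<^bsub>A\<^esub> y i))"
    proof (rule T.finsum_cong')
      fix i assume i: "i \<in> I"
      have "(\<Oplus>\<^bsub>T\<^esub>j\<in>J. pure (a \<otimes>\<^bsub>A\<^esub> \<Gamma> j b \<otimes>\<^bsub>A\<^esub> \<Delta> j (x i)) (y i))
          = pure (\<Oplus>\<^bsub>A\<^esub>j\<in>J. a \<otimes>\<^bsub>A\<^esub> \<Gamma> j b \<otimes>\<^bsub>A\<^esub> \<Delta> j (x i)) (y i)"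
        using i by (intro balanced_map_finsum(1)[OF balanced_pure S.ring_axioms T_ring, symmetric]) (auto simp: cl)
      also have "(\<Oplus>\<^bsub>A\<^esub>j\<in>J. a \<otimes>\<^bsub>A\<^esub> \<Gamma> j b \<otimes>\<^bsub>A\<^esub> \<Delta> j (x i))
          = a \<otimes>\<^bsub>A\<^esub> (\<Oplus>\<^bsub>A\<^esub>j\<in>J. \<Gamma> j b \<otimes>\<^bsub>A\<^esub> \<Delta> j (x i))"
        using i by (subst S.finsum_rdistr) (auto simp: cl finite_J S.m_assoc intro!: S.finsum_cong')
      also have "\<dots> = a \<otimes>\<^bsub>A\<^esub> k (E (b \<otimes>\<^bsub>A\<^esub> x i))"
        using i by (simp add: E_mult cl)
      also have "pure \<dots> (y i) = pure a (k (E (b \<otimes>\<^bsub>A\<^esub> x i)) \<otimes>\<^bsub>A\<^esub> y i)"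
        using i by (simp add: pD(4) cl)
      finally show "(\<Oplus>\<^bsub>T\<^esub>j\<in>J. pure (a \<otimes>\<^bsub>A\<^esub> \<Gamma> j b \<otimes>\<^bsub>A\<^esub> \<Delta> j (x i)) (y i))
          = pure a (k (E (b \<otimes>\<^bsub>A\<^esub> x i)) \<otimes>\<^bsub>A\<^esub> y i)" .
    qed (auto simp: cl intro!: pure_cl)
    also have "\<dots> = pure a (\<Oplus>\<^bsub>A\<^esub>i\<in>I. k (E (b \<otimes>\<^bsub>A\<^esub> x i)) \<otimes>\<^bsub>A\<^esub> y i)"
      by (intro balanced_map_finsum(2)[OF balanced_pure S.ring_axioms T_ring, symmetric]) (auto simp: cl)
    also have "\<dots> = pure a b"
      by (simp add: dual_basis_left ab)
    finally show "(\<Oplus>\<^bsub>T\<^esub>j\<in>J. g j (h j (pure a b))) = id (pure a b)" by simp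
  qed (auto simp: hom_def)
  then have "\<exists>n>0. iso_direct_summand A C T (bimodule_power ?M n)"
    by (intro iso_direct_summand_powerI_finite[OF T.bimodule_axioms bimodules(1) finite_J J_nonempty h g]) auto
  then show ?thesis
    unfolding right_depth_two_def using ring_hom_ring_axioms by blast
qed

text \<open>Mirror image of the right-hand case with the same data: \<open>\<Delta> j\<close> now
  acts on the first leg of a tensor and \<open>\<Gamma> j\<close> on the \<open>y i\<close>. The
  products \<open>\<Gamma> j (y i) \<Delta> j a\<close> then meet in the order in which
  \<open>E_mult\<close> contracts them.\<close>

lemma left_depth_two: "left_depth_two A C k"
proof -
  let ?M = "ring_bimodule A k k"
  let ?N = "ring_bimodule A k id"
  interpret tensor_product C C A ?M ?N
    by (intro tensor_product.intro bimodules)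
  note pD = balanced_mapD[OF balanced_pure, simplified]
  have T_ring: "abelian_group T" by (rule T.abelian_group_axioms)
  have pure_cl: "pure a b \<in> carrier T" if "a \<in> carrier A" "b \<in> carrier A" for a b
    using pD(1) that by blast
  have "\<exists>h. h \<in> bimodule_hom C A T ?N \<and>
      (\<forall>a\<in>carrier A. \<forall>b\<in>carrier A. h (pure a b) = \<Delta> j a \<otimes>\<^bsub>A\<^esub> b)" if j: "j \<in> J" for j
  proof -
    have "balanced_map C ?M ?N ?N (\<lambda>a b. \<Delta> j a \<otimes>\<^bsub>A\<^esub> b)"
      by (rule balanced_mapI)
        (simp_all add: j \<Delta>_closed \<Delta>_add \<Delta>_right S.l_distr S.r_distr S.m_assoc)
    then obtain h where "h \<in> bimodule_hom C A T ?N"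
      "\<And>a b. \<lbrakk>a \<in> carrier ?M; b \<in> carrier ?N\<rbrakk> \<Longrightarrow> h (pure a b) = \<Delta> j a \<otimes>\<^bsub>A\<^esub> b"
      by (rule tensor_lift_bimodule[OF bimodules(2)])
        (simp_all add: j \<Delta>_closed \<Delta>_left S.m_assoc)
    then show ?thesis by auto
  qed
  then obtain h where h: "\<And>j. j \<in> J \<Longrightarrow> h j \<in> bimodule_hom C A T ?N"
    and h_pure: "\<And>j a b. \<lbrakk>j \<in> J; a \<in> carrier A; b \<in> carrier A\<rbrakk> \<Longrightarrow> h j (pure a b) = \<Delta> j a \<otimes>\<^bsub>A\<^esub> b"
    by metis
  define g where "g j a = (\<Oplus>\<^bsub>T\<^esub>i\<in>I. pure (x i) (\<Gamma> j (y i) \<otimes>\<^bsub>A\<^esub> a))" for j a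
  have g: "g j \<in> bimodule_hom C A ?N T" if j: "j \<in> J" for j
  proof -
    have summand: "pure b (\<Gamma> j b' \<otimes>\<^bsub>A\<^esub> a) \<in> carrier T"
      if "a \<in> carrier A" "b \<in> carrier A" "b' \<in> carrier A" for a b b'
      using that j by (intro pure_cl) (auto intro: \<Gamma>_closed)
    have "g j \<in> hom (add_monoid ?N) (add_monoid T)"
      unfolding g_def
      by (intro T.finsum_add_homI add_homI) (auto simp: j \<Gamma>_closed x_closed y_closed S.r_distr pD)
    moreover have "g j (a \<otimes>\<^bsub>A\<^esub> r) = g j a \<odot>\<^sub>r\<^bsub>T\<^esub> r" if r: "r \<in> carrier A" "a \<in> carrier A" for r a
    proof -
      have "g j a \<odot>\<^sub>r\<^bsub>T\<^esub> r = (\<Oplus>\<^bsub>T\<^esub>i\<in>I. pure (x i) (\<Gamma> j (y i) \<otimes>\<^bsub>A\<^esub> a) \<odot>\<^sub>r\<^bsub>T\<^esub> r)"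
        unfolding g_def using r
        by (intro add_hom_finsum[OF T_ring T_ring T.rsmult_add_hom]) (auto intro: summand x_closed y_closed)
      also have "\<dots> = g j (a \<otimes>\<^bsub>A\<^esub> r)"
        unfolding g_def using r j
        by (intro T.finsum_cong')
          (auto simp: rsmult_pure \<Gamma>_closed x_closed y_closed S.m_assoc intro!: pure_cl)
      finally show ?thesis ..
    qed
    moreover have "g j (k c \<otimes>\<^bsub>A\<^esub> a) = c \<odot>\<^bsub>T\<^esub> g j a" if c: "a \<in> carrier A" "c \<in> carrier C" for a c
    proof -
      \<comment> \<open>Here \<open>c\<close> leaves \<open>\<Gamma> j (y i)\<close> on the right,
        enters \<open>y i\<close> by right C-linearity, and is carried to the left of
        \<open>x i\<close> by the Casimir identity.\<close>
      have "balanced_map C ?M ?N T (\<lambda>b b'. pure b (\<Gamma> j b' \<otimes>\<^bsub>A\<^esub> a))"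
        by (rule balanced_mapI)
          (simp_all add: c j summand pD \<Gamma>_closed \<Gamma>_add \<Gamma>_left S.l_distr S.m_assoc)
      from casimir[OF T_ring this, of "k c"] c
      have "(\<Oplus>\<^bsub>T\<^esub>i\<in>I. pure (k c \<otimes>\<^bsub>A\<^esub> x i) (\<Gamma> j (y i) \<otimes>\<^bsub>A\<^esub> a))
          = (\<Oplus>\<^bsub>T\<^esub>i\<in>I. pure (x i) (\<Gamma> j (y i \<otimes>\<^bsub>A\<^esub> k c) \<otimes>\<^bsub>A\<^esub> a))" by simp
      moreover have "g j (k c \<otimes>\<^bsub>A\<^esub> a) = (\<Oplus>\<^bsub>T\<^esub>i\<in>I. pure (x i) (\<Gamma> j (y i \<otimes>\<^bsub>A\<^esub> k c) \<otimes>\<^bsub>A\<^esub> a))"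
        unfolding g_def using c j
        by (intro T.finsum_cong')
          (auto simp: \<Gamma>_right \<Gamma>_closed x_closed y_closed S.m_assoc intro!: pure_cl)
      moreover have "(\<Oplus>\<^bsub>T\<^esub>i\<in>I. pure (k c \<otimes>\<^bsub>A\<^esub> x i) (\<Gamma> j (y i) \<otimes>\<^bsub>A\<^esub> a))
          = (\<Oplus>\<^bsub>T\<^esub>i\<in>I. c \<odot>\<^bsub>T\<^esub> pure (x i) (\<Gamma> j (y i) \<otimes>\<^bsub>A\<^esub> a))"
        using c j
        by (intro T.finsum_cong')
          (auto simp: smult_pure \<Gamma>_closed x_closed y_closed intro!: pure_cl)
      moreover have "c \<odot>\<^bsub>T\<^esub> g j a = (\<Oplus>\<^bsub>T\<^esub>i\<in>I. c \<odot>\<^bsub>T\<^esub> pure (x i) (\<Gamma> j (y i) \<otimes>\<^bsub>A\<^esub> a))"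
        unfolding g_def using c
        by (intro add_hom_finsum[OF T_ring T_ring T.smult_add_hom]) (auto intro: summand x_closed y_closed)
      ultimately show ?thesis by simp
    qed
    ultimately show ?thesis
      by (auto simp: bimodule_hom_def hom_def)
  qed
  have "(\<Oplus>\<^bsub>T\<^esub>j\<in>J. g j (h j t)) = id t" if "t \<in> carrier T" for t
  proof (rule tensor_hom_eqI[OF T_ring _ _ _ that])
    show "(\<lambda>t. \<Oplus>\<^bsub>T\<^esub>j\<in>J. g j (h j t)) \<in> hom (add_monoid T) (add_monoid T)"
      using hom_compose[OF bimodule_hom_add_hom[OF h] bimodule_hom_add_hom[OF g]]
      by (intro T.finsum_add_homI) (simp add: o_def)
    fix a b assume "a \<in> carrier ?M" "b \<in> carrier ?N"
    then have ab: "a \<in> carrier A" "b \<in> carrier A" by simp_all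
    note cl = ab x_closed y_closed \<Gamma>_closed \<Delta>_closed E_closed
    have "(\<Oplus>\<^bsub>T\<^esub>j\<in>J. g j (h j (pure a b)))
        = (\<Oplus>\<^bsub>T\<^esub>j\<in>J. \<Oplus>\<^bsub>T\<^esub>i\<in>I. pure (x i) (\<Gamma> j (y i) \<otimes>\<^bsub>A\<^esub> (\<Delta> j a \<otimes>\<^bsub>A\<^esub> b)))"
      by (intro T.finsum_cong') (auto simp: g_def h_pure cl intro!: T.finsum_closed pure_cl)
    also have "\<dots> = (\<Oplus>\<^bsub>T\<^esub>i\<in>I. \<Oplus>\<^bsub>T\<^esub>j\<in>J. pure (x i) (\<Gamma> j (y i) \<otimes>\<^bsub>A\<^esub> (\<Delta> j a \<otimes>\<^bsub>A\<^esub> b)))"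
      by (intro T.finsum_swap finite_I finite_J pure_cl) (auto simp: cl)
    also have "\<dots> = (\<Oplus>\<^bsub>T\<^esub>i\<in>I. pure (x i \<otimes>\<^bsub>A\<^esub> k (E (y i \<otimes>\<^bsub>A\<^esub> a))) b)"
    proof (rule T.finsum_cong')
      fix i assume i: "i \<in> I"
      have "(\<Oplus>\<^bsub>T\<^esub>j\<in>J. pure (x i) (\<Gamma> j (y i) \<otimes>\<^bsub>A\<^esub> (\<Delta> j a \<otimes>\<^bsub>A\<^esub> b)))
          = pure (x i) (\<Oplus>\<^bsub>A\<^esub>j\<in>J. \<Gamma> j (y i) \<otimes>\<^bsub>A\<^esub> (\<Delta> j a \<otimes>\<^bsub>A\<^esub> b))"
        using i by (intro balanced_map_finsum(2)[OF balanced_pure S.ring_axioms T_ring, symmetric]) (auto simp: cl)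
      also have "(\<Oplus>\<^bsub>A\<^esub>j\<in>J. \<Gamma> j (y i) \<otimes>\<^bsub>A\<^esub> (\<Delta> j a \<otimes>\<^bsub>A\<^esub> b))
          = (\<Oplus>\<^bsub>A\<^esub>j\<in>J. \<Gamma> j (y i) \<otimes>\<^bsub>A\<^esub> \<Delta> j a) \<otimes>\<^bsub>A\<^esub> b"
        using i by (subst S.finsum_ldistr) (auto simp: cl finite_J S.m_assoc intro!: S.finsum_cong')
      also have "\<dots> = k (E (y i \<otimes>\<^bsub>A\<^esub> a)) \<otimes>\<^bsub>A\<^esub> b"
        using i by (simp add: E_mult cl)
      also have "pure (x i) \<dots> = pure (x i \<otimes>\<^bsub>A\<^esub> k (E (y i \<otimes>\<^bsub>A\<^esub> a))) b"
        using i by (simp add: pD(4) cl)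
      finally show "(\<Oplus>\<^bsub>T\<^esub>j\<in>J. pure (x i) (\<Gamma> j (y i) \<otimes>\<^bsub>A\<^esub> (\<Delta> j a \<otimes>\<^bsub>A\<^esub> b)))
          = pure (x i \<otimes>\<^bsub>A\<^esub> k (E (y i \<otimes>\<^bsub>A\<^esub> a))) b" .
    qed (auto simp: cl intro!: pure_cl)
    also have "\<dots> = pure (\<Oplus>\<^bsub>A\<^esub>i\<in>I. x i \<otimes>\<^bsub>A\<^esub> k (E (y i \<otimes>\<^bsub>A\<^esub> a))) b"
      by (intro balanced_map_finsum(1)[OF balanced_pure S.ring_axioms T_ring, symmetric]) (auto simp: cl)
    also have "\<dots> = pure a b"
      by (simp add: dual_basis_right ab)
    finally show "(\<Oplus>\<^bsub>T\<^esub>j\<in>J. g j (h j (pure a b))) = id (pure a b)" by simp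
  qed (auto simp: hom_def)
  then have "\<exists>n>0. iso_direct_summand C A T (bimodule_power ?N n)"
    by (intro iso_direct_summand_powerI_finite[OF T.bimodule_axioms bimodules(2) finite_J J_nonempty h g]) auto
  then show ?thesis
    unfolding left_depth_two_def using ring_hom_ring_axioms by blast
qed

lemma depth_two: "depth_two A C k"
  unfolding depth_two_def by (intro conjI right_depth_two left_depth_two)

end

section \<open>The endomorphism ring of a Frobenius extension\<close>

lemma frobenius_extensionE:
  assumes "frobenius_extension B C f"
  obtains E n x y where "frobenius_system C B f E {..<n::nat} x y"
proof -
  have f: "ring_hom_ring C B f" using assms by (simp add: frobenius_extension_def)
  obtain E n x y where "E \<in> bimodule_hom C C (ring_bimodule B f f) (ring_bimodule C id id)"
    "x \<in> {..<n::nat} \<rightarrow> carrier B" "y \<in> {..<n} \<rightarrow> carrier B"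
    "\<forall>b\<in>carrier B. (\<Oplus>\<^bsub>B\<^esub>i\<in>{..<n}. f (E (b \<otimes>\<^bsub>B\<^esub> x i)) \<otimes>\<^bsub>B\<^esub> y i) = b \<and>
      (\<Oplus>\<^bsub>B\<^esub>i\<in>{..<n}. x i \<otimes>\<^bsub>B\<^esub> f (E (y i \<otimes>\<^bsub>B\<^esub> b))) = b"
    using assms unfolding frobenius_extension_def by blast
  then have "frobenius_system C B f E {..<n} x y"
    using f by (intro frobenius_system.intro frobenius_system_axioms.intro) auto
  then show thesis by (rule that)
qed

text \<open>A copy of \<open>frobenius_system\<close> in which the extension is called
  \<open>B | C\<close>, so that \<open>A\<close> and \<open>k\<close> are free for the endomorphism
  ring and the composite map into it.\<close>

locale frobenius_endomorphisms = frobenius_system C B f E I x y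
  for C :: "('c, 'n) ring_scheme" and B :: "('b, 'm) ring_scheme" and f and E and I :: "'i set" and x y
begin

abbreviation A where "A \<equiv> extension_End B C f"
abbreviation lam where "lam \<equiv> left_regular B"
abbreviation k where "k \<equiv> lam \<circ> f"

sublocale A: ring A
  by (rule ring_extension_End[OF ring_hom_ring_axioms])

sublocale lam: ring_hom_ring B A lam
  by (rule ring_hom_left_regular[OF ring_hom_ring_axioms])

lemma k_hom: "ring_hom_ring C A k"
  by (rule ring_hom_ringI2[OF R.ring_axioms A.ring_axioms])
    (rule ring_hom_trans[OF homh lam.homh])

lemma carrier_A: "a \<in> carrier A \<longleftrightarrow> a \<in> carrier B \<rightarrow>\<^sub>E carrier B \<and>
    (\<forall>u\<in>carrier B. \<forall>v\<in>carrier B. a (u \<oplus>\<^bsub>B\<^esub> v) = a u \<oplus>\<^bsub>B\<^esub> a v) \<and>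
    (\<forall>u\<in>carrier B. \<forall>c\<in>carrier C. a (u \<otimes>\<^bsub>B\<^esub> f c) = a u \<otimes>\<^bsub>B\<^esub> f c)"
  by (simp add: extension_End_def right_End_def ring_bimodule_def)

lemma app_closed [simp]: "\<lbrakk>a \<in> carrier A; u \<in> carrier B\<rbrakk> \<Longrightarrow> a u \<in> carrier B"
  and app_add: "\<lbrakk>a \<in> carrier A; u \<in> carrier B; v \<in> carrier B\<rbrakk> \<Longrightarrow> a (u \<oplus>\<^bsub>B\<^esub> v) = a u \<oplus>\<^bsub>B\<^esub> a v"
  and app_right: "\<lbrakk>a \<in> carrier A; u \<in> carrier B; c \<in> carrier C\<rbrakk> \<Longrightarrow> a (u \<otimes>\<^bsub>B\<^esub> f c) = a u \<otimes>\<^bsub>B\<^esub> f c"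
  by (auto simp: carrier_A)

lemma app_hom: "a \<in> carrier A \<Longrightarrow> a \<in> hom (add_monoid B) (add_monoid B)"
  by (intro add_homI) (auto simp: app_add)

text \<open>Endomorphisms are undefined outside the carrier of \<open>B\<close>, so their values on
  the carrier determine them.\<close>

lemma A_eqI:
  assumes "a \<in> carrier A" "b \<in> carrier A" "\<And>u. u \<in> carrier B \<Longrightarrow> a u = b u"
  shows "a = b"
  using assms by (auto simp: carrier_A PiE_iff intro: extensionalityI)

lemma app_simps [simp]:
  assumes "u \<in> carrier B"
  shows "(a \<oplus>\<^bsub>A\<^esub> b) u = a u \<oplus>\<^bsub>B\<^esub> b u" and "(a \<otimes>\<^bsub>A\<^esub> b) u = a (b u)"
    and "\<zero>\<^bsub>A\<^esub> u = \<zero>\<^bsub>B\<^esub>" and "\<one>\<^bsub>A\<^esub> u = u" and "lam v u = v \<otimes>\<^bsub>B\<^esub> u"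
  using assms
  by (simp_all add: extension_End_def right_End_def ring_bimodule_def compose_def left_regular_def)

lemma app_finsum:
  assumes "g \<in> J \<rightarrow> carrier A" "u \<in> carrier B"
  shows "(\<Oplus>\<^bsub>A\<^esub>j\<in>J. g j) u = (\<Oplus>\<^bsub>B\<^esub>j\<in>J. g j u)"
  using assms by (intro add_hom_finsum[of A B "\<lambda>a. a u"] add_homI A.is_abelian_group S.is_abelian_group) auto

section \<open>Rank-one endomorphisms and the Frobenius system of \<open>A | C\<close>\<close>

definition rank_one :: "'b \<Rightarrow> 'b \<Rightarrow> 'b \<Rightarrow> 'b"
  where "rank_one b b' = (\<lambda>u\<in>carrier B. b \<otimes>\<^bsub>B\<^esub> f (E (b' \<otimes>\<^bsub>B\<^esub> u)))"

lemma fE_closed [simp]: "u \<in> carrier B \<Longrightarrow> f (E u) \<in> carrier B"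
  by (simp add: E_closed)

lemma fE_add: "\<lbrakk>u \<in> carrier B; v \<in> carrier B\<rbrakk> \<Longrightarrow> f (E (u \<oplus>\<^bsub>B\<^esub> v)) = f (E u) \<oplus>\<^bsub>B\<^esub> f (E v)"
  by (simp add: E_add E_closed)

lemma fE_left: "\<lbrakk>c \<in> carrier C; u \<in> carrier B\<rbrakk> \<Longrightarrow> f (E (f c \<otimes>\<^bsub>B\<^esub> u)) = f c \<otimes>\<^bsub>B\<^esub> f (E u)"
  by (simp add: E_left E_closed)

lemma fE_right: "\<lbrakk>c \<in> carrier C; u \<in> carrier B\<rbrakk> \<Longrightarrow> f (E (u \<otimes>\<^bsub>B\<^esub> f c)) = f (E u) \<otimes>\<^bsub>B\<^esub> f c"
  by (simp add: E_right E_closed)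

lemma rank_one_app [simp]: "u \<in> carrier B \<Longrightarrow> rank_one b b' u = b \<otimes>\<^bsub>B\<^esub> f (E (b' \<otimes>\<^bsub>B\<^esub> u))"
  by (simp add: rank_one_def)

lemma rank_one_closed [simp]: "\<lbrakk>b \<in> carrier B; b' \<in> carrier B\<rbrakk> \<Longrightarrow> rank_one b b' \<in> carrier A"
  unfolding carrier_A
  by (auto simp: rank_one_def S.r_distr fE_add fE_right S.m_assoc[symmetric])

text \<open>Expand \<open>u\<close> in the dual basis and pull the coefficients out of
  \<open>a\<close> by right C-linearity. In other words, \<open>a\<close> is the sum of the maps
  \<open>rank_one (a (x i)) (y i)\<close>; this is the form in which the spanning of
  \<open>A\<close> by rank-one maps is used.\<close>

lemma app_dual_basis:
  assumes "a \<in> carrier A" "u \<in> carrier B"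
  shows "(\<Oplus>\<^bsub>B\<^esub>i\<in>I. a (x i) \<otimes>\<^bsub>B\<^esub> f (E (y i \<otimes>\<^bsub>B\<^esub> u))) = a u"
proof -
  have "(\<Oplus>\<^bsub>B\<^esub>i\<in>I. a (x i) \<otimes>\<^bsub>B\<^esub> f (E (y i \<otimes>\<^bsub>B\<^esub> u))) = (\<Oplus>\<^bsub>B\<^esub>i\<in>I. a (x i \<otimes>\<^bsub>B\<^esub> f (E (y i \<otimes>\<^bsub>B\<^esub> u))))"
    using assms by (intro S.finsum_cong') (auto simp: app_right E_closed x_closed y_closed)
  also have "\<dots> = a (\<Oplus>\<^bsub>B\<^esub>i\<in>I. x i \<otimes>\<^bsub>B\<^esub> f (E (y i \<otimes>\<^bsub>B\<^esub> u)))"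
    using assms
    by (intro add_hom_finsum[OF S.is_abelian_group S.is_abelian_group app_hom, symmetric])
      (auto simp: x_closed y_closed)
  finally show ?thesis using assms by (simp add: dual_basis_right)
qed

text \<open>Composition of \<open>E\<close> with the Frobenius homomorphism of \<open>A | B\<close> that sends \<open>rank_one b b'\<close> to \<open>b b'\<close>.\<close>

definition eps :: "('b \<Rightarrow> 'b) \<Rightarrow> 'c"
  where "eps a = E (\<Oplus>\<^bsub>B\<^esub>i\<in>I. a (x i) \<otimes>\<^bsub>B\<^esub> y i)"

lemma trace_closed: "a \<in> carrier A \<Longrightarrow> (\<Oplus>\<^bsub>B\<^esub>i\<in>I. a (x i) \<otimes>\<^bsub>B\<^esub> y i) \<in> carrier B"
  by (intro S.finsum_closed) (auto simp: x_closed y_closed)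

lemma eps_closed: "a \<in> carrier A \<Longrightarrow> eps a \<in> carrier C"
  by (simp add: eps_def E_closed trace_closed)

lemma eps_hom: "eps \<in> bimodule_hom C C (ring_bimodule A k k) (ring_bimodule C id id)"
proof (rule bimodule_homI; simp)
  fix a assume a: "a \<in> carrier A"
  then show "eps a \<in> carrier C" by (rule eps_closed)
  show "eps (a \<oplus>\<^bsub>A\<^esub> b) = eps a \<oplus>\<^bsub>C\<^esub> eps b" if b: "b \<in> carrier A" for b
  proof -
    have "(\<Oplus>\<^bsub>B\<^esub>i\<in>I. (a \<oplus>\<^bsub>A\<^esub> b) (x i) \<otimes>\<^bsub>B\<^esub> y i) = (\<Oplus>\<^bsub>B\<^esub>i\<in>I. a (x i) \<otimes>\<^bsub>B\<^esub> y i \<oplus>\<^bsub>B\<^esub> b (x i) \<otimes>\<^bsub>B\<^esub> y i)"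
      using a b by (intro S.finsum_cong') (auto simp: x_closed y_closed S.l_distr)
    also have "\<dots> = (\<Oplus>\<^bsub>B\<^esub>i\<in>I. a (x i) \<otimes>\<^bsub>B\<^esub> y i) \<oplus>\<^bsub>B\<^esub> (\<Oplus>\<^bsub>B\<^esub>i\<in>I. b (x i) \<otimes>\<^bsub>B\<^esub> y i)"
      using a b by (intro S.finsum_addf) (auto simp: x_closed y_closed)
    finally show ?thesis using a b by (simp add: eps_def E_add trace_closed)
  qed
  show "eps (lam (f c) \<otimes>\<^bsub>A\<^esub> a) = c \<otimes>\<^bsub>C\<^esub> eps a" if c: "c \<in> carrier C" for c
  proof -
    have "(\<Oplus>\<^bsub>B\<^esub>i\<in>I. (lam (f c) \<otimes>\<^bsub>A\<^esub> a) (x i) \<otimes>\<^bsub>B\<^esub> y i) = (\<Oplus>\<^bsub>B\<^esub>i\<in>I. f c \<otimes>\<^bsub>B\<^esub> (a (x i) \<otimes>\<^bsub>B\<^esub> y i))"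
      using a c by (intro S.finsum_cong') (auto simp: x_closed y_closed S.m_assoc)
    also have "\<dots> = f c \<otimes>\<^bsub>B\<^esub> (\<Oplus>\<^bsub>B\<^esub>i\<in>I. a (x i) \<otimes>\<^bsub>B\<^esub> y i)"
      using a c by (intro S.finsum_rdistr[symmetric] finite_I) (auto simp: x_closed y_closed)
    finally show ?thesis using a c by (simp add: eps_def E_left trace_closed)
  qed
  show "eps (a \<otimes>\<^bsub>A\<^esub> lam (f c)) = eps a \<otimes>\<^bsub>C\<^esub> c" if c: "c \<in> carrier C" for c
  proof -
    \<comment> \<open>The scalar \<open>c\<close> acts inside \<open>a\<close>, on
      \<open>x i\<close>. The Casimir identity moves it to \<open>y i\<close>, outside
      \<open>a\<close>.\<close>
    have "balanced_map C (ring_bimodule B f f) (ring_bimodule B f f) B (\<lambda>u v. a u \<otimes>\<^bsub>B\<^esub> v)"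
      using a by (intro balanced_mapI) (auto simp: app_add app_right S.l_distr S.r_distr S.m_assoc)
    from casimir[OF S.is_abelian_group this, of "f c"] c
    have "(\<Oplus>\<^bsub>B\<^esub>i\<in>I. a (f c \<otimes>\<^bsub>B\<^esub> x i) \<otimes>\<^bsub>B\<^esub> y i) = (\<Oplus>\<^bsub>B\<^esub>i\<in>I. a (x i) \<otimes>\<^bsub>B\<^esub> (y i \<otimes>\<^bsub>B\<^esub> f c))"
      by simp
    moreover have "(\<Oplus>\<^bsub>B\<^esub>i\<in>I. (a \<otimes>\<^bsub>A\<^esub> lam (f c)) (x i) \<otimes>\<^bsub>B\<^esub> y i) = (\<Oplus>\<^bsub>B\<^esub>i\<in>I. a (f c \<otimes>\<^bsub>B\<^esub> x i) \<otimes>\<^bsub>B\<^esub> y i)"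
      using a c by (intro S.finsum_cong') (auto simp: x_closed y_closed)
    moreover have "(\<Oplus>\<^bsub>B\<^esub>i\<in>I. a (x i) \<otimes>\<^bsub>B\<^esub> (y i \<otimes>\<^bsub>B\<^esub> f c)) = (\<Oplus>\<^bsub>B\<^esub>i\<in>I. a (x i) \<otimes>\<^bsub>B\<^esub> y i) \<otimes>\<^bsub>B\<^esub> f c"
      using a c by (subst S.finsum_ldistr) (auto simp: finite_I x_closed y_closed S.m_assoc intro!: S.finsum_cong')
    ultimately show ?thesis using a c by (simp add: eps_def E_right trace_closed)
  qed
qed

text \<open>The inner sum is the element \<open>s\<close> of \<open>B\<close> with
  \<open>E (s u) = E (b' (a u))\<close>, so that \<open>rank_one b b'\<close> composed with
  \<open>a\<close> is \<open>rank_one b s\<close>.\<close>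

lemma eps_rank_one:
  assumes "b \<in> carrier B" "b' \<in> carrier B" "a \<in> carrier A"
  shows "eps (rank_one b b' \<otimes>\<^bsub>A\<^esub> a) = E (b \<otimes>\<^bsub>B\<^esub> (\<Oplus>\<^bsub>B\<^esub>i\<in>I. f (E (b' \<otimes>\<^bsub>B\<^esub> a (x i))) \<otimes>\<^bsub>B\<^esub> y i))"
  unfolding eps_def using assms
  by (subst S.finsum_rdistr)
    (auto simp: finite_I x_closed y_closed S.m_assoc intro!: S.finsum_cong' arg_cong[where f = E])

lemma comp_rank_one:
  "\<lbrakk>b \<in> carrier B; b' \<in> carrier B; a \<in> carrier A\<rbrakk> \<Longrightarrow> a \<otimes>\<^bsub>A\<^esub> rank_one b b' = rank_one (a b) b'"
  by (rule A_eqI) (auto simp: app_right E_closed)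

text \<open>On this side \<open>a\<close> is absorbed into the first argument of
  \<open>rank_one\<close>. What remains is \<open>eps_rank_one\<close> for the identity, where the
  inner sum is \<open>b'\<close> itself.\<close>

lemma eps_comp_rank_one:
  assumes "b \<in> carrier B" "b' \<in> carrier B" "a \<in> carrier A"
  shows "eps (a \<otimes>\<^bsub>A\<^esub> rank_one b b') = E (a b \<otimes>\<^bsub>B\<^esub> b')"
proof -
  have "rank_one (a b) b' \<otimes>\<^bsub>A\<^esub> \<one>\<^bsub>A\<^esub> = rank_one (a b) b'"
    using assms by simp
  moreover have "(\<Oplus>\<^bsub>B\<^esub>i\<in>I. f (E (b' \<otimes>\<^bsub>B\<^esub> \<one>\<^bsub>A\<^esub> (x i))) \<otimes>\<^bsub>B\<^esub> y i)
      = (\<Oplus>\<^bsub>B\<^esub>i\<in>I. f (E (b' \<otimes>\<^bsub>B\<^esub> x i)) \<otimes>\<^bsub>B\<^esub> y i)"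
    using assms by (intro S.finsum_cong') (auto simp: x_closed y_closed)
  ultimately show ?thesis
    using assms eps_rank_one[of "a b" b' "\<one>\<^bsub>A\<^esub>"] by (simp add: comp_rank_one dual_basis_left)
qed

text \<open>The arguments of the second family are in reversed order so that sums contract from the
  inside: in the first identity the sum over \<open>l\<close> turns
  \<open>E (a (x m) x l) y l\<close> into \<open>a (x m)\<close>, and the sum over \<open>m\<close>
  then rebuilds \<open>a\<close>.\<close>

lemma frobenius_system_A:
  "frobenius_system C A k eps (I \<times> I)
    (\<lambda>p. rank_one (x (fst p)) (x (snd p))) (\<lambda>p. rank_one (y (snd p)) (y (fst p)))"
proof (intro frobenius_system.intro frobenius_system_axioms.intro k_hom eps_hom)
  note cl = x_closed y_closed eps_closed
  have k_eps: "k (eps b) \<in> carrier A" if "b \<in> carrier A" for b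
    using that by (simp add: eps_closed)
  fix a assume a: "a \<in> carrier A"
  show "(\<Oplus>\<^bsub>A\<^esub>p\<in>I \<times> I. k (eps (a \<otimes>\<^bsub>A\<^esub> rank_one (x (fst p)) (x (snd p))))
      \<otimes>\<^bsub>A\<^esub> rank_one (y (snd p)) (y (fst p))) = a" (is "finsum A ?g _ = a")
  proof (rule A_eqI)
    have g: "?g \<in> I \<times> I \<rightarrow> carrier A" using a by (auto simp: cl)
    then show "finsum A ?g (I \<times> I) \<in> carrier A" by (rule A.finsum_closed)
    fix u assume u: "u \<in> carrier B"
    let ?h = "\<lambda>m l. f (E (a (x m) \<otimes>\<^bsub>B\<^esub> x l)) \<otimes>\<^bsub>B\<^esub> (y l \<otimes>\<^bsub>B\<^esub> f (E (y m \<otimes>\<^bsub>B\<^esub> u)))"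
    have "finsum A ?g (I \<times> I) u = (\<Oplus>\<^bsub>B\<^esub>p\<in>I \<times> I. ?h (fst p) (snd p))"
      unfolding app_finsum[OF g u] using a u
      by (intro S.finsum_cong') (auto simp: cl eps_comp_rank_one)
    also have "\<dots> = (\<Oplus>\<^bsub>B\<^esub>m\<in>I. \<Oplus>\<^bsub>B\<^esub>l\<in>I. ?h m l)"
      using a u by (intro S.finsum_Times finite_I) (auto simp: cl)
    also have "\<dots> = (\<Oplus>\<^bsub>B\<^esub>m\<in>I. a (x m) \<otimes>\<^bsub>B\<^esub> f (E (y m \<otimes>\<^bsub>B\<^esub> u)))"
    proof (rule S.finsum_cong')
      fix m assume m: "m \<in> I"
      have "(\<Oplus>\<^bsub>B\<^esub>l\<in>I. ?h m l) = (\<Oplus>\<^bsub>B\<^esub>l\<in>I. f (E (a (x m) \<otimes>\<^bsub>B\<^esub> x l)) \<otimes>\<^bsub>B\<^esub> y l) \<otimes>\<^bsub>B\<^esub> f (E (y m \<otimes>\<^bsub>B\<^esub> u))"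
        using a u m
        by (subst S.finsum_ldistr) (auto simp: finite_I cl S.m_assoc intro!: S.finsum_cong')
      then show "(\<Oplus>\<^bsub>B\<^esub>l\<in>I. ?h m l) = a (x m) \<otimes>\<^bsub>B\<^esub> f (E (y m \<otimes>\<^bsub>B\<^esub> u))"
        using a m by (simp add: dual_basis_left cl)
    qed (use a u in \<open>auto simp: cl\<close>)
    also have "\<dots> = a u" by (rule app_dual_basis[OF a u])
    finally show "finsum A ?g (I \<times> I) u = a u" .
  qed (rule a)
  show "(\<Oplus>\<^bsub>A\<^esub>p\<in>I \<times> I. rank_one (x (fst p)) (x (snd p))
      \<otimes>\<^bsub>A\<^esub> k (eps (rank_one (y (snd p)) (y (fst p)) \<otimes>\<^bsub>A\<^esub> a))) = a" (is "finsum A ?g _ = a")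
  proof (rule A_eqI)
    have g: "?g \<in> I \<times> I \<rightarrow> carrier A" using a by (auto simp: cl)
    then show "finsum A ?g (I \<times> I) \<in> carrier A" by (rule A.finsum_closed)
    fix u assume u: "u \<in> carrier B"
    \<comment> \<open>The element representing \<open>y m\<close> after \<open>a\<close>: composing
      \<open>rank_one (y l) (y m)\<close> with \<open>a\<close> gives
      \<open>rank_one (y l) (s m)\<close>.\<close>
    define s where "s m = (\<Oplus>\<^bsub>B\<^esub>p\<in>I. f (E (y m \<otimes>\<^bsub>B\<^esub> a (x p))) \<otimes>\<^bsub>B\<^esub> y p)" for m
    have s: "s m \<in> carrier B" if "m \<in> I" for m
      unfolding s_def using a that by (intro S.finsum_closed) (auto simp: cl)
    \<comment> \<open>The value of \<open>rank_one (x m) v\<close> at \<open>u\<close>, seen as an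
      additive map of \<open>v\<close>, so that sums can be moved into and out of its argument: the
      sum over \<open>l\<close> contracts to \<open>s m\<close>, which is then expanded.\<close>
    define h where "h m v = x m \<otimes>\<^bsub>B\<^esub> f (E (v \<otimes>\<^bsub>B\<^esub> u))" for m v
    have h_closed: "h m v \<in> carrier B" if "m \<in> I" "v \<in> carrier B" for m v
      using that u by (simp add: h_def cl)
    have h: "h m \<in> hom (add_monoid B) (add_monoid B)" if "m \<in> I" for m
      using that u by (intro add_homI) (auto simp: h_def cl S.l_distr S.r_distr fE_add)
    have h_sum: "h m (finsum B w I) = (\<Oplus>\<^bsub>B\<^esub>i\<in>I. h m (w i))" if "m \<in> I" "w \<in> I \<rightarrow> carrier B" for m w
      by (rule add_hom_finsum[OF S.is_abelian_group S.is_abelian_group h[OF that(1)] that(2)])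
    have "finsum A ?g (I \<times> I) u
        = (\<Oplus>\<^bsub>B\<^esub>p\<in>I \<times> I. h (fst p) (x (snd p) \<otimes>\<^bsub>B\<^esub> f (E (y (snd p) \<otimes>\<^bsub>B\<^esub> s (fst p)))))"
      unfolding app_finsum[OF g u] using a u s h_closed
      by (intro S.finsum_cong')
        (auto simp: cl eps_rank_one E_closed S.m_assoc h_def simp flip: s_def)
    also have "\<dots> = (\<Oplus>\<^bsub>B\<^esub>m\<in>I. \<Oplus>\<^bsub>B\<^esub>l\<in>I. h m (x l \<otimes>\<^bsub>B\<^esub> f (E (y l \<otimes>\<^bsub>B\<^esub> s m))))"
      using s by (intro S.finsum_Times finite_I h_closed) (auto simp: cl)
    also have "\<dots> = (\<Oplus>\<^bsub>B\<^esub>m\<in>I. \<Oplus>\<^bsub>B\<^esub>p\<in>I. h m (f (E (y m \<otimes>\<^bsub>B\<^esub> a (x p))) \<otimes>\<^bsub>B\<^esub> y p))"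
    proof (rule S.finsum_cong')
      fix m assume m: "m \<in> I"
      have "(\<Oplus>\<^bsub>B\<^esub>l\<in>I. h m (x l \<otimes>\<^bsub>B\<^esub> f (E (y l \<otimes>\<^bsub>B\<^esub> s m))))
          = h m (\<Oplus>\<^bsub>B\<^esub>l\<in>I. x l \<otimes>\<^bsub>B\<^esub> f (E (y l \<otimes>\<^bsub>B\<^esub> s m)))"
        using m s by (intro h_sum[symmetric]) (auto simp: cl)
      also have "\<dots> = h m (s m)" using m s by (simp add: dual_basis_right)
      also have "\<dots> = (\<Oplus>\<^bsub>B\<^esub>p\<in>I. h m (f (E (y m \<otimes>\<^bsub>B\<^esub> a (x p))) \<otimes>\<^bsub>B\<^esub> y p))"
        unfolding s_def using m a by (intro h_sum) (auto simp: cl)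
      finally show "(\<Oplus>\<^bsub>B\<^esub>l\<in>I. h m (x l \<otimes>\<^bsub>B\<^esub> f (E (y l \<otimes>\<^bsub>B\<^esub> s m))))
          = (\<Oplus>\<^bsub>B\<^esub>p\<in>I. h m (f (E (y m \<otimes>\<^bsub>B\<^esub> a (x p))) \<otimes>\<^bsub>B\<^esub> y p))" .
    qed (use a in \<open>auto simp: cl intro!: S.finsum_closed h_closed\<close>)
    \<comment> \<open>With \<open>p\<close> outermost, the sum over \<open>m\<close> rebuilds
      \<open>a (x p)\<close>, and the sum over \<open>p\<close> rebuilds \<open>a u\<close>.\<close>
    also have "\<dots> = (\<Oplus>\<^bsub>B\<^esub>p\<in>I. \<Oplus>\<^bsub>B\<^esub>m\<in>I. h m (f (E (y m \<otimes>\<^bsub>B\<^esub> a (x p))) \<otimes>\<^bsub>B\<^esub> y p))"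
      using a by (intro S.finsum_swap finite_I h_closed) (auto simp: cl)
    also have "\<dots> = (\<Oplus>\<^bsub>B\<^esub>p\<in>I. a (x p) \<otimes>\<^bsub>B\<^esub> f (E (y p \<otimes>\<^bsub>B\<^esub> u)))"
    proof (rule S.finsum_cong')
      fix p assume p: "p \<in> I"
      have "(\<Oplus>\<^bsub>B\<^esub>m\<in>I. h m (f (E (y m \<otimes>\<^bsub>B\<^esub> a (x p))) \<otimes>\<^bsub>B\<^esub> y p))
          = (\<Oplus>\<^bsub>B\<^esub>m\<in>I. x m \<otimes>\<^bsub>B\<^esub> f (E (y m \<otimes>\<^bsub>B\<^esub> a (x p)))) \<otimes>\<^bsub>B\<^esub> f (E (y p \<otimes>\<^bsub>B\<^esub> u))"
        using a u p
        by (subst S.finsum_ldistr)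
          (auto simp: finite_I cl S.m_assoc h_def fE_left E_closed intro!: S.finsum_cong')
      then show "(\<Oplus>\<^bsub>B\<^esub>m\<in>I. h m (f (E (y m \<otimes>\<^bsub>B\<^esub> a (x p))) \<otimes>\<^bsub>B\<^esub> y p))
          = a (x p) \<otimes>\<^bsub>B\<^esub> f (E (y p \<otimes>\<^bsub>B\<^esub> u))"
        using a p by (simp add: dual_basis_right cl)
    qed (use a u in \<open>auto simp: cl\<close>)
    also have "\<dots> = a u" by (rule app_dual_basis[OF a u])
    finally show "finsum A ?g (I \<times> I) u = a u" .
  qed (rule a)
qed (auto simp: finite_I x_closed y_closed)

text \<open>Under the identification of \<open>A\<close> with \<open>B \<otimes> B\<close> over
  \<open>C\<close> this is \<open>\<alpha> \<otimes> \<beta>\<close> followed by multiplication: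
  \<open>rank_one b b'\<close> goes to the product of \<open>\<alpha> b\<close> and
  \<open>\<beta> b'\<close>. Right linearity needs the Casimir identity for
  \<open>B | C\<close>.\<close>

lemma bimodule_hom_convolution:
  assumes \<alpha>: "\<alpha> \<in> bimodule_hom C C (ring_bimodule B f f) (ring_bimodule A k k)"
    and \<beta>: "\<beta> \<in> bimodule_hom C C (ring_bimodule B f f) (ring_bimodule A k k)"
  shows "(\<lambda>a. \<Oplus>\<^bsub>A\<^esub>i\<in>I. \<alpha> (a (x i)) \<otimes>\<^bsub>A\<^esub> \<beta> (y i))
    \<in> bimodule_hom C C (ring_bimodule A k k) (ring_bimodule A k k)" (is "?g \<in> _")
proof -
  note \<alpha>D = bimodule_homD[OF \<alpha>, simplified] and \<beta>D = bimodule_homD[OF \<beta>, simplified]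
  have "?g \<in> hom (add_monoid A) (add_monoid A)"
    by (intro A.finsum_add_homI add_homI) (auto simp: x_closed y_closed \<alpha>D \<beta>D A.l_distr)
  moreover have "?g (lam (f c) \<otimes>\<^bsub>A\<^esub> a) = lam (f c) \<otimes>\<^bsub>A\<^esub> ?g a" if "c \<in> carrier C" "a \<in> carrier A" for c a
    using that
    by (subst A.finsum_rdistr)
      (auto simp: finite_I x_closed y_closed \<alpha>D \<beta>D A.m_assoc intro!: A.finsum_cong')
  moreover have "?g (a \<otimes>\<^bsub>A\<^esub> lam (f c)) = ?g a \<otimes>\<^bsub>A\<^esub> lam (f c)" if ca: "c \<in> carrier C" "a \<in> carrier A" for c a
  proof -
    have "balanced_map C (ring_bimodule B f f) (ring_bimodule B f f) A (\<lambda>u v. \<alpha> (a u) \<otimes>\<^bsub>A\<^esub> \<beta> v)"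
      using ca by (intro balanced_mapI)
        (auto simp: app_add app_right \<alpha>D \<beta>D A.l_distr A.r_distr A.m_assoc)
    from casimir[OF A.is_abelian_group this, of "f c"] ca
    have "(\<Oplus>\<^bsub>A\<^esub>i\<in>I. \<alpha> (a (f c \<otimes>\<^bsub>B\<^esub> x i)) \<otimes>\<^bsub>A\<^esub> \<beta> (y i)) = (\<Oplus>\<^bsub>A\<^esub>i\<in>I. \<alpha> (a (x i)) \<otimes>\<^bsub>A\<^esub> \<beta> (y i \<otimes>\<^bsub>B\<^esub> f c))"
      by simp
    moreover have "?g (a \<otimes>\<^bsub>A\<^esub> lam (f c)) = (\<Oplus>\<^bsub>A\<^esub>i\<in>I. \<alpha> (a (f c \<otimes>\<^bsub>B\<^esub> x i)) \<otimes>\<^bsub>A\<^esub> \<beta> (y i))"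
      using ca by (intro A.finsum_cong') (auto simp: x_closed y_closed \<alpha>D \<beta>D)
    moreover have "(\<Oplus>\<^bsub>A\<^esub>i\<in>I. \<alpha> (a (x i)) \<otimes>\<^bsub>A\<^esub> \<beta> (y i \<otimes>\<^bsub>B\<^esub> f c)) = ?g a \<otimes>\<^bsub>A\<^esub> lam (f c)"
      using ca by (subst A.finsum_ldistr)
        (auto simp: finite_I x_closed y_closed \<alpha>D \<beta>D A.m_assoc intro!: A.finsum_cong')
    ultimately show ?thesis by simp
  qed
  ultimately show ?thesis by (auto simp: bimodule_hom_def hom_def)
qed

lemma depth_two_if_E_mult:
  assumes J: "finite J" "J \<noteq> {}"
    and \<gamma>: "\<And>j. j \<in> J \<Longrightarrow> \<gamma> j \<in> bimodule_hom C C (ring_bimodule B f f) (ring_bimodule A k k)"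
    and \<delta>: "\<And>j. j \<in> J \<Longrightarrow> \<delta> j \<in> bimodule_hom C C (ring_bimodule B f f) (ring_bimodule A k k)"
    and E_mult: "\<And>b b'. \<lbrakk>b \<in> carrier B; b' \<in> carrier B\<rbrakk>
      \<Longrightarrow> lam (f (E (b \<otimes>\<^bsub>B\<^esub> b'))) = (\<Oplus>\<^bsub>A\<^esub>j\<in>J. \<gamma> j b \<otimes>\<^bsub>A\<^esub> \<delta> j b')"
  shows "depth_two A C k"
proof -
  note \<gamma>D = bimodule_homD[OF \<gamma>, simplified] and \<delta>D = bimodule_homD[OF \<delta>, simplified]
  note cl = x_closed y_closed \<gamma>D(1) \<delta>D(1)
  \<comment> \<open>On \<open>rank_one b b'\<close> these maps give \<open>\<gamma> i b\<close>
    times \<open>\<gamma> j b'\<close> and \<open>\<delta> j b\<close> times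
    \<open>\<delta> i b'\<close>. The indices of \<open>D\<close> are reversed because the factors
    of the inner splitting \<open>j\<close> must be neighbours.\<close>
  define G where "G i j a = (\<Oplus>\<^bsub>A\<^esub>l\<in>I. \<gamma> i (a (x l)) \<otimes>\<^bsub>A\<^esub> \<gamma> j (y l))" for i j a
  define D where "D i j a = (\<Oplus>\<^bsub>A\<^esub>l\<in>I. \<delta> j (a (x l)) \<otimes>\<^bsub>A\<^esub> \<delta> i (y l))" for i j a
  have G: "G i j \<in> bimodule_hom C C (ring_bimodule A k k) (ring_bimodule A k k)"
    and D: "D i j \<in> bimodule_hom C C (ring_bimodule A k k) (ring_bimodule A k k)"
    if "i \<in> J" "j \<in> J" for i j
    using that bimodule_hom_convolution[OF \<gamma> \<gamma>, of i j] bimodule_hom_convolution[OF \<delta> \<delta>, of j i]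
    by (auto simp: G_def[abs_def] D_def[abs_def])
  have G_closed: "G i j a \<in> carrier A" and D_closed: "D i j a \<in> carrier A"
    if "i \<in> J" "j \<in> J" "a \<in> carrier A" for i j a
    using bimodule_homD(1)[OF G] bimodule_homD(1)[OF D] that by simp_all
  \<comment> \<open>The inner splitting: expand \<open>a u\<close> in the dual basis, release the
    coefficient \<open>E (y l u)\<close> by right C-linearity of \<open>\<gamma> i\<close>, split it
    by \<open>E_mult\<close> and collect the sum over \<open>l\<close> into
    \<open>G i j a\<close>.\<close>
  have G_\<delta>: "(\<Oplus>\<^bsub>A\<^esub>j\<in>J. G i j a \<otimes>\<^bsub>A\<^esub> \<delta> j u) = \<gamma> i (a u)"
    if i: "i \<in> J" and a: "a \<in> carrier A" and u: "u \<in> carrier B" for i a u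
  proof -
    have "(\<Oplus>\<^bsub>A\<^esub>j\<in>J. G i j a \<otimes>\<^bsub>A\<^esub> \<delta> j u) = (\<Oplus>\<^bsub>A\<^esub>j\<in>J. \<Oplus>\<^bsub>A\<^esub>l\<in>I. \<gamma> i (a (x l)) \<otimes>\<^bsub>A\<^esub> (\<gamma> j (y l) \<otimes>\<^bsub>A\<^esub> \<delta> j u))"
    proof (rule A.finsum_cong')
      fix j assume j: "j \<in> J"
      show "G i j a \<otimes>\<^bsub>A\<^esub> \<delta> j u = (\<Oplus>\<^bsub>A\<^esub>l\<in>I. \<gamma> i (a (x l)) \<otimes>\<^bsub>A\<^esub> (\<gamma> j (y l) \<otimes>\<^bsub>A\<^esub> \<delta> j u))"
        unfolding G_def using i j a u
        by (subst A.finsum_ldistr) (auto simp: finite_I cl A.m_assoc intro!: A.finsum_cong')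
    qed (use i a u in \<open>auto simp: cl intro!: A.finsum_closed\<close>)
    also have "\<dots> = (\<Oplus>\<^bsub>A\<^esub>l\<in>I. \<Oplus>\<^bsub>A\<^esub>j\<in>J. \<gamma> i (a (x l)) \<otimes>\<^bsub>A\<^esub> (\<gamma> j (y l) \<otimes>\<^bsub>A\<^esub> \<delta> j u))"
      using i a u by (intro A.finsum_swap finite_I J) (auto simp: cl)
    also have "\<dots> = (\<Oplus>\<^bsub>A\<^esub>l\<in>I. \<gamma> i (a (x l) \<otimes>\<^bsub>B\<^esub> f (E (y l \<otimes>\<^bsub>B\<^esub> u))))"
    proof (rule A.finsum_cong')
      fix l assume l: "l \<in> I"
      have "(\<Oplus>\<^bsub>A\<^esub>j\<in>J. \<gamma> i (a (x l)) \<otimes>\<^bsub>A\<^esub> (\<gamma> j (y l) \<otimes>\<^bsub>A\<^esub> \<delta> j u))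
          = \<gamma> i (a (x l)) \<otimes>\<^bsub>A\<^esub> (\<Oplus>\<^bsub>A\<^esub>j\<in>J. \<gamma> j (y l) \<otimes>\<^bsub>A\<^esub> \<delta> j u)"
        using i a u l by (intro A.finsum_rdistr[symmetric] J) (auto simp: cl)
      also have "\<dots> = \<gamma> i (a (x l)) \<otimes>\<^bsub>A\<^esub> lam (f (E (y l \<otimes>\<^bsub>B\<^esub> u)))"
        using l u by (simp add: E_mult cl)
      also have "\<dots> = \<gamma> i (a (x l) \<otimes>\<^bsub>B\<^esub> f (E (y l \<otimes>\<^bsub>B\<^esub> u)))"
        using i a u l by (simp add: \<gamma>D(4) cl E_closed)
      finally show "(\<Oplus>\<^bsub>A\<^esub>j\<in>J. \<gamma> i (a (x l)) \<otimes>\<^bsub>A\<^esub> (\<gamma> j (y l) \<otimes>\<^bsub>A\<^esub> \<delta> j u))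
          = \<gamma> i (a (x l) \<otimes>\<^bsub>B\<^esub> f (E (y l \<otimes>\<^bsub>B\<^esub> u)))" .
    qed (use i a u in \<open>auto simp: cl\<close>)
    also have "\<dots> = \<gamma> i (\<Oplus>\<^bsub>B\<^esub>l\<in>I. a (x l) \<otimes>\<^bsub>B\<^esub> f (E (y l \<otimes>\<^bsub>B\<^esub> u)))"
      using i a u \<gamma>D(1,2)
      by (intro add_hom_finsum[OF S.is_abelian_group A.is_abelian_group, symmetric] add_homI) (auto simp: cl)
    finally show ?thesis using app_dual_basis[OF a u] by simp
  qed
  have mult: "lam (f (eps (a \<otimes>\<^bsub>A\<^esub> b))) = (\<Oplus>\<^bsub>A\<^esub>p\<in>J \<times> J. G (fst p) (snd p) a \<otimes>\<^bsub>A\<^esub> D (fst p) (snd p) b)"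
    if a: "a \<in> carrier A" and b: "b \<in> carrier A" for a b
  proof -
    \<comment> \<open>Applying \<open>G_\<delta>\<close> with \<open>u = b (x m)\<close> undoes the
      inner splitting and removes \<open>j\<close>. Only the outer one, indexed by \<open>i\<close>,
      is left for \<open>E_mult\<close>.\<close>
    have GD: "(\<Oplus>\<^bsub>A\<^esub>j\<in>J. G i j a \<otimes>\<^bsub>A\<^esub> D i j b) = (\<Oplus>\<^bsub>A\<^esub>m\<in>I. \<gamma> i (a (b (x m))) \<otimes>\<^bsub>A\<^esub> \<delta> i (y m))"
      if i: "i \<in> J" for i
    proof -
      have "(\<Oplus>\<^bsub>A\<^esub>j\<in>J. G i j a \<otimes>\<^bsub>A\<^esub> D i j b)
          = (\<Oplus>\<^bsub>A\<^esub>j\<in>J. \<Oplus>\<^bsub>A\<^esub>m\<in>I. G i j a \<otimes>\<^bsub>A\<^esub> \<delta> j (b (x m)) \<otimes>\<^bsub>A\<^esub> \<delta> i (y m))"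
      proof (rule A.finsum_cong')
        fix j assume j: "j \<in> J"
        show "G i j a \<otimes>\<^bsub>A\<^esub> D i j b = (\<Oplus>\<^bsub>A\<^esub>m\<in>I. G i j a \<otimes>\<^bsub>A\<^esub> \<delta> j (b (x m)) \<otimes>\<^bsub>A\<^esub> \<delta> i (y m))"
          unfolding D_def using i j a b
          by (subst A.finsum_rdistr) (auto simp: finite_I cl G_closed A.m_assoc intro!: A.finsum_cong')
      qed (use i a b in \<open>auto simp: cl G_closed intro!: A.finsum_closed\<close>)
      also have "\<dots> = (\<Oplus>\<^bsub>A\<^esub>m\<in>I. \<Oplus>\<^bsub>A\<^esub>j\<in>J. G i j a \<otimes>\<^bsub>A\<^esub> \<delta> j (b (x m)) \<otimes>\<^bsub>A\<^esub> \<delta> i (y m))"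
        using i a b by (intro A.finsum_swap finite_I J) (auto simp: cl G_closed)
      also have "\<dots> = (\<Oplus>\<^bsub>A\<^esub>m\<in>I. \<gamma> i (a (b (x m))) \<otimes>\<^bsub>A\<^esub> \<delta> i (y m))"
      proof (rule A.finsum_cong')
        fix m assume m: "m \<in> I"
        have "(\<Oplus>\<^bsub>A\<^esub>j\<in>J. G i j a \<otimes>\<^bsub>A\<^esub> \<delta> j (b (x m)) \<otimes>\<^bsub>A\<^esub> \<delta> i (y m))
            = (\<Oplus>\<^bsub>A\<^esub>j\<in>J. G i j a \<otimes>\<^bsub>A\<^esub> \<delta> j (b (x m))) \<otimes>\<^bsub>A\<^esub> \<delta> i (y m)"
          using i a b m by (intro A.finsum_ldistr[symmetric] J) (auto simp: cl G_closed)
        then show "(\<Oplus>\<^bsub>A\<^esub>j\<in>J. G i j a \<otimes>\<^bsub>A\<^esub> \<delta> j (b (x m)) \<otimes>\<^bsub>A\<^esub> \<delta> i (y m))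
            = \<gamma> i (a (b (x m))) \<otimes>\<^bsub>A\<^esub> \<delta> i (y m)"
          using G_\<delta>[OF i a, of "b (x m)"] b m by (simp add: cl)
      qed (use i a b in \<open>auto simp: cl\<close>)
      finally show ?thesis .
    qed
    have "(\<Oplus>\<^bsub>A\<^esub>p\<in>J \<times> J. G (fst p) (snd p) a \<otimes>\<^bsub>A\<^esub> D (fst p) (snd p) b)
        = (\<Oplus>\<^bsub>A\<^esub>i\<in>J. \<Oplus>\<^bsub>A\<^esub>j\<in>J. G i j a \<otimes>\<^bsub>A\<^esub> D i j b)"
      using a b by (intro A.finsum_Times J) (auto simp: G_closed D_closed)
    also have "\<dots> = (\<Oplus>\<^bsub>A\<^esub>i\<in>J. \<Oplus>\<^bsub>A\<^esub>m\<in>I. \<gamma> i (a (b (x m))) \<otimes>\<^bsub>A\<^esub> \<delta> i (y m))"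
      using a b by (intro A.finsum_cong' GD) (auto simp: cl intro!: A.finsum_closed)
    also have "\<dots> = (\<Oplus>\<^bsub>A\<^esub>m\<in>I. \<Oplus>\<^bsub>A\<^esub>i\<in>J. \<gamma> i (a (b (x m))) \<otimes>\<^bsub>A\<^esub> \<delta> i (y m))"
      using a b by (intro A.finsum_swap finite_I J) (auto simp: cl)
    also have "\<dots> = (\<Oplus>\<^bsub>A\<^esub>m\<in>I. lam (f (E (a (b (x m)) \<otimes>\<^bsub>B\<^esub> y m))))"
      using a b by (intro A.finsum_cong') (auto simp: cl E_mult)
    also have "\<dots> = lam (f (E (\<Oplus>\<^bsub>B\<^esub>m\<in>I. a (b (x m)) \<otimes>\<^bsub>B\<^esub> y m)))"
      using a b
      by (intro add_hom_finsum[OF S.is_abelian_group A.is_abelian_group, symmetric] add_homI)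
        (auto simp: cl fE_add)
    also have "(\<Oplus>\<^bsub>B\<^esub>m\<in>I. a (b (x m)) \<otimes>\<^bsub>B\<^esub> y m) = (\<Oplus>\<^bsub>B\<^esub>m\<in>I. (a \<otimes>\<^bsub>A\<^esub> b) (x m) \<otimes>\<^bsub>B\<^esub> y m)"
      using a b by (intro S.finsum_cong') (auto simp: cl)
    finally show ?thesis by (simp add: eps_def)
  qed
  have "frobenius_quasibase C A k eps (I \<times> I)
      (\<lambda>p. rank_one (x (fst p)) (x (snd p))) (\<lambda>p. rank_one (y (snd p)) (y (fst p)))
      (J \<times> J) (\<lambda>p. G (fst p) (snd p)) (\<lambda>p. D (fst p) (snd p))"
    using J G D mult
    by (intro frobenius_quasibase.intro frobenius_quasibase_axioms.intro frobenius_system_A) auto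
  then show ?thesis by (rule frobenius_quasibase.depth_two)
qed

text \<open>The tensor of 1 and \<open>rank_one \<one> b\<close> is rebuilt from its coordinates
  \<open>\<gamma> i b\<close> and the fixed tensors \<open>h i \<one>\<close>. A left A-linear map
  that sends this tensor to \<open>E (b b')\<close> turns this into the decomposition.\<close>

lemma E_mult_if_right_depth_three:
  assumes "right_depth_three A B C lam f"
  obtains N :: nat and \<gamma> \<delta> where "N > 0"
    and "\<And>i. i < N \<Longrightarrow> \<gamma> i \<in> bimodule_hom C C (ring_bimodule B f f) (ring_bimodule A k k)"
    and "\<And>i. i < N \<Longrightarrow> \<delta> i \<in> bimodule_hom C C (ring_bimodule B f f) (ring_bimodule A k k)"
    and "\<And>b b'. \<lbrakk>b \<in> carrier B; b' \<in> carrier B\<rbrakk>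
      \<Longrightarrow> lam (f (E (b \<otimes>\<^bsub>B\<^esub> b'))) = (\<Oplus>\<^bsub>A\<^esub>i\<in>{..<N}. \<gamma> i b \<otimes>\<^bsub>A\<^esub> \<delta> i b')"
proof -
  let ?L = "ring_bimodule A id lam"
  let ?R = "ring_bimodule A lam k"
  let ?M = "ring_bimodule A id k"
  have bim: "bimodule A B ?L" "bimodule B C ?R" "bimodule A C ?M"
    by (intro bimodule_ring_bimodule ring_hom_ring_id A.ring_axioms lam.ring_hom_ring_axioms k_hom)+
  interpret tensor_product A B C ?L ?R
    by (intro tensor_product.intro bim)
  note pD = balanced_mapD[OF balanced_pure, simplified]
  have pure_cl: "pure a b \<in> carrier T" if "a \<in> carrier A" "b \<in> carrier A" for a b
    using pD(1) that by blast
  obtain N where N: "N > 0" and "iso_direct_summand A C T (bimodule_power ?M N)"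
    using assms unfolding right_depth_three_def by blast
  then obtain g h where g: "\<And>i. i < N \<Longrightarrow> g i \<in> bimodule_hom A C T ?M"
    and h: "\<And>i. i < N \<Longrightarrow> h i \<in> bimodule_hom A C ?M T"
    and hg: "\<And>t. t \<in> carrier T \<Longrightarrow> (\<Oplus>\<^bsub>T\<^esub>i\<in>{..<N}. h i (g i t)) = t"
    using iso_direct_summand_powerE[OF T.bimodule_axioms bim(3)] by blast
  note gD = bimodule_homD[OF g, simplified] and hD = bimodule_homD[OF h, simplified]
  \<comment> \<open>Evaluation of the second leg at \<open>b\<close>, followed by multiplication. It
    is balanced over \<open>B\<close> since \<open>a' \<mapsto> lam (a' b)\<close> is left
    B-linear.\<close>
  have "\<exists>\<mu>. \<mu> \<in> hom (add_monoid T) (add_monoid A) \<and>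
      (\<forall>a\<in>carrier A. \<forall>a'\<in>carrier A. \<mu> (pure a a') = a \<otimes>\<^bsub>A\<^esub> lam (a' b))" if b: "b \<in> carrier B" for b
  proof -
    have "balanced_map B ?L ?R A (\<lambda>a a'. a \<otimes>\<^bsub>A\<^esub> lam (a' b))"
      by (rule balanced_mapI) (simp_all add: b A.l_distr A.r_distr A.m_assoc)
    then obtain \<mu> where "\<mu> \<in> hom (add_monoid T) (add_monoid A)"
      "\<And>a a'. \<lbrakk>a \<in> carrier ?L; a' \<in> carrier ?R\<rbrakk> \<Longrightarrow> \<mu> (pure a a') = a \<otimes>\<^bsub>A\<^esub> lam (a' b)"
      using tensor_lift[OF A.is_abelian_group] by metis
    then show ?thesis by auto
  qed
  then obtain \<mu> where \<mu>: "\<And>b. b \<in> carrier B \<Longrightarrow> \<mu> b \<in> hom (add_monoid T) (add_monoid A)"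
    and \<mu>_pure: "\<And>b a a'. \<lbrakk>b \<in> carrier B; a \<in> carrier A; a' \<in> carrier A\<rbrakk>
      \<Longrightarrow> \<mu> b (pure a a') = a \<otimes>\<^bsub>A\<^esub> lam (a' b)"
    by metis
  have \<mu>_closed: "\<mu> b t \<in> carrier A" if "b \<in> carrier B" "t \<in> carrier T" for b t
    using \<mu>[OF that(1)] that(2) by (auto simp: hom_def)
  have \<mu>_T_add: "\<mu> b (t \<oplus>\<^bsub>T\<^esub> t') = \<mu> b t \<oplus>\<^bsub>A\<^esub> \<mu> b t'"
    if "b \<in> carrier B" "t \<in> carrier T" "t' \<in> carrier T" for b t t'
    using \<mu>[OF that(1)] that(2,3) by (auto simp: hom_def)
  have \<mu>_smult: "\<mu> b (r \<odot>\<^bsub>T\<^esub> t) = r \<otimes>\<^bsub>A\<^esub> \<mu> b t"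
    if "b \<in> carrier B" "r \<in> carrier A" "t \<in> carrier T" for b r t
  proof (rule tensor_hom_eqI[OF A.is_abelian_group _ _ _ that(3)])
    show "(\<lambda>t. \<mu> b (r \<odot>\<^bsub>T\<^esub> t)) \<in> hom (add_monoid T) (add_monoid A)"
      using that by (intro add_homI) (auto simp: \<mu>_closed \<mu>_T_add T.smult_closed T.smult_r_distr)
    show "(\<lambda>t. r \<otimes>\<^bsub>A\<^esub> \<mu> b t) \<in> hom (add_monoid T) (add_monoid A)"
      using that by (intro add_homI) (auto simp: \<mu>_closed \<mu>_T_add A.r_distr)
    fix a a' assume "a \<in> carrier ?L" "a' \<in> carrier ?R"
    then show "\<mu> b (r \<odot>\<^bsub>T\<^esub> pure a a') = r \<otimes>\<^bsub>A\<^esub> \<mu> b (pure a a')"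
      using that by (subst smult_pure) (simp_all add: \<mu>_pure A.m_assoc)
  qed
  \<comment> \<open>Each \<open>\<mu> b\<close> was chosen separately, so its dependence on
    \<open>b\<close> has to be recovered on pure tensors.\<close>
  have \<mu>_add: "\<mu> (b \<oplus>\<^bsub>B\<^esub> b') t = \<mu> b t \<oplus>\<^bsub>A\<^esub> \<mu> b' t"
    if "b \<in> carrier B" "b' \<in> carrier B" "t \<in> carrier T" for b b' t
  proof (rule tensor_hom_eqI[OF A.is_abelian_group _ _ _ that(3)])
    show "\<mu> (b \<oplus>\<^bsub>B\<^esub> b') \<in> hom (add_monoid T) (add_monoid A)"
      using that by (intro \<mu>) auto
    show "(\<lambda>t. \<mu> b t \<oplus>\<^bsub>A\<^esub> \<mu> b' t) \<in> hom (add_monoid T) (add_monoid A)"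
      using that by (intro add_homI) (auto simp: \<mu>_closed \<mu>_T_add A.a_ac)
  qed (use that in \<open>simp_all add: \<mu>_pure app_add A.r_distr\<close>)
  \<comment> \<open>Evaluating \<open>a'\<close> at \<open>f c\<close> times \<open>b\<close> is
    evaluating \<open>a'\<close> composed with \<open>lam (f c)\<close> at \<open>b\<close>; a left
    scalar on \<open>b\<close> therefore becomes a right scalar on the tensor.\<close>
  have \<mu>_left: "\<mu> (f c \<otimes>\<^bsub>B\<^esub> b) t = \<mu> b (t \<odot>\<^sub>r\<^bsub>T\<^esub> c)"
    if "b \<in> carrier B" "c \<in> carrier C" "t \<in> carrier T" for b c t
  proof (rule tensor_hom_eqI[OF A.is_abelian_group _ _ _ that(3)])
    show "\<mu> (f c \<otimes>\<^bsub>B\<^esub> b) \<in> hom (add_monoid T) (add_monoid A)"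
      using that by (intro \<mu>) auto
    show "(\<lambda>t. \<mu> b (t \<odot>\<^sub>r\<^bsub>T\<^esub> c)) \<in> hom (add_monoid T) (add_monoid A)"
      using that by (intro add_homI) (auto simp: \<mu>_closed \<mu>_T_add T.rsmult_closed T.rsmult_l_distr)
    fix a a' assume "a \<in> carrier ?L" "a' \<in> carrier ?R"
    then show "\<mu> (f c \<otimes>\<^bsub>B\<^esub> b) (pure a a') = \<mu> b (pure a a' \<odot>\<^sub>r\<^bsub>T\<^esub> c)"
      using that by (subst rsmult_pure) (simp_all add: \<mu>_pure)
  qed
  have \<mu>_right: "\<mu> (b \<otimes>\<^bsub>B\<^esub> f c) t = \<mu> b t \<otimes>\<^bsub>A\<^esub> lam (f c)"
    if "b \<in> carrier B" "c \<in> carrier C" "t \<in> carrier T" for b c t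
  proof (rule tensor_hom_eqI[OF A.is_abelian_group _ _ _ that(3)])
    show "\<mu> (b \<otimes>\<^bsub>B\<^esub> f c) \<in> hom (add_monoid T) (add_monoid A)"
      using that by (intro \<mu>) auto
    show "(\<lambda>t. \<mu> b t \<otimes>\<^bsub>A\<^esub> lam (f c)) \<in> hom (add_monoid T) (add_monoid A)"
      using that by (intro add_homI) (auto simp: \<mu>_closed \<mu>_T_add A.l_distr)
  qed (use that in \<open>simp_all add: \<mu>_pure app_right A.m_assoc\<close>)
  \<comment> \<open>Here \<open>rank_one \<one> b\<close> is the functional
    \<open>u \<mapsto> E (b u)\<close> regarded as an element of \<open>A\<close>; evaluated at
    \<open>b'\<close> it gives \<open>E (b b')\<close>.\<close>
  define \<gamma> where "\<gamma> i b = g i (pure \<one>\<^bsub>A\<^esub> (rank_one \<one>\<^bsub>B\<^esub> b))" for i b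
  \<comment> \<open>By left A-linearity \<open>h i\<close> is determined by its value at 1.\<close>
  define \<delta> where "\<delta> i b = \<mu> b (h i \<one>\<^bsub>A\<^esub>)" for i b
  have "\<gamma> i \<in> bimodule_hom C C (ring_bimodule B f f) (ring_bimodule A k k)" if i: "i < N" for i
  proof (rule bimodule_homI; simp)
    fix b assume b: "b \<in> carrier B"
    show "\<gamma> i b \<in> carrier A" using i b by (simp add: \<gamma>_def gD pure_cl)
    show "\<gamma> i (b \<oplus>\<^bsub>B\<^esub> b') = \<gamma> i b \<oplus>\<^bsub>A\<^esub> \<gamma> i b'" if b': "b' \<in> carrier B" for b'
    proof -
      have "rank_one \<one>\<^bsub>B\<^esub> (b \<oplus>\<^bsub>B\<^esub> b') = rank_one \<one>\<^bsub>B\<^esub> b \<oplus>\<^bsub>A\<^esub> rank_one \<one>\<^bsub>B\<^esub> b'"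
        using b b' by (intro A_eqI) (auto simp: fE_add S.l_distr)
      then show ?thesis using i b b' by (simp add: \<gamma>_def gD pD pure_cl)
    qed
    show "\<gamma> i (f c \<otimes>\<^bsub>B\<^esub> b) = lam (f c) \<otimes>\<^bsub>A\<^esub> \<gamma> i b" if c: "c \<in> carrier C" for c
    proof -
      have "rank_one \<one>\<^bsub>B\<^esub> (f c \<otimes>\<^bsub>B\<^esub> b) = lam (f c) \<otimes>\<^bsub>A\<^esub> rank_one \<one>\<^bsub>B\<^esub> b"
        using b c by (intro A_eqI) (auto simp: fE_left S.m_assoc)
      \<comment> \<open>As the tensor product is over \<open>B\<close>, \<open>lam (f c)\<close>
        moves to the first leg, where \<open>g i\<close> is linear.\<close>
      moreover have "pure \<one>\<^bsub>A\<^esub> (lam (f c) \<otimes>\<^bsub>A\<^esub> rank_one \<one>\<^bsub>B\<^esub> b)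
          = lam (f c) \<odot>\<^bsub>T\<^esub> pure \<one>\<^bsub>A\<^esub> (rank_one \<one>\<^bsub>B\<^esub> b)"
        using b c pD(4)[of "\<one>\<^bsub>A\<^esub>" "f c" "rank_one \<one>\<^bsub>B\<^esub> b"] by (subst smult_pure) simp_all
      ultimately show ?thesis using i b c by (simp add: \<gamma>_def gD pure_cl)
    qed
    show "\<gamma> i (b \<otimes>\<^bsub>B\<^esub> f c) = \<gamma> i b \<otimes>\<^bsub>A\<^esub> lam (f c)" if c: "c \<in> carrier C" for c
    proof -
      have "rank_one \<one>\<^bsub>B\<^esub> (b \<otimes>\<^bsub>B\<^esub> f c) = rank_one \<one>\<^bsub>B\<^esub> b \<otimes>\<^bsub>A\<^esub> lam (f c)"
        using b c by (intro A_eqI) (auto simp: S.m_assoc)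
      moreover have "pure \<one>\<^bsub>A\<^esub> (rank_one \<one>\<^bsub>B\<^esub> b \<otimes>\<^bsub>A\<^esub> lam (f c))
          = pure \<one>\<^bsub>A\<^esub> (rank_one \<one>\<^bsub>B\<^esub> b) \<odot>\<^sub>r\<^bsub>T\<^esub> c"
        using b c by (subst rsmult_pure) simp_all
      ultimately show ?thesis using i b c by (simp add: \<gamma>_def gD pure_cl)
    qed
  qed
  moreover have "\<delta> i \<in> bimodule_hom C C (ring_bimodule B f f) (ring_bimodule A k k)" if i: "i < N" for i
  proof (rule bimodule_homI; simp)
    have t: "h i \<one>\<^bsub>A\<^esub> \<in> carrier T" using i by (simp add: hD)
    fix b assume b: "b \<in> carrier B"
    show "\<delta> i b \<in> carrier A" using t b by (simp add: \<delta>_def \<mu>_closed)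
    show "\<delta> i (b \<oplus>\<^bsub>B\<^esub> b') = \<delta> i b \<oplus>\<^bsub>A\<^esub> \<delta> i b'" if "b' \<in> carrier B" for b'
      using t b that by (simp add: \<delta>_def \<mu>_add)
    show "\<delta> i (f c \<otimes>\<^bsub>B\<^esub> b) = lam (f c) \<otimes>\<^bsub>A\<^esub> \<delta> i b" if c: "c \<in> carrier C" for c
    proof -
      \<comment> \<open>Both sides are the value of \<open>h i\<close> at \<open>lam (f c)\<close>,
        once by right C-linearity and once by left A-linearity.\<close>
      have "h i \<one>\<^bsub>A\<^esub> \<odot>\<^sub>r\<^bsub>T\<^esub> c = lam (f c) \<odot>\<^bsub>T\<^esub> h i \<one>\<^bsub>A\<^esub>"
        using i c by (simp flip: hD(3,4))
      then show ?thesis using t b c by (simp add: \<delta>_def \<mu>_left \<mu>_smult)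
    qed
    show "\<delta> i (b \<otimes>\<^bsub>B\<^esub> f c) = \<delta> i b \<otimes>\<^bsub>A\<^esub> lam (f c)" if "c \<in> carrier C" for c
      using t b that by (simp add: \<delta>_def \<mu>_right)
  qed
  moreover have "lam (f (E (b \<otimes>\<^bsub>B\<^esub> b'))) = (\<Oplus>\<^bsub>A\<^esub>i\<in>{..<N}. \<gamma> i b \<otimes>\<^bsub>A\<^esub> \<delta> i b')"
    if b: "b \<in> carrier B" "b' \<in> carrier B" for b b'
  proof -
    define t where "t = pure \<one>\<^bsub>A\<^esub> (rank_one \<one>\<^bsub>B\<^esub> b)"
    have t: "t \<in> carrier T" using b by (simp add: t_def pure_cl)
    have "lam (f (E (b \<otimes>\<^bsub>B\<^esub> b'))) = \<mu> b' t"
      using b by (simp add: t_def \<mu>_pure)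
    also have "\<dots> = \<mu> b' (\<Oplus>\<^bsub>T\<^esub>i\<in>{..<N}. h i (g i t))"
      using hg[OF t] by simp
    also have "\<dots> = (\<Oplus>\<^bsub>A\<^esub>i\<in>{..<N}. \<mu> b' (h i (g i t)))"
      using t by (intro add_hom_finsum[OF T.abelian_group_axioms A.is_abelian_group \<mu>[OF b(2)]])
        (auto simp: gD hD)
    also have "\<dots> = (\<Oplus>\<^bsub>A\<^esub>i\<in>{..<N}. \<gamma> i b \<otimes>\<^bsub>A\<^esub> \<delta> i b')"
    proof (rule A.finsum_cong')
      fix i assume "i \<in> {..<N}"
      then have i: "i < N" by simp
      \<comment> \<open>The coordinate \<open>g i t\<close> is an element of \<open>A\<close> and
        can be pulled out as a left scalar from \<open>h i\<close>.\<close>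
      have "h i (g i t) = g i t \<odot>\<^bsub>T\<^esub> h i \<one>\<^bsub>A\<^esub>"
        using i t by (simp add: gD flip: hD(3))
      then show "\<mu> b' (h i (g i t)) = \<gamma> i b \<otimes>\<^bsub>A\<^esub> \<delta> i b'"
        using i t b by (simp add: \<gamma>_def \<delta>_def \<mu>_smult gD hD flip: t_def)
    qed (use t b in \<open>auto simp: \<gamma>_def \<delta>_def \<mu>_closed gD hD simp flip: t_def\<close>)
    finally show ?thesis .
  qed
  ultimately show thesis using that N by blast
qed

end

theorem theorem2p5:
  fixes B :: "('b, 'm) ring_scheme" and C :: "('c, 'n) ring_scheme" and f :: "'c \<Rightarrow> 'b"
  assumes "frobenius_extension B C f"
    and "right_depth_three (extension_End B C f) B C (left_regular B) f"
  shows "depth_two (extension_End B C f) C (left_regular B \<circ> f)"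
proof -
  obtain E n x y where "frobenius_system C B f E {..<n::nat} x y"
    using assms(1) by (rule frobenius_extensionE)
  then interpret frobenius_endomorphisms C B f E "{..<n}" x y
    by (rule frobenius_endomorphisms.intro)
  show ?thesis
    \<comment> \<open>The index set is \<open>{..<N}\<close> for the exponent \<open>N\<close> of
      the depth three condition; it is nonempty because \<open>N\<close> is positive.\<close>
    by (rule E_mult_if_right_depth_three[OF assms(2)])
      (rule depth_two_if_E_mult[of "{..<_}"], auto)
qed

end
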